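(* Let $n\ge3$ and $\gamma_1,\dots,\gamma_n>\frac12$. With the notation of the context, for a suitable choice of the phases of the unit vectors $|\tilde{\mathbf j}\rangle$ and $|\tilde{\mathbf s}\rangle$, the overlap coefficients are proportional to multivariate Bannai--Ito polynomials: for all $\tilde{\mathbf j},\tilde{\mathbf s}\in\mathbb N^{n-1}$, $$\langle\tilde j_{n-1},\dots,\tilde j_1|\tilde s_{n-1},\dots,\tilde s_1\rangle=\delta_{|\tilde{\mathbf s}_{n-1}|,|\tilde{\mathbf j}_{n-1}|}\,C_{\tilde{\mathbf s},\tilde{\mathbf j}}\,B_{(\tilde j_1,\dots,\tilde j_{n-2})}\big((\tilde s_1,\tilde s_1+\tilde s_2,\dots,|\tilde{\mathbf s}_{n-2}|);\boldsymbol\alpha,\beta,|\tilde{\mathbf s}_{n-1}|\big),$$ where $\boldsymbol\alpha=(2\gamma_1+2\gamma_2-1,2\gamma_3,\dots,2\gamma_n)$, $\beta=2\gamma_2-1$ and $$C_{\tilde{\mathbf s},\tilde{\mathbf j}}=\sqrt{\frac{\Omega\big((\tilde s_1,\dots,|\tilde{\mathbf s}_{n-2}|),(\tilde j_1,\dots,\tilde j_{n-2});\boldsymbol\alpha,\beta,|\tilde{\mathbf s}_{n-1}|\big)}{H\big((\tilde j_1,\dots,\tilde j_{n-2});\boldsymbol\alpha,\beta,|\tilde{\mathbf s}_{n-1}|\big)}}.$$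
   Context: Notation: $\mathbb N=\{0,1,\dots\}$, $[i;j]=\{i,\dots,j\}$, $\gamma_A=\sum_{t\in A}\gamma_t$, $\alpha_A=\sum_{t\in A}\alpha_t$, $(a)_m=\prod_{t=0}^{m-1}(a+t)$, $|\mathbf v_m|=v_1+\dots+v_m$. For $m\in\mathbb N$ write $m=2m_e+m_p$ with $m_e\in\mathbb N$, $m_p\in\{0,1\}$. Lie superalgebra $\mathfrak{osp}(1|2)$ (with grade involution $P$): generators $A_0,A_\pm,P$, relations $[A_0,A_\pm]=\pm A_\pm$, $A_+A_-+A_-A_+=2A_0$, $[P,A_0]=0$, $PA_\pm=-A_\pm P$, $P^2=1$. Coproduct $\Delta(A_\pm)=A_\pm\otimes P+1\otimes A_\pm$, $\Delta(A_0)=A_0\otimes1+1\otimes A_0$, $\Delta(P)=P\otimes P$ (componentwise product on tensor powers); $\Delta^{(1)}=\mathrm{id}$, $\Delta^{(d)}=(1^{\otimes(d-2)}\otimes\Delta)\Delta^{(d-1)}$. Casimir $\Gamma=(-A_+A_-+A_0-\frac12)P$; $\Gamma_{[k;l]}=1^{\otimes(k-1)}\otimes\Delta^{(l-k+1)}(\Gamma)\otimes1^{\otimes(n-l)}$; $(A_0)_{[1;n]}=\Delta^{(n)}(A_0)$. Module $\widetilde W^{(\gamma)}$: orthonormal basis $|m\rangle_\gamma$, $m\in\mathbb N$, $A_+|m\rangle=\sqrt{\sigma_{m+1}}|m+1\rangle$, $A_-|m\rangle=\sqrt{\sigma_m}|m-1\rangle$, $A_0|m\rangle=(m+\gamma)|m\rangle$,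 $P|m\rangle=(-1)^m|m\rangle$, with $\sigma_m=m+(1-(-1)^m)(\gamma-\frac12)$. Everything acts on $\widetilde W^{(\gamma_1)}\otimes\dots\otimes\widetilde W^{(\gamma_n)}$. $|\tilde{\mathbf s}\rangle=|\tilde s_{n-1},\dots,\tilde s_1\rangle$ is the unit vector (unique up to phase) with $\Gamma_{[1;k+1]}|\tilde{\mathbf s}\rangle=(-1)^{|\tilde{\mathbf s}_k|}(|\tilde{\mathbf s}_k|+\gamma_{[1;k+1]}-\frac12)|\tilde{\mathbf s}\rangle$ for $k\in[1;n-1]$ and $(A_0)_{[1;n]}|\tilde{\mathbf s}\rangle=(|\tilde{\mathbf s}_{n-1}|+\gamma_{[1;n]})|\tilde{\mathbf s}\rangle$. $|\tilde{\mathbf j}\rangle=|\tilde j_{n-1},\dots,\tilde j_1\rangle$ is the unit vector (unique up to phase) with $\Gamma_{[2;k+1]}|\tilde{\mathbf j}\rangle=(-1)^{|\tilde{\mathbf j}_{k-1}|}(|\tilde{\mathbf j}_{k-1}|+\gamma_{[2;k+1]}-\frac12)|\tilde{\mathbf j}\rangle$ for $k\in[2;n-1]$, $\Gamma_{[1;n]}|\tilde{\mathbf j}\rangle=(-1)^{|\tilde{\mathbf j}_{n-1}|}(|\tilde{\mathbf j}_{n-1}|+\gamma_{[1;n]}-\frac12)|\tilde{\mathbf j}\rangle$ and $(A_0)_{[1;n]}|\tilde{\mathbf j}\rangle=(|\tilde{\mathbf j}_{n-1}|+\gamma_{[1;n]})|\tilde{\mathbf j}\rangle$. Univariate Bannai--Ito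 polynomials $B_m(x)=B_m(x;\rho_1,\rho_2,r_1,r_2)$: $B_{-1}=0$, $B_0=1$, $xB_m=B_{m+1}+(\rho_1-A_m-C_m)B_m+A_{m-1}C_mB_{m-1}$, $$A_m=\frac{(m+2\rho_1-2r_1+m_p(2\rho_2-2r_2)+1)(m+2\rho_1-2r_2+m_p(2r_2+2\rho_2)+1)}{4(m+\rho_1+\rho_2-r_1-r_2+1)},$$ $$C_m=-\frac{(m+m_p(2\rho_2-2r_2))(m-2r_1-2r_2+m_p(2r_2+2\rho_2))}{4(m+\rho_1+\rho_2-r_1-r_2)}.$$ Multivariate Bannai--Ito polynomials: for $\mathbf n\in\mathbb N^s$, $N_k=n_1+\dots+n_k$, $x_{s+1}=N$, $$B_{\mathbf n}(\mathbf x;\alpha_1,\dots,\alpha_{s+1},\beta,N)=\prod_{k=1}^sB_{n_k}\Big(\tfrac{(-1)^{N_{k-1}+x_k}}2\big(x_k+\tfrac{\alpha_{[1;k]}}2\big)-\tfrac14;\rho_1^{(k)},\rho_2^{(k)},r_1^{(k)},r_2^{(k)}\Big),$$ with $X_k=\frac{(-1)^{N_{k-1}+x_{k+1}}}2(x_{k+1}+\frac{\alpha_{[1;k+1]}}2)$ and $\rho_1^{(k)}=\frac{N_{k-1}}2+\frac{\alpha_{[1;k]}-1}4$, $\rho_2^{(k)}=X_k+\frac{\alpha_{k+1}-1}4$, $r_1^{(k)}=X_k-\frac{\alpha_{k+1}-1}4$, $r_2^{(k)}=-\frac{N_{k-1}}2+\frac{\alpha_1-\alpha_{[2;k]}-1}4-\frac\beta2$.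 Weights: for $\boldsymbol\ell\in\mathbb N^s$ with $0\le\ell_1\le\dots\le\ell_s\le N=:\ell_{s+1}$, $$\Omega(\boldsymbol\ell,\mathbf n;\boldsymbol\alpha,\beta,N)=\frac{\prod_{i=1}^sw^{(i)}}{\prod_{i=1}^{s-1}h^{(i)}},\qquad H(\mathbf n;\boldsymbol\alpha,\beta,N)=h^{(s)},$$ where $\Omega:=0$ if $\ell_i<N_{i-1}$ for some $i$ (and $C_{\tilde{\mathbf s},\tilde{\mathbf j}}:=0$ in that case); otherwise, with $x_{k}=\ell_{k}$ in $\rho^{(i)}_a,r^{(i)}_a$ (written $\rho_a,r_a$ below), $k=\ell_i-N_{i-1}$, $M=\ell_{i+1}-N_{i-1}$, $m=n_i$, $$w^{(i)}=(-1)^{k_p}\frac{(\rho_1+\rho_2+1)_{k_e}(\rho_1-r_1+\frac12)_{k_e+k_p}(\rho_1-r_2+\frac12)_{k_e+k_p}(2\rho_1+1)_{k_e}}{k_e!\,(\rho_1+r_2+\frac12)_{k_e+k_p}(\rho_1+r_1+\frac12)_{k_e+k_p}(\rho_1-\rho_2+1)_{k_e}},$$ $$h^{(i)}=\frac{M_e!\,m_e!}{(M_e-m_e-m_p(1-M_p))!}\cdot\frac{(\rho_1+\rho_2-r_1-r_2+m_e+1)_{M_e+M_p-m_e}}{(\rho_2-r_1+m_e+m_p+\frac12)_{M_e+M_p-m_e-m_p}}$$ $$\times\frac{(2\rho_1+1)_{M_e+M_p}\,\big(M_p(\rho_1-\rho_2-r_1+r_2)+\rho_2-r_2+\frac12\big)_{m_e+m_p}}{(\rho_1+r_2+\frac12)_{M_e-m_e+M_p(1-m_p)}\big((\rho_1+\rho_2-r_1-r_2+m_e+1)_{m_e+m_p}\big)^2}$$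 $$\times(\rho_1-r_2+\tfrac12)_{m_e+m_p}\big(-M_p(\rho_1+\rho_2+r_1+r_2)+\rho_1+\rho_2+1\big)_{m_e}.$$ *)

theory Defs
  imports Complex_Main
begin

section \<open>The superalgebra \<open>osp(1|2)\<close> and its coproduct\<close>

text \<open>
  The unit is listed among the letters, so that the coproduct of a letter is a sum of pure
  tensors of letters; a list of pairs (or of lists) of letters stands for the sum of the
  corresponding pure tensors.
\<close>

datatype letter = A0 | Ap | Am | Pinv | Unit

fun coproduct :: "letter \<Rightarrow> (letter \<times> letter) list" where
  "coproduct A0 = [(A0, Unit), (Unit, A0)]"
| "coproduct Ap = [(Ap, Pinv), (Unit, Ap)]"
| "coproduct Am = [(Am, Pinv), (Unit, Am)]"
| "coproduct Pinv = [(Pinv, Pinv)]"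
| "coproduct Unit = [(Unit, Unit)]"

text \<open>
  \<open>\<Delta>\<^sup>(\<^sup>1\<^sup>) = id\<close> and \<open>\<Delta>\<^sup>(\<^sup>d\<^sup>) = (1 \<otimes> \<dots> \<otimes> 1 \<otimes> \<Delta>) \<Delta>\<^sup>(\<^sup>d\<^sup>-\<^sup>1\<^sup>)\<close>;
  the value at \<open>d = 0\<close> is irrelevant.
\<close>

fun iter_coproduct :: "nat \<Rightarrow> letter \<Rightarrow> letter list list" where
  "iter_coproduct 0 g = []"
| "iter_coproduct (Suc 0) g = [[g]]"
| "iter_coproduct (Suc (Suc d)) g =
     concat (map (\<lambda>t. map (\<lambda>(a, b). butlast t @ [a, b]) (coproduct (last t)))
       (iter_coproduct (Suc d) g))"

text \<open>Expressions denoting elements of the algebra; they are only evaluated in modules.\<close>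

datatype alg = Gen letter | Add alg alg | Mul alg alg | Scale complex alg

definition casimir :: alg where
  "casimir =
     Mul (Add (Add (Scale (-1) (Mul (Gen Ap) (Gen Am))) (Gen A0)) (Scale (-1/2) (Gen Unit)))
         (Gen Pinv)"

section \<open>The tensor product module\<close>

text \<open>
  The basis vector \<open>|m\<^sub>1\<rangle> \<otimes> \<dots> \<otimes> |m\<^sub>n\<rangle>\<close> is indexed by the list \<open>[m\<^sub>1, \<dots>, m\<^sub>n]\<close>, and a vector is
  given by its coordinates in this orthonormal basis.  The Hilbert space completion is not
  needed: eigenvectors of \<open>(A\<^sub>0)\<^bsub>[1;n]\<^esub>\<close> have finite support.
\<close>

type_synonym tvec = "nat list \<Rightarrow> complex"

definition tensor_space :: "nat \<Rightarrow> tvec set" where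
  "tensor_space n = {v. finite {m. v m \<noteq> 0} \<and> (\<forall>m. v m \<noteq> 0 \<longrightarrow> length m = n)}"

text \<open>Antilinear in the first argument, as for \<open>\<langle>u|v\<rangle>\<close>.\<close>

definition overlap :: "tvec \<Rightarrow> tvec \<Rightarrow> complex" where
  "overlap u v = (\<Sum>m | u m \<noteq> 0. cnj (u m) * v m)"

definition sigma :: "real \<Rightarrow> nat \<Rightarrow> real" where
  "sigma g m = real m + (1 - (-1) ^ m) * (g - 1/2)"

text \<open>
  On the module with parameter \<open>g\<close>, a letter \<open>a\<close> maps \<open>|m\<rangle>\<close> to
  \<open>site_coeff g a m |site_shift a m\<rangle>\<close>.  For \<open>A\<^sub>-\<close> at \<open>m = 0\<close> the shift is truncated, but
  the coefficient is \<open>sigma g 0 = 0\<close>.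
\<close>

fun site_coeff :: "real \<Rightarrow> letter \<Rightarrow> nat \<Rightarrow> real" where
  "site_coeff g A0 m = real m + g"
| "site_coeff g Ap m = sqrt (sigma g (m + 1))"
| "site_coeff g Am m = sqrt (sigma g m)"
| "site_coeff g Pinv m = (-1) ^ m"
| "site_coeff g Unit m = 1"

fun site_shift :: "letter \<Rightarrow> nat \<Rightarrow> nat" where
  "site_shift A0 m = m"
| "site_shift Ap m = m + 1"
| "site_shift Am m = m - 1"
| "site_shift Pinv m = m"
| "site_shift Unit m = m"

text \<open>
  Action of a pure tensor of letters: no sign appears, as the product on tensor powers is
  componentwise.  The parameters \<open>\<gamma> 1, \<gamma> 2, \<dots>\<close> are numbered from 1.
\<close>

definition tensor_act :: "(nat \<Rightarrow> real) \<Rightarrow> letter list \<Rightarrow> tvec \<Rightarrow> tvec" where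
  "tensor_act \<gamma> gs v = (\<lambda>x. \<Sum>m | v m \<noteq> 0.
     v m * of_real (\<Prod>i<length gs. site_coeff (\<gamma> (Suc i)) (gs ! i) (m ! i))
         * of_bool (x = map2 site_shift gs m))"

text \<open>\<open>1 \<otimes> \<dots> \<otimes> 1 \<otimes> \<Delta>\<^sup>(\<^sup>l\<^sup>-\<^sup>k\<^sup>+\<^sup>1\<^sup>)(g) \<otimes> 1 \<otimes> \<dots> \<otimes> 1\<close>, first for a letter, then
  extended to the algebra, \<open>\<Delta>\<^sup>(\<^sup>d\<^sup>)\<close> being an algebra morphism.\<close>

definition letter_act :: "(nat \<Rightarrow> real) \<Rightarrow> nat \<Rightarrow> nat \<Rightarrow> nat \<Rightarrow> letter \<Rightarrow> tvec \<Rightarrow> tvec" where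
  "letter_act \<gamma> n k l g v = (\<lambda>x. \<Sum>t\<leftarrow>iter_coproduct (l + 1 - k) g.
     tensor_act \<gamma> (replicate (k - 1) Unit @ t @ replicate (n - l) Unit) v x)"

primrec alg_act :: "(nat \<Rightarrow> real) \<Rightarrow> nat \<Rightarrow> nat \<Rightarrow> nat \<Rightarrow> alg \<Rightarrow> tvec \<Rightarrow> tvec" where
  "alg_act \<gamma> n k l (Gen g) v = letter_act \<gamma> n k l g v"
| "alg_act \<gamma> n k l (Add a b) v = (\<lambda>x. alg_act \<gamma> n k l a v x + alg_act \<gamma> n k l b v x)"
| "alg_act \<gamma> n k l (Mul a b) v = alg_act \<gamma> n k l a (alg_act \<gamma> n k l b v)"
| "alg_act \<gamma> n k l (Scale c a) v = (\<lambda>x. c * alg_act \<gamma> n k l a v x)"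

definition Gamma_op :: "(nat \<Rightarrow> real) \<Rightarrow> nat \<Rightarrow> nat \<Rightarrow> nat \<Rightarrow> tvec \<Rightarrow> tvec" where
  "Gamma_op \<gamma> n k l = alg_act \<gamma> n k l casimir"

definition A0_op :: "(nat \<Rightarrow> real) \<Rightarrow> nat \<Rightarrow> tvec \<Rightarrow> tvec" where
  "A0_op \<gamma> n = alg_act \<gamma> n 1 n (Gen A0)"

section \<open>The two bases\<close>

text \<open>The list \<open>s\<close> is \<open>[s\<^sub>1, \<dots>, s\<^bsub>n-1\<^esub>]\<close>, so that \<open>psum s k\<close> is \<open>s\<^sub>1 + \<dots> + s\<^sub>k\<close>.\<close>

definition psum :: "nat list \<Rightarrow> nat \<Rightarrow> nat" where
  "psum s k = sum_list (take k s)"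

definition is_eigen :: "(tvec \<Rightarrow> tvec) \<Rightarrow> real \<Rightarrow> tvec \<Rightarrow> bool" where
  "is_eigen T c v \<longleftrightarrow> T v = (\<lambda>x. of_real c * v x)"

definition gamma_eigenvalue :: "(nat \<Rightarrow> real) \<Rightarrow> nat \<Rightarrow> nat \<Rightarrow> nat \<Rightarrow> real" where
  "gamma_eigenvalue \<gamma> k l q = (-1) ^ q * (real q + (\<Sum>t = k..l. \<gamma> t) - 1/2)"

definition is_s_vector :: "(nat \<Rightarrow> real) \<Rightarrow> nat \<Rightarrow> nat list \<Rightarrow> tvec \<Rightarrow> bool" where
  "is_s_vector \<gamma> n s v \<longleftrightarrow>
     v \<in> tensor_space n \<and> overlap v v = 1 \<and>
     (\<forall>k\<in>{1..n-1}. is_eigen (Gamma_op \<gamma> n 1 (k+1))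
        (gamma_eigenvalue \<gamma> 1 (k+1) (psum s k)) v) \<and>
     is_eigen (A0_op \<gamma> n) (real (psum s (n-1)) + (\<Sum>t = 1..n. \<gamma> t)) v"

definition is_j_vector :: "(nat \<Rightarrow> real) \<Rightarrow> nat \<Rightarrow> nat list \<Rightarrow> tvec \<Rightarrow> bool" where
  "is_j_vector \<gamma> n j v \<longleftrightarrow>
     v \<in> tensor_space n \<and> overlap v v = 1 \<and>
     (\<forall>k\<in>{2..n-1}. is_eigen (Gamma_op \<gamma> n 2 (k+1))
        (gamma_eigenvalue \<gamma> 2 (k+1) (psum j (k-1))) v) \<and>
     is_eigen (Gamma_op \<gamma> n 1 n) (gamma_eigenvalue \<gamma> 1 n (psum j (n-1))) v \<and>
     is_eigen (A0_op \<gamma> n) (real (psum j (n-1)) + (\<Sum>t = 1..n. \<gamma> t)) v"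

section \<open>Univariate Bannai--Ito polynomials\<close>

definition BI_A :: "real \<Rightarrow> real \<Rightarrow> real \<Rightarrow> real \<Rightarrow> nat \<Rightarrow> real" where
  "BI_A \<rho>1 \<rho>2 r1 r2 m =
     (real m + 2*\<rho>1 - 2*r1 + real (m mod 2) * (2*\<rho>2 - 2*r2) + 1) *
     (real m + 2*\<rho>1 - 2*r2 + real (m mod 2) * (2*r2 + 2*\<rho>2) + 1) /
     (4 * (real m + \<rho>1 + \<rho>2 - r1 - r2 + 1))"

definition BI_C :: "real \<Rightarrow> real \<Rightarrow> real \<Rightarrow> real \<Rightarrow> nat \<Rightarrow> real" where
  "BI_C \<rho>1 \<rho>2 r1 r2 m =
     - ((real m + real (m mod 2) * (2*\<rho>2 - 2*r2)) *
        (real m - 2*r1 - 2*r2 + real (m mod 2) * (2*r2 + 2*\<rho>2)) /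
        (4 * (real m + \<rho>1 + \<rho>2 - r1 - r2)))"

fun BI_poly :: "real \<Rightarrow> real \<Rightarrow> real \<Rightarrow> real \<Rightarrow> nat \<Rightarrow> real \<Rightarrow> real" where
  "BI_poly \<rho>1 \<rho>2 r1 r2 0 x = 1"
| "BI_poly \<rho>1 \<rho>2 r1 r2 (Suc 0) x = x - (\<rho>1 - BI_A \<rho>1 \<rho>2 r1 r2 0 - BI_C \<rho>1 \<rho>2 r1 r2 0)"
| "BI_poly \<rho>1 \<rho>2 r1 r2 (Suc (Suc m)) x =
     (x - (\<rho>1 - BI_A \<rho>1 \<rho>2 r1 r2 (Suc m) - BI_C \<rho>1 \<rho>2 r1 r2 (Suc m)))
       * BI_poly \<rho>1 \<rho>2 r1 r2 (Suc m) x
     - BI_A \<rho>1 \<rho>2 r1 r2 m * BI_C \<rho>1 \<rho>2 r1 r2 (Suc m) * BI_poly \<rho>1 \<rho>2 r1 r2 m x"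

section \<open>Multivariate Bannai--Ito polynomials\<close>

text \<open>
  Tuples are functions on \<open>nat\<close> read at the indices \<open>1, 2, \<dots>\<close>; below, \<open>y\<close> is the value
  \<open>x\<^bsub>k+1\<^esub>\<close> (resp.\ \<open>\<ell>\<^bsub>k+1\<^esub>\<close>) entering the parameters at level \<open>k\<close>, and
  \<open>Nprev d k\<close> is \<open>N\<^bsub>k-1\<^esub> = d\<^sub>1 + \<dots> + d\<^bsub>k-1\<^esub>\<close>.
\<close>

definition Nprev :: "(nat \<Rightarrow> nat) \<Rightarrow> nat \<Rightarrow> nat" where
  "Nprev d k = (\<Sum>t = 1..<k. d t)"

definition BI_X :: "(nat \<Rightarrow> real) \<Rightarrow> (nat \<Rightarrow> nat) \<Rightarrow> nat \<Rightarrow> nat \<Rightarrow> real" where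
  "BI_X \<alpha> d y k = (-1) ^ (Nprev d k + y) / 2 * (real y + (\<Sum>t = 1..k+1. \<alpha> t) / 2)"

definition par_rho1 :: "(nat \<Rightarrow> real) \<Rightarrow> (nat \<Rightarrow> nat) \<Rightarrow> nat \<Rightarrow> real" where
  "par_rho1 \<alpha> d k = real (Nprev d k) / 2 + ((\<Sum>t = 1..k. \<alpha> t) - 1) / 4"

definition par_rho2 :: "(nat \<Rightarrow> real) \<Rightarrow> (nat \<Rightarrow> nat) \<Rightarrow> nat \<Rightarrow> nat \<Rightarrow> real" where
  "par_rho2 \<alpha> d y k = BI_X \<alpha> d y k + (\<alpha> (k+1) - 1) / 4"

definition par_r1 :: "(nat \<Rightarrow> real) \<Rightarrow> (nat \<Rightarrow> nat) \<Rightarrow> nat \<Rightarrow> nat \<Rightarrow> real" where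
  "par_r1 \<alpha> d y k = BI_X \<alpha> d y k - (\<alpha> (k+1) - 1) / 4"

definition par_r2 :: "(nat \<Rightarrow> real) \<Rightarrow> real \<Rightarrow> (nat \<Rightarrow> nat) \<Rightarrow> nat \<Rightarrow> real" where
  "par_r2 \<alpha> \<beta> d k =
     - real (Nprev d k) / 2 + (\<alpha> 1 - (\<Sum>t = 2..k. \<alpha> t) - 1) / 4 - \<beta> / 2"

text \<open>\<open>x(s + 1 := N)\<close> implements the convention \<open>x\<^bsub>s+1\<^esub> = N\<close>.\<close>

definition multi_BI ::
  "nat \<Rightarrow> (nat \<Rightarrow> nat) \<Rightarrow> (nat \<Rightarrow> nat) \<Rightarrow> (nat \<Rightarrow> real) \<Rightarrow> real \<Rightarrow> nat \<Rightarrow> real" where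
  "multi_BI s d x \<alpha> \<beta> N =
     (\<Prod>k = 1..s. let y = (x(s + 1 := N)) (k + 1) in
        BI_poly (par_rho1 \<alpha> d k) (par_rho2 \<alpha> d y k) (par_r1 \<alpha> d y k) (par_r2 \<alpha> \<beta> d k) (d k)
          ((-1) ^ (Nprev d k + x k) / 2 * (real (x k) + (\<Sum>t = 1..k. \<alpha> t) / 2) - 1/4))"

section \<open>Weights and norms\<close>

definition weight1 :: "real \<Rightarrow> real \<Rightarrow> real \<Rightarrow> real \<Rightarrow> nat \<Rightarrow> real" where
  "weight1 \<rho>1 \<rho>2 r1 r2 k =
     (let e = k div 2; p = k mod 2 in
      (-1) ^ p *
      (pochhammer (\<rho>1 + \<rho>2 + 1) e * pochhammer (\<rho>1 - r1 + 1/2) (e + p) *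
       pochhammer (\<rho>1 - r2 + 1/2) (e + p) * pochhammer (2*\<rho>1 + 1) e) /
      (fact e * pochhammer (\<rho>1 + r2 + 1/2) (e + p) *
       pochhammer (\<rho>1 + r1 + 1/2) (e + p) * pochhammer (\<rho>1 - \<rho>2 + 1) e))"

text \<open>If \<open>m \<le> M\<close>, no subtraction of naturals below is truncated.  In the other case the
  resulting value is always multiplied by zero.\<close>

definition norm1 :: "real \<Rightarrow> real \<Rightarrow> real \<Rightarrow> real \<Rightarrow> nat \<Rightarrow> nat \<Rightarrow> real" where
  "norm1 \<rho>1 \<rho>2 r1 r2 M m =
     (let Me = M div 2; Mp = M mod 2; me = m div 2; mp = m mod 2;
          g = \<rho>1 + \<rho>2 - r1 - r2 in
      fact Me * fact me / fact (Me - me - mp * (1 - Mp)) *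
      (pochhammer (g + real me + 1) (Me + Mp - me) /
       pochhammer (\<rho>2 - r1 + real me + real mp + 1/2) (Me + Mp - me - mp)) *
      (pochhammer (2*\<rho>1 + 1) (Me + Mp) *
       pochhammer (real Mp * (\<rho>1 - \<rho>2 - r1 + r2) + \<rho>2 - r2 + 1/2) (me + mp) /
       (pochhammer (\<rho>1 + r2 + 1/2) (Me - me + Mp * (1 - mp)) *
        (pochhammer (g + real me + 1) (me + mp))\<^sup>2)) *
      pochhammer (\<rho>1 - r2 + 1/2) (me + mp) *
      pochhammer (- real Mp * (\<rho>1 + \<rho>2 + r1 + r2) + \<rho>1 + \<rho>2 + 1) me)"

definition level_weight ::
  "(nat \<Rightarrow> nat) \<Rightarrow> (nat \<Rightarrow> nat) \<Rightarrow> (nat \<Rightarrow> real) \<Rightarrow> real \<Rightarrow> nat \<Rightarrow> real" where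
  "level_weight l d \<alpha> \<beta> i =
     weight1 (par_rho1 \<alpha> d i) (par_rho2 \<alpha> d (l (i+1)) i) (par_r1 \<alpha> d (l (i+1)) i)
       (par_r2 \<alpha> \<beta> d i) (l i - Nprev d i)"

definition level_norm ::
  "nat \<Rightarrow> (nat \<Rightarrow> nat) \<Rightarrow> (nat \<Rightarrow> real) \<Rightarrow> real \<Rightarrow> nat \<Rightarrow> real" where
  "level_norm y d \<alpha> \<beta> i =
     norm1 (par_rho1 \<alpha> d i) (par_rho2 \<alpha> d y i) (par_r1 \<alpha> d y i) (par_r2 \<alpha> \<beta> d i)
       (y - Nprev d i) (d i)"

definition Omega ::
  "nat \<Rightarrow> (nat \<Rightarrow> nat) \<Rightarrow> (nat \<Rightarrow> nat) \<Rightarrow> (nat \<Rightarrow> real) \<Rightarrow> real \<Rightarrow> nat \<Rightarrow> real" where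
  "Omega s l d \<alpha> \<beta> N =
     (if \<exists>i\<in>{1..s}. l i < Nprev d i then 0
      else (\<Prod>i = 1..s. level_weight (l(s + 1 := N)) d \<alpha> \<beta> i) /
           (\<Prod>i = 1..s-1. level_norm (l (i+1)) d \<alpha> \<beta> i))"

definition Hnorm ::
  "nat \<Rightarrow> (nat \<Rightarrow> nat) \<Rightarrow> (nat \<Rightarrow> real) \<Rightarrow> real \<Rightarrow> nat \<Rightarrow> real" where
  "Hnorm s d \<alpha> \<beta> N = level_norm N d \<alpha> \<beta> s"

section \<open>The specialization of the parameters\<close>

definition alpha_of :: "(nat \<Rightarrow> real) \<Rightarrow> nat \<Rightarrow> real" where
  "alpha_of \<gamma> k = (if k = 1 then 2 * \<gamma> 1 + 2 * \<gamma> 2 - 1 else 2 * \<gamma> (k + 1))"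

definition beta_of :: "(nat \<Rightarrow> real) \<Rightarrow> real" where
  "beta_of \<gamma> = 2 * \<gamma> 2 - 1"

text \<open>If \<open>Omega\<close> vanishes by its first case, so does \<open>C_coeff\<close>, whatever the denominator.\<close>

definition C_coeff :: "(nat \<Rightarrow> real) \<Rightarrow> nat \<Rightarrow> nat list \<Rightarrow> nat list \<Rightarrow> real" where
  "C_coeff \<gamma> n s j =
     sqrt (Omega (n-2) (psum s) (\<lambda>k. j ! (k-1)) (alpha_of \<gamma>) (beta_of \<gamma>) (psum s (n-1)) /
           Hnorm (n-2) (\<lambda>k. j ! (k-1)) (alpha_of \<gamma>) (beta_of \<gamma>) (psum s (n-1)))"

end

theory Submission
  imports Defs
begin

text \<open>
  By Clebsch--Gordan decomposition, two neighbouring sites of parameters \<open>a\<close> and \<open>b\<close> contain,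
  for each \<open>N\<close>, one copy of the module of parameter \<open>a + b + N\<close>, on which their Casimir operator is
  the scalar \<open>(-1)\<^sup>N (N + a + b - 1/2)\<close>.  Merging repeatedly the sites 1 and 2 gives the vectors
  \<open>|s\<rangle>\<close>; merging repeatedly the sites 2 and 3, and finally the last two, gives the vectors \<open>|j\<rangle>\<close>.
  They are unique up to phase, since an eigenvector of a total Casimir operator is determined by its
  coordinates with last (or first) entry 0, which removes one site.

  For three sites, the two bases are compared on the vectors killed by \<open>A\<^sub>-\<close>, which are
  determined by their coordinates \<open>|M - i, 0, i\<rangle>\<close>.  There \<open>\<Gamma>\<^bsub>12\<^esub>\<close> is upper and \<open>\<Gamma>\<^bsub>23\<^esub>\<close> lower
  bidiagonal, and \<open>\<Gamma>\<^bsub>12\<^esub>\<close> is tridiagonal in the eigenbasis of \<open>\<Gamma>\<^bsub>23\<^esub>\<close>, with the recurrence coefficients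
  of the Bannai--Ito polynomials.  The normalization follows from the symmetry of \<open>\<Gamma>\<^bsub>12\<^esub>\<close> and from
  exchanging the outer sites.

  For \<open>n\<close> sites, replacing the merging of 1, 2 and then 3 by that of 2, 3 and then 1 leaves the same
  problem with one site less, so that the overlap is a product of \<open>n - 2\<close> three-site coefficients.
\<close>

section \<open>Coordinates of the action\<close>

text \<open>The delicate point is the sign. One choice of phases must serve all pairs of vectors at
  once, with a square root in front of the polynomials, while the three-site computation determines
  only the square of this prefactor. Hence the model vectors \<open>Sv\<close> and \<open>Jv\<close>
  carry explicit phases, and all signs are tracked until the prefactor is seen to be positive. The
  square needs two inputs. The symmetry of \<Gamma>_12 gives its dependence on the row m of the
  overlap matrix. Row 0 is obtained by computing its entries from both sides: one way expands a
  vector |s> in the |j>, the other expands |j> with m = 0 in the |s>. The second is the same problem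
  with the outer sites exchanged, and there the polynomial is evaluated at \<rho>_1, where it is an
  explicit product. All operators have real matrices. The work is therefore done with real functions
  on lists, and a complex eigenvector is treated through its real and imaginary part. The sites are
  indexed by all naturals, so that merging two of them merely shifts the remaining
  parameters.\<close>

abbreviation (input) shift :: "(nat \<Rightarrow> 'a) \<Rightarrow> nat \<Rightarrow> 'a" where
  "shift g \<equiv> \<lambda>i. g (Suc i)"

text \<open>
  A letter \<open>t\<close> sends the vector with coordinates \<open>v\<close> to the one whose coordinate at \<open>x\<close> is that of \<open>v\<close>
  at \<open>site_pre t x\<close>, multiplied by \<open>site_val g t x\<close>.
\<close>

fun site_pre :: "letter \<Rightarrow> nat \<Rightarrow> nat" where
  "site_pre Ap m = m - 1"
| "site_pre Am m = Suc m"
| "site_pre _ m = m"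

fun site_val :: "real \<Rightarrow> letter \<Rightarrow> nat \<Rightarrow> real" where
  "site_val g A0 m = real m + g"
| "site_val g Ap m = sqrt (sigma g m)"
| "site_val g Am m = sqrt (sigma g (Suc m))"
| "site_val g Pinv m = (-1) ^ m"
| "site_val g Unit m = 1"

fun pull :: "(nat \<Rightarrow> real) \<Rightarrow> letter list \<Rightarrow> (nat list \<Rightarrow> 'a::real_algebra_1) \<Rightarrow> nat list \<Rightarrow> 'a" where
  "pull g (t # ts) v (a # x) =
     of_real (site_val (g 0) t a) * pull (shift g) ts (\<lambda>r. v (site_pre t a # r)) x"
| "pull g _ v x = v x"

lemma sigma_0 [simp]: "sigma g 0 = 0"
  by (simp add: sigma_def)

text \<open>Pushing basis vectors forward and pulling coordinates back agree wherever the
  coefficient is nonzero. The truncated subtractions, A_- at 0 on one side and A_+ at coordinate 0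
  on the other, both carry the factor \<open>sigma g 0 = 0\<close>.\<close>

lemma site_shift_pre:
  assumes "site_coeff g t m \<noteq> 0"
  shows "site_pre t (site_shift t m) = m" and "site_val g t (site_shift t m) = site_coeff g t m"
  using assms by (cases t; cases m; simp)+

lemma site_pre_shift:
  assumes "site_val g t x \<noteq> 0"
  shows "site_shift t (site_pre t x) = x" and "site_coeff g t (site_pre t x) = site_val g t x"
  using assms by (cases t; cases x; simp)+

lemma pull_eq_prod:
  "length ts = length x \<Longrightarrow> pull g ts v x =
     of_real (\<Prod>i<length ts. site_val (g i) (ts ! i) (x ! i)) * v (map2 site_pre ts x)"
proof (induction ts arbitrary: g v x)
  case Nil
  then show ?case by simp
next
  case (Cons t ts)
  then obtain a y where x: "x = a # y" and y: "length ts = length y" by (cases x) auto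
  show ?case
    using Cons.IH[OF y]
    by (simp add: x prod.lessThan_Suc_shift mult.assoc del: prod.lessThan_Suc)
qed

lemma map2_site_pre_shift:
  assumes "length m = length ts" "\<And>i. i < length ts \<Longrightarrow> site_coeff (g i) (ts ! i) (m ! i) \<noteq> 0"
  shows "map2 site_pre ts (map2 site_shift ts m) = m"
    and "i < length ts \<Longrightarrow> site_val (g i) (ts ! i) (map2 site_shift ts m ! i) = site_coeff (g i) (ts ! i) (m ! i)"
proof -
  show "map2 site_pre ts (map2 site_shift ts m) = m"
  proof (rule nth_equalityI)
    fix i assume "i < length (map2 site_pre ts (map2 site_shift ts m))"
    then show "map2 site_pre ts (map2 site_shift ts m) ! i = m ! i"
      using assms(1) site_shift_pre(1)[OF assms(2)[of i]] by simp
  qed (use assms(1) in simp)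
  show "i < length ts \<Longrightarrow> site_val (g i) (ts ! i) (map2 site_shift ts m ! i) = site_coeff (g i) (ts ! i) (m ! i)"
    using assms(1) site_shift_pre(2)[OF assms(2)[of i]] by simp
qed

lemma map2_site_shift_pre:
  assumes "length x = length ts" "\<And>i. i < length ts \<Longrightarrow> site_val (g i) (ts ! i) (x ! i) \<noteq> 0"
  shows "map2 site_shift ts (map2 site_pre ts x) = x"
    and "i < length ts \<Longrightarrow> site_coeff (g i) (ts ! i) (map2 site_pre ts x ! i) = site_val (g i) (ts ! i) (x ! i)"
proof -
  show "map2 site_shift ts (map2 site_pre ts x) = x"
  proof (rule nth_equalityI)
    fix i assume "i < length (map2 site_shift ts (map2 site_pre ts x))"
    then show "map2 site_shift ts (map2 site_pre ts x) ! i = x ! i"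
      using assms(1) site_pre_shift(1)[OF assms(2)[of i]] by simp
  qed (use assms(1) in simp)
  show "i < length ts \<Longrightarrow> site_coeff (g i) (ts ! i) (map2 site_pre ts x ! i) = site_val (g i) (ts ! i) (x ! i)"
    using assms(1) site_pre_shift(2)[OF assms(2)[of i]] by simp
qed

text \<open>At most one basis vector m contributes to the coordinate x. If a factor on the left
  vanishes, m can still be the preimage of x, but then the product \<open>s\<close> of the values at
  x vanishes as well.\<close>

lemma tensor_act_term:
  fixes g :: "nat \<Rightarrow> real"
  assumes "length m = length ts" "length x = length ts"
  defines "c \<equiv> \<lambda>m. \<Prod>i<length ts. site_coeff (g i) (ts ! i) (m ! i)"
    and "s \<equiv> \<Prod>i<length ts. site_val (g i) (ts ! i) (x ! i)"
  shows "c m * of_bool (x = map2 site_shift ts m) = (if m = map2 site_pre ts x then s else 0)"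
proof (cases "c m \<noteq> 0 \<and> x = map2 site_shift ts m")
  case True
  then have nz: "i < length ts \<Longrightarrow> site_coeff (g i) (ts ! i) (m ! i) \<noteq> 0" for i
    by (simp add: c_def)
  have "m = map2 site_pre ts x"
    using True map2_site_pre_shift(1)[where g = g, OF assms(1) nz] by simp
  moreover have "s = c m"
    unfolding s_def c_def
    using True map2_site_pre_shift(2)[where g = g, OF assms(1) nz] by (intro prod.cong) simp_all
  ultimately show ?thesis using True by (simp only: if_True simp_thms of_bool_eq mult_1_right)
next
  case False
  have "s = 0" if "m = map2 site_pre ts x"
  proof (rule ccontr)
    assume "s \<noteq> 0"
    then have nz: "i < length ts \<Longrightarrow> site_val (g i) (ts ! i) (x ! i) \<noteq> 0" for i
      by (simp add: s_def)
    have "x = map2 site_shift ts m"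
      using that map2_site_shift_pre(1)[where g = g, OF assms(2) nz] by simp
    moreover have "c m = s"
      unfolding s_def c_def that
      using map2_site_shift_pre(2)[where g = g, OF assms(2) nz] by (intro prod.cong) simp_all
    ultimately show False using False \<open>s \<noteq> 0\<close> by blast
  qed
  moreover have "c m * of_bool (x = map2 site_shift ts m) = 0"
    using False by (cases "c m = 0") (simp_all only: of_bool_eq simp_thms mult_zero_left mult_zero_right)
  ultimately show ?thesis by (simp only: if_cancel split: if_split) blast
qed

lemma tensor_act_eq_pull:
  assumes v: "v \<in> tensor_space n" and ts: "length ts = n"
  shows "tensor_act \<gamma> ts v x = (if length x = n then pull (shift \<gamma>) ts v x else 0)"
proof -
  let ?c = "\<lambda>m. \<Prod>i<length ts. site_coeff (\<gamma> (Suc i)) (ts ! i) (m ! i)"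
  let ?p = "map2 site_pre ts x"
  have fin: "finite {m. v m \<noteq> 0}" and len: "\<And>m. v m \<noteq> 0 \<Longrightarrow> length m = n"
    using v by (auto simp: tensor_space_def)
  show ?thesis
  proof (cases "length x = n")
    case False
    have "x \<noteq> map2 site_shift ts m" if "v m \<noteq> 0" for m
      using len[OF that] ts False by auto
    then have "tensor_act \<gamma> ts v x = 0"
      unfolding tensor_act_def by (intro sum.neutral ballI) (simp only: mem_Collect_eq of_bool_eq simp_thms mult_zero_right)
    then show ?thesis using False by simp
  next
    case True
    define s where "s = (\<Prod>i<length ts. site_val (\<gamma> (Suc i)) (ts ! i) (x ! i))"
    have single: "v m * of_real (?c m) * of_bool (x = map2 site_shift ts m)
        = (if m = ?p then v ?p * of_real s else 0)" if "v m \<noteq> 0" for m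
    proof -
      have of_bool: "complex_of_real (of_bool Q) = of_bool Q" for Q by (cases Q) simp_all
      have "?c m * of_bool (x = map2 site_shift ts m) = (if m = ?p then s else 0)"
        unfolding s_def using len[OF that] ts True by (intro tensor_act_term) simp_all
      then have "complex_of_real (?c m * of_bool (x = map2 site_shift ts m)) = (if m = ?p then of_real s else 0)"
        by (simp only: of_real_0 split: if_split) blast
      then have "complex_of_real (?c m) * of_bool (x = map2 site_shift ts m) = (if m = ?p then of_real s else 0)"
        using of_bool by (simp only: of_real_mult)
      then show ?thesis by (simp only: mult.assoc mult_zero_right split: if_split) blast
    qed
    have "tensor_act \<gamma> ts v x = (\<Sum>m | v m \<noteq> 0. if m = ?p then v ?p * of_real s else 0)"
      unfolding tensor_act_def by (intro sum.cong) (use single in simp_all)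
    also have "\<dots> = v ?p * of_real s"
      using fin by (cases "v ?p = 0") (simp_all add: sum.delta')
    finally show ?thesis
      using True ts pull_eq_prod[of ts x "shift \<gamma>" v] by (simp add: s_def)
  qed
qed

text \<open>A_- at one of the first k sites is accompanied by P at the later sites of this block,
  whence the sign; the sites beyond k are spectators.\<close>

fun lower_op :: "(nat \<Rightarrow> real) \<Rightarrow> nat \<Rightarrow> (nat list \<Rightarrow> real) \<Rightarrow> nat list \<Rightarrow> real" where
  "lower_op g (Suc k) v (a # r) =
     (-1) ^ sum_list (take k r) * sqrt (sigma (g 0) (Suc a)) * v (Suc a # r)
     + lower_op (shift g) k (\<lambda>r. v (a # r)) r"
| "lower_op g _ v _ = 0"

fun raise_op :: "(nat \<Rightarrow> real) \<Rightarrow> nat \<Rightarrow> (nat list \<Rightarrow> real) \<Rightarrow> nat list \<Rightarrow> real" where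
  "raise_op g (Suc k) v (a # r) =
     (-1) ^ sum_list (take k r) * sqrt (sigma (g 0) a) * v ((a - 1) # r)
     + raise_op (shift g) k (\<lambda>r. v (a # r)) r"
| "raise_op g _ v _ = 0"

text \<open>The parity operator of the Casimir element stands in front here: A_+ A_- and A_0
  preserve the parity, so P commutes with the other factor.\<close>

definition Gam :: "(nat \<Rightarrow> real) \<Rightarrow> nat \<Rightarrow> (nat list \<Rightarrow> real) \<Rightarrow> nat list \<Rightarrow> real" where
  "Gam g k v x = (-1) ^ sum_list (take k x) *
     ((real (sum_list (take k x)) + (\<Sum>i<k. g i) - 1/2) * v x - raise_op g k (lower_op g k v) x)"

section \<open>The iterated coproduct of a letter\<close>

definition expand :: "letter list \<Rightarrow> letter list list" where
  "expand t = map (\<lambda>(a, b). butlast t @ [a, b]) (coproduct (last t))"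

lemma expand_Cons: "t \<noteq> [] \<Longrightarrow> expand (u # t) = map ((#) u) (expand t)"
  by (simp add: expand_def case_prod_unfold)

lemma iter_coproduct_Suc: "iter_coproduct (Suc (Suc d)) g = concat (map expand (iter_coproduct (Suc d) g))"
  by (simp add: expand_def[abs_def])

declare iter_coproduct.simps(3) [simp del]

lemma expand_replicate:
  assumes "coproduct u = [(u, u)]"
  shows "expand (replicate (Suc d) u) = [replicate (Suc (Suc d)) u]"
  using assms
proof (induction d)
  case 0
  then show ?case by (simp add: expand_def)
next
  case (Suc d)
  have "expand (replicate (Suc (Suc d)) u) = map ((#) u) (expand (replicate (Suc d) u))"
    by (simp add: expand_Cons)
  then show ?case using Suc by simp
qed

lemma iter_coproduct_grouplike:
  assumes "coproduct u = [(u, u)]"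
  shows "iter_coproduct (Suc d) u = [replicate (Suc d) u]"
proof (induction d)
  case (Suc d)
  then show ?case
    using expand_replicate[OF assms, of d] unfolding iter_coproduct_Suc by simp
qed simp

lemma iter_coproduct_nonempty: "t \<in> set (iter_coproduct (Suc d) g) \<Longrightarrow> length t = Suc d"
proof (induction d arbitrary: t)
  case (Suc d)
  then obtain t' where t': "t' \<in> set (iter_coproduct (Suc d) g)" and t: "t \<in> set (expand t')"
    unfolding iter_coproduct_Suc by auto
  have "length t' = Suc d" using Suc.IH[OF t'] .
  then show ?case using t by (auto simp: expand_def)
qed simp

text \<open>The iterated coproduct expands its last factor, whereas \<open>lower_op\<close> and
  \<open>raise_op\<close> recurse on the first site. For letters with \<Delta>(g) = g \<otimes> u +
  1 \<otimes> g and u group-like, one recursion turns into the other; here u is P for A_+ and A_-,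
  and 1 for A_0.\<close>

lemma iter_coproduct_primitive:
  assumes g: "coproduct g = [(g, u), (Unit, g)]" and u: "coproduct u = [(u, u)]"
  shows "iter_coproduct (Suc (Suc d)) g =
    (g # replicate (Suc d) u) # map ((#) Unit) (iter_coproduct (Suc d) g)"
proof (induction d)
  case 0
  then show ?case using g by (simp add: expand_def iter_coproduct.simps(3))
next
  case (Suc d)
  have "concat (map expand (map ((#) Unit) (iter_coproduct (Suc d) g)))
      = map ((#) Unit) (concat (map expand (iter_coproduct (Suc d) g)))"
    unfolding map_concat map_map
    by (intro arg_cong[where f = concat] map_cong refl)
       (simp, subst expand_Cons, use iter_coproduct_nonempty in fastforce, simp)
  moreover have "expand (g # replicate (Suc d) u) = [g # replicate (Suc (Suc d)) u]"
    using expand_replicate[OF u, of d] by (simp add: expand_Cons)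
  ultimately show ?case
    unfolding iter_coproduct_Suc[of "Suc d"] Suc
    by (simp add: iter_coproduct_Suc[of d, symmetric] del: map_map) (simp add: Suc)
qed

lemma pull_units: "length x = m \<Longrightarrow> pull g (replicate m Unit) v x = v x"
  by (induction m arbitrary: g v x) (auto simp: length_Suc_conv)

lemma pull_parity_units:
  "length x = d + m \<Longrightarrow> pull g (replicate d Pinv @ replicate m Unit) v x
     = of_real ((-1) ^ sum_list (take d x)) * v x"
  by (induction d arbitrary: g v x) (auto simp: pull_units length_Suc_conv power_add mult.assoc)

definition acts :: "(nat \<Rightarrow> real) \<Rightarrow> nat \<Rightarrow> letter \<Rightarrow> (nat list \<Rightarrow> complex) \<Rightarrow> nat list \<Rightarrow> complex" where
  "acts g k u v x = (\<Sum>t\<leftarrow>iter_coproduct k u. pull g (t @ replicate (length x - k) Unit) v x)"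

lemma acts_parity: "0 < k \<Longrightarrow> k \<le> length x \<Longrightarrow>
    acts g k Pinv v x = of_real ((-1) ^ sum_list (take k x)) * v x"
  using iter_coproduct_grouplike[of Pinv "k - 1"] by (simp add: acts_def pull_parity_units)

lemma acts_unit: "0 < k \<Longrightarrow> k \<le> length x \<Longrightarrow> acts g k Unit v x = v x"
  using iter_coproduct_grouplike[of Unit "k - 1"]
  by (simp add: acts_def pull_units flip: replicate_add)

lemma acts_primitive:
  assumes "coproduct u = [(u, w), (Unit, u)]" "coproduct w = [(w, w)]" "Suc d \<le> length r"
  shows "acts g (Suc (Suc d)) u v (a # r) =
    of_real (site_val (g 0) u a) *
      pull (shift g) (replicate (Suc d) w @ replicate (length r - Suc d) Unit) (\<lambda>r. v (site_pre u a # r)) r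
    + acts (shift g) (Suc d) u (\<lambda>r. v (a # r)) r"
  unfolding acts_def iter_coproduct_primitive[OF assms(1,2)] by (simp add: o_def)

lemma acts_Am: "0 < k \<Longrightarrow> k \<le> length x \<Longrightarrow>
  acts g k Am v x = Complex (lower_op g k (\<lambda>y. Re (v y)) x) (lower_op g k (\<lambda>y. Im (v y)) x)"
proof (induction k arbitrary: g v x)
  case (Suc k)
  then obtain a r where x: "x = a # r" by (cases x) auto
  show ?case
  proof (cases k)
    case 0
    then show ?thesis by (simp add: x acts_def pull_units complex_eq_iff)
  next
    case (Suc d)
    then have "acts (shift g) k Am (\<lambda>r. v (a # r)) r =
       Complex (lower_op (shift g) k (\<lambda>y. Re (v (a # y))) r) (lower_op (shift g) k (\<lambda>y. Im (v (a # y))) r)"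
      using Suc.prems Suc.IH[of r "shift g" "\<lambda>r. v (a # r)"] x by simp
    then show ?thesis
      using Suc.prems acts_primitive[of Am Pinv d r g v a]
        pull_parity_units[of r "Suc d" "length r - Suc d" "shift g" "\<lambda>r. v (Suc a # r)"]
      by (simp add: x Suc complex_eq_iff ac_simps)
  qed
qed simp

lemma acts_Ap: "0 < k \<Longrightarrow> k \<le> length x \<Longrightarrow>
  acts g k Ap v x = Complex (raise_op g k (\<lambda>y. Re (v y)) x) (raise_op g k (\<lambda>y. Im (v y)) x)"
proof (induction k arbitrary: g v x)
  case (Suc k)
  then obtain a r where x: "x = a # r" by (cases x) auto
  show ?case
  proof (cases k)
    case 0
    then show ?thesis by (simp add: x acts_def pull_units complex_eq_iff)
  next
    case (Suc d)
    then have "acts (shift g) k Ap (\<lambda>r. v (a # r)) r =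
       Complex (raise_op (shift g) k (\<lambda>y. Re (v (a # y))) r) (raise_op (shift g) k (\<lambda>y. Im (v (a # y))) r)"
      using Suc.prems Suc.IH[of r "shift g" "\<lambda>r. v (a # r)"] x by simp
    then show ?thesis
      using Suc.prems acts_primitive[of Ap Pinv d r g v a]
        pull_parity_units[of r "Suc d" "length r - Suc d" "shift g" "\<lambda>r. v ((a - 1) # r)"]
      by (simp add: x Suc complex_eq_iff ac_simps)
  qed
qed simp

lemma acts_A0: "0 < k \<Longrightarrow> k \<le> length x \<Longrightarrow>
  acts g k A0 v x = of_real (real (sum_list (take k x)) + (\<Sum>i<k. g i)) * v x"
proof (induction k arbitrary: g v x)
  case (Suc k)
  then obtain a r where x: "x = a # r" by (cases x) auto
  show ?case
  proof (cases k)
    case 0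
    then show ?thesis by (simp add: x acts_def pull_units)
  next
    case (Suc d)
    then have "acts (shift g) k A0 (\<lambda>r. v (a # r)) r =
       of_real (real (sum_list (take k r)) + (\<Sum>i<k. g (Suc i))) * v (a # r)"
      using Suc.prems Suc.IH[of r "shift g" "\<lambda>r. v (a # r)"] x by simp
    moreover have "pull (shift g) (replicate (Suc d) Unit @ replicate (length r - Suc d) Unit)
        (\<lambda>r. v (a # r)) r = v (a # r)"
      using Suc.prems x Suc unfolding replicate_add[symmetric] by (intro pull_units) simp
    ultimately show ?thesis
      using Suc.prems acts_primitive[of A0 Unit d r g v a]
      by (simp add: x Suc sum.lessThan_Suc_shift algebra_simps
          del: sum.lessThan_Suc replicate.simps replicate_Suc)
  qed
qed simp

lemma lower_op_cong:
  "(\<And>y. length y = length x \<Longrightarrow> f y = h y) \<Longrightarrow> lower_op g k f x = lower_op g k h x"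
proof (induction k arbitrary: g f h x)
  case (Suc k)
  show ?case
  proof (cases x)
    case (Cons a r)
    have "lower_op (shift g) k (\<lambda>r. f (a # r)) r = lower_op (shift g) k (\<lambda>r. h (a # r)) r"
      using Suc.prems Cons by (intro Suc.IH) simp
    then show ?thesis using Suc.prems Cons by simp
  qed simp
qed simp

lemma raise_op_cong:
  "(\<And>y. length y = length x \<Longrightarrow> f y = h y) \<Longrightarrow> raise_op g k f x = raise_op g k h x"
proof (induction k arbitrary: g f h x)
  case (Suc k)
  show ?case
  proof (cases x)
    case (Cons a r)
    have "raise_op (shift g) k (\<lambda>r. f (a # r)) r = raise_op (shift g) k (\<lambda>r. h (a # r)) r"
      using Suc.prems Cons by (intro Suc.IH) simp
    then show ?thesis using Suc.prems Cons by simp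
  qed simp
qed simp

lemma lower_op_cmult: "lower_op g k (\<lambda>y. c * f y) x = c * lower_op g k f x"
  by (induction g k f x rule: lower_op.induct) (simp_all add: algebra_simps)

lemma raise_op_cmult: "raise_op g k (\<lambda>y. c * f y) x = c * raise_op g k f x"
  by (induction g k f x rule: raise_op.induct) (simp_all add: algebra_simps)

lemma lower_op_add: "lower_op g k (\<lambda>y. f y + h y) x = lower_op g k f x + lower_op g k h x"
proof (induction k arbitrary: g f h x)
  case (Suc k)
  then show ?case by (cases x) (simp_all add: algebra_simps)
qed simp

lemma raise_op_add: "raise_op g k (\<lambda>y. f y + h y) x = raise_op g k f x + raise_op g k h x"
proof (induction k arbitrary: g f h x)
  case (Suc k)
  then show ?case by (cases x) (simp_all add: algebra_simps)
qed simp

text \<open>Each term changes the degree of the block by one, so A_- anticommutes with P.\<close>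

lemma lower_op_parity:
  "lower_op g k (\<lambda>y. (-1) ^ sum_list (take k y) * v y) x = - ((-1) ^ sum_list (take k x)) * lower_op g k v x"
proof (induction k arbitrary: g v x)
  case (Suc k)
  show ?case
  proof (cases x)
    case (Cons a r)
    have "lower_op (shift g) k (\<lambda>r. (-1) ^ (a + sum_list (take k r)) * v (a # r)) r
      = (-1) ^ a * lower_op (shift g) k (\<lambda>r. (-1) ^ sum_list (take k r) * v (a # r)) r"
      unfolding lower_op_cmult[symmetric] by (simp add: power_add mult.assoc)
    then show ?thesis
      using Suc.IH[of "shift g" "\<lambda>r. v (a # r)" r] Cons by (simp add: power_add algebra_simps)
  qed simp
qed simp

lemma raise_op_parity:
  "raise_op g k (\<lambda>y. (-1) ^ sum_list (take k y) * v y) x = - ((-1) ^ sum_list (take k x)) * raise_op g k v x"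
proof (induction k arbitrary: g v x)
  case (Suc k)
  show ?case
  proof (cases x)
    case (Cons a r)
    have "raise_op (shift g) k (\<lambda>r. (-1) ^ (a + sum_list (take k r)) * v (a # r)) r
      = (-1) ^ a * raise_op (shift g) k (\<lambda>r. (-1) ^ sum_list (take k r) * v (a # r)) r"
      unfolding raise_op_cmult[symmetric] by (simp add: power_add mult.assoc)
    then show ?thesis
      using Suc.IH[of "shift g" "\<lambda>r. v (a # r)" r] Cons
      by (cases a) (simp_all add: power_add algebra_simps)
  qed simp
qed simp

lemma Gam_eq_casimir:
  "Gam g k v x =
     - raise_op g k (lower_op g k (\<lambda>y. (-1) ^ sum_list (take k y) * v y)) x
     + (real (sum_list (take k x)) + (\<Sum>i<k. g i)) * ((-1) ^ sum_list (take k x) * v x)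
     - 1/2 * ((-1) ^ sum_list (take k x) * v x)"
proof -
  have "lower_op g k (\<lambda>y. (-1) ^ sum_list (take k y) * v y)
      = (\<lambda>y. (-1) * ((-1) ^ sum_list (take k y) * lower_op g k v y))"
    by (simp add: fun_eq_iff lower_op_parity)
  then have "raise_op g k (lower_op g k (\<lambda>y. (-1) ^ sum_list (take k y) * v y)) x
      = (-1) ^ sum_list (take k x) * raise_op g k (lower_op g k v) x"
    by (simp only: raise_op_cmult raise_op_parity)
  then show ?thesis
    by (simp only: Gam_def) (simp add: algebra_simps)
qed

section \<open>The module operators as real operators on coordinates\<close>

lemma tensor_act_space:
  assumes "v \<in> tensor_space n" "length ts = n"
  shows "tensor_act \<gamma> ts v \<in> tensor_space n"
proof -
  have "{x. tensor_act \<gamma> ts v x \<noteq> 0} \<subseteq> map2 site_shift ts ` {m. v m \<noteq> 0}"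
  proof
    fix x assume "x \<in> {x. tensor_act \<gamma> ts v x \<noteq> 0}"
    then have "tensor_act \<gamma> ts v x \<noteq> 0" by simp
    then obtain m where "m \<in> {m. v m \<noteq> 0}"
      "v m * of_real (\<Prod>i<length ts. site_coeff (\<gamma> (Suc i)) (ts ! i) (m ! i))
         * of_bool (x = map2 site_shift ts m) \<noteq> 0"
      unfolding tensor_act_def by (rule sum.not_neutral_contains_not_neutral)
    then have "v m \<noteq> 0" "x = map2 site_shift ts m"
      by (simp_all only: mem_Collect_eq mult_eq_0_iff of_bool_eq_0_iff de_Morgan_disj not_not simp_thms)
    then show "x \<in> map2 site_shift ts ` {m. v m \<noteq> 0}" by (simp only: image_iff mem_Collect_eq) blast
  qed
  moreover have "finite {m. v m \<noteq> 0}" using assms by (simp add: tensor_space_def)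
  ultimately have "finite {x. tensor_act \<gamma> ts v x \<noteq> 0}" by (meson finite_imageI finite_subset)
  moreover have "length x = n" if "tensor_act \<gamma> ts v x \<noteq> 0" for x
    using that tensor_act_eq_pull[OF assms] by (auto split: if_splits)
  ultimately show ?thesis by (simp add: tensor_space_def)
qed

lemma add_space:
  assumes "u \<in> tensor_space n" "v \<in> tensor_space n"
  shows "(\<lambda>x. u x + v x) \<in> tensor_space n"
proof -
  have "{x. u x + v x \<noteq> 0} \<subseteq> {x. u x \<noteq> 0} \<union> {x. v x \<noteq> 0}" by auto
  moreover have "finite ({x. u x \<noteq> 0} \<union> {x. v x \<noteq> 0})"
    using assms by (simp add: tensor_space_def)
  ultimately have "finite {x. u x + v x \<noteq> 0}" by (rule finite_subset)
  moreover have "length x = n" if "u x + v x \<noteq> 0" for x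
    using that assms unfolding tensor_space_def by (cases "u x = 0") auto
  ultimately show ?thesis by (simp add: tensor_space_def)
qed

lemma sum_list_space:
  "(\<And>t. t \<in> set T \<Longrightarrow> f t \<in> tensor_space n) \<Longrightarrow> (\<lambda>x. \<Sum>t\<leftarrow>T. f t x) \<in> tensor_space n"
proof (induction T)
  case Nil
  then show ?case by (simp add: tensor_space_def)
next
  case (Cons t T)
  then show ?case using add_space[of "f t" n "\<lambda>x. \<Sum>t\<leftarrow>T. f t x"] by simp
qed

lemma iter_coproduct_length: "t \<in> set (iter_coproduct k u) \<Longrightarrow> length t = k"
  using iter_coproduct_nonempty by (cases k) auto

lemma letter_act_space:
  assumes "v \<in> tensor_space n" "1 \<le> k" "k \<le> l" "l \<le> n"
  shows "letter_act \<gamma> n k l u v \<in> tensor_space n"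
  unfolding letter_act_def
  using assms by (intro sum_list_space tensor_act_space) (auto dest: iter_coproduct_length)

lemma letter_act_prefix:
  assumes "v \<in> tensor_space n" "1 \<le> l" "l \<le> n" "length x = n"
  shows "letter_act \<gamma> n 1 l u v x = acts (shift \<gamma>) l u v x"
proof -
  have "tensor_act \<gamma> (t @ replicate (n - l) Unit) v x = pull (shift \<gamma>) (t @ replicate (n - l) Unit) v x"
    if "t \<in> set (iter_coproduct l u)" for t
    using assms iter_coproduct_length[OF that] by (simp add: tensor_act_eq_pull)
  then show ?thesis
    using assms by (simp add: letter_act_def acts_def cong: map_cong)
qed

text \<open>The first tensor factor is the unit, so the operators on the sites 2, 3, ... act on each
  slice with a fixed first entry a, with the parameters shifted once more.\<close>

lemma letter_act_suffix:
  assumes "v \<in> tensor_space n" "1 \<le> l" "Suc l \<le> n" "length (a # r) = n"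
  shows "letter_act \<gamma> n 2 (Suc l) u v (a # r) = acts (shift (shift \<gamma>)) l u (\<lambda>r. v (a # r)) r"
proof -
  have "tensor_act \<gamma> (Unit # t @ replicate (n - Suc l) Unit) v (a # r)
      = pull (shift (shift \<gamma>)) (t @ replicate (n - Suc l) Unit) (\<lambda>r. v (a # r)) r"
    if "t \<in> set (iter_coproduct l u)" for t
    using assms iter_coproduct_length[OF that] by (simp add: tensor_act_eq_pull)
  moreover have "length r - l = n - Suc l" using assms by auto
  ultimately show ?thesis
    using assms by (simp add: letter_act_def acts_def numeral_2_eq_2 cong: map_cong)
qed

lemma Gamma_op_prefix:
  assumes v: "v \<in> tensor_space n" and k: "1 \<le> k" "k \<le> n" and x: "length x = n"
  shows "Gamma_op \<gamma> n 1 k v x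
    = Complex (Gam (shift \<gamma>) k (\<lambda>y. Re (v y)) x) (Gam (shift \<gamma>) k (\<lambda>y. Im (v y)) x)"
proof -
  let ?g = "shift \<gamma>"
  define p where "p = letter_act \<gamma> n 1 k Pinv v"
  define q where "q = letter_act \<gamma> n 1 k Am p"
  have p: "p \<in> tensor_space n" unfolding p_def using v k by (intro letter_act_space) auto
  have q: "q \<in> tensor_space n" unfolding q_def using p k by (intro letter_act_space) auto
  have p_eq: "p y = of_real ((-1) ^ sum_list (take k y)) * v y" if "length y = n" for y
    unfolding p_def using letter_act_prefix[OF v k that] k that by (simp add: acts_parity)
  have q_eq: "q y = Complex (lower_op ?g k (\<lambda>y. (-1) ^ sum_list (take k y) * Re (v y)) y)
      (lower_op ?g k (\<lambda>y. (-1) ^ sum_list (take k y) * Im (v y)) y)" if "length y = n" for y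
    unfolding q_def using letter_act_prefix[OF p k that] k that
    by (simp add: acts_Am) (intro conjI lower_op_cong; simp add: p_eq)
  have "Gamma_op \<gamma> n 1 k v x = - letter_act \<gamma> n 1 k Ap q x + letter_act \<gamma> n 1 k A0 p x
      - 1/2 * letter_act \<gamma> n 1 k Unit p x"
    by (simp add: Gamma_op_def casimir_def p_def q_def)
  also have "letter_act \<gamma> n 1 k Ap q x =
      Complex (raise_op ?g k (lower_op ?g k (\<lambda>y. (-1) ^ sum_list (take k y) * Re (v y))) x)
        (raise_op ?g k (lower_op ?g k (\<lambda>y. (-1) ^ sum_list (take k y) * Im (v y))) x)"
    using letter_act_prefix[OF q k x] k x
    by (simp add: acts_Ap) (intro conjI raise_op_cong; simp add: q_eq)
  also have "letter_act \<gamma> n 1 k A0 p x = of_real (real (sum_list (take k x)) + (\<Sum>i<k. ?g i)) * p x"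
    using letter_act_prefix[OF p k x] k x by (simp add: acts_A0)
  also have "letter_act \<gamma> n 1 k Unit p x = p x"
    using letter_act_prefix[OF p k x] k x by (simp add: acts_unit)
  finally show ?thesis
    unfolding Gam_eq_casimir using p_eq[OF x] by (simp add: complex_eq_iff)
qed

lemma Gamma_op_suffix:
  assumes v: "v \<in> tensor_space n" and k: "1 \<le> k" "Suc k \<le> n" and x: "length (a # r) = n"
  shows "Gamma_op \<gamma> n 2 (Suc k) v (a # r)
    = Complex (Gam (shift (shift \<gamma>)) k (\<lambda>y. Re (v (a # y))) r)
        (Gam (shift (shift \<gamma>)) k (\<lambda>y. Im (v (a # y))) r)"
proof -
  let ?g = "shift (shift \<gamma>)"
  define p where "p = letter_act \<gamma> n 2 (Suc k) Pinv v"
  define q where "q = letter_act \<gamma> n 2 (Suc k) Am p"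
  have kr: "k \<le> length r" "0 < k" using k x by auto
  have p: "p \<in> tensor_space n" unfolding p_def using v k by (intro letter_act_space) auto
  have q: "q \<in> tensor_space n" unfolding q_def using p k by (intro letter_act_space) auto
  have p_eq: "p (a # y) = of_real ((-1) ^ sum_list (take k y)) * v (a # y)" if "length y = length r" for y
    unfolding p_def using letter_act_suffix[OF v k, of a y] kr that x by (simp add: acts_parity)
  have q_eq: "q (a # y) = Complex (lower_op ?g k (\<lambda>y. (-1) ^ sum_list (take k y) * Re (v (a # y))) y)
      (lower_op ?g k (\<lambda>y. (-1) ^ sum_list (take k y) * Im (v (a # y))) y)" if "length y = length r" for y
    unfolding q_def using letter_act_suffix[OF p k, of a y] kr that x
    by (simp add: acts_Am) (intro conjI lower_op_cong; simp add: p_eq)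
  have "Gamma_op \<gamma> n 2 (Suc k) v (a # r) = - letter_act \<gamma> n 2 (Suc k) Ap q (a # r)
      + letter_act \<gamma> n 2 (Suc k) A0 p (a # r) - 1/2 * letter_act \<gamma> n 2 (Suc k) Unit p (a # r)"
    by (simp add: Gamma_op_def casimir_def p_def q_def)
  also have "letter_act \<gamma> n 2 (Suc k) Ap q (a # r) =
      Complex (raise_op ?g k (lower_op ?g k (\<lambda>y. (-1) ^ sum_list (take k y) * Re (v (a # y)))) r)
        (raise_op ?g k (lower_op ?g k (\<lambda>y. (-1) ^ sum_list (take k y) * Im (v (a # y)))) r)"
    using letter_act_suffix[OF q k x] kr
    by (simp add: acts_Ap) (intro conjI raise_op_cong; simp add: q_eq)
  also have "letter_act \<gamma> n 2 (Suc k) A0 p (a # r)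
      = of_real (real (sum_list (take k r)) + (\<Sum>i<k. ?g i)) * p (a # r)"
    using letter_act_suffix[OF p k x] kr by (simp add: acts_A0)
  also have "letter_act \<gamma> n 2 (Suc k) Unit p (a # r) = p (a # r)"
    using letter_act_suffix[OF p k x] kr by (simp add: acts_unit)
  finally show ?thesis
    unfolding Gam_eq_casimir using p_eq[of r] by (simp add: complex_eq_iff)
qed

lemma A0_op_eq:
  assumes "v \<in> tensor_space n" "1 \<le> n"
  shows "A0_op \<gamma> n v x = of_real (real (sum_list x) + (\<Sum>i<n. \<gamma> (Suc i))) * v x"
proof (cases "length x = n")
  case True
  then show ?thesis
    using letter_act_prefix[of v n n x \<gamma> A0] assms by (simp add: A0_op_def acts_A0)
next
  case False
  then have "v x = 0" "A0_op \<gamma> n v x = 0"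
    using assms letter_act_space[of v n 1 n \<gamma> A0] by (auto simp: tensor_space_def A0_op_def)
  then show ?thesis by simp
qed

section \<open>Clebsch--Gordan vectors of two sites\<close>

lemma sigma_pos: "0 < g \<Longrightarrow> 0 < sigma g (Suc m)"
  by (cases "even m") (auto simp: sigma_def algebra_simps)

lemma sigma_nonneg: "0 < g \<Longrightarrow> 0 \<le> sigma g m"
  using sigma_pos[of g "m - 1"] by (cases m) auto

lemma sqrt_sigma_square [simp]:
  "0 < g \<Longrightarrow> sqrt (sigma g m) * sqrt (sigma g m) = sigma g m"
  using sigma_nonneg[of g m] by simp

text \<open>This is A_+ A_- + A_- A_+ = 2 A_0 on the basis vector |m> of one module.\<close>

lemma sigma_add_sigma_Suc: "sigma g m + sigma g (Suc m) = 2 * (real m + g)"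
  by (cases "even m") (simp_all add: sigma_def algebra_simps)

definition lower2 :: "real \<Rightarrow> real \<Rightarrow> (nat \<Rightarrow> nat \<Rightarrow> real) \<Rightarrow> nat \<Rightarrow> nat \<Rightarrow> real" where
  "lower2 a b f x y = (-1) ^ y * sqrt (sigma a (Suc x)) * f (Suc x) y + sqrt (sigma b (Suc y)) * f x (Suc y)"

definition raise2 :: "real \<Rightarrow> real \<Rightarrow> (nat \<Rightarrow> nat \<Rightarrow> real) \<Rightarrow> nat \<Rightarrow> nat \<Rightarrow> real" where
  "raise2 a b f x y = (-1) ^ y * sqrt (sigma a x) * f (x - 1) y + sqrt (sigma b y) * f x (y - 1)"

text \<open>The relation A_+ A_- + A_- A_+ = 2 A_0 survives the coproduct: the mixed terms, with one
  operator on each site, cancel, because an operator on the second site flips the sign (-1)^y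
  carried by the first.\<close>

lemma lower2_raise2:
  assumes "0 < a" "0 < b"
  shows "lower2 a b (raise2 a b f) x y + raise2 a b (lower2 a b f) x y = 2 * (real x + real y + a + b) * f x y"
proof -
  have s: "sqrt (sigma a m) * (sqrt (sigma a m) * z) = sigma a m * z"
    "sqrt (sigma b m) * (sqrt (sigma b m) * z) = sigma b m * z" for z m
    using assms by (simp_all only: mult.assoc[symmetric] sqrt_sigma_square)
  have abs: "\<bar>sigma a m\<bar> = sigma a m" "\<bar>sigma b m\<bar> = sigma b m" for m
    using assms by (simp_all add: sigma_nonneg)
  have sg: "(-1) ^ y * ((-1) ^ y * z) = z" for z :: real
    by (simp flip: mult.assoc power_add)
  have "lower2 a b (raise2 a b f) x y + raise2 a b (lower2 a b f) x y
      = (sigma a x + sigma a (Suc x) + sigma b y + sigma b (Suc y)) * f x y"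
    by (cases x; cases y) (simp_all add: lower2_def raise2_def algebra_simps s sg abs)
  also have "sigma a x + sigma a (Suc x) + sigma b y + sigma b (Suc y) = 2 * (real x + real y + a + b)"
    using sigma_add_sigma_Suc[of a x] sigma_add_sigma_Suc[of b y] by simp
  finally show ?thesis .
qed

text \<open>The coordinates at \<open>|N - y, y\<rangle>\<close> of the lowest weight vector of degree \<open>N\<close>, up to
  normalization.\<close>

primrec lowest :: "real \<Rightarrow> real \<Rightarrow> nat \<Rightarrow> nat \<Rightarrow> real" where
  "lowest a b N 0 = 1"
| "lowest a b N (Suc y) = - ((-1) ^ y) * sqrt (sigma a (N - y)) / sqrt (sigma b (Suc y)) * lowest a b N y"

text \<open>The Clebsch-Gordan coefficients: \<open>cg a b N t\<close> holds the coordinates of the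
  basis vector |t> in the copy of the module of parameter a + b + N that A_+ generates from the
  normalized lowest weight vector.\<close>

primrec cg :: "real \<Rightarrow> real \<Rightarrow> nat \<Rightarrow> nat \<Rightarrow> nat \<Rightarrow> nat \<Rightarrow> real" where
  "cg a b N 0 = (\<lambda>x y. if x + y = N then lowest a b N y / sqrt (\<Sum>y\<le>N. (lowest a b N y)\<^sup>2) else 0)"
| "cg a b N (Suc t) = (\<lambda>x y. raise2 a b (cg a b N t) x y / sqrt (sigma (a + b + real N) (Suc t)))"

lemma lowest_norm_pos: "0 < (\<Sum>y\<le>N. (lowest a b N y)\<^sup>2)"
proof -
  have "(lowest a b N 0)\<^sup>2 \<le> (\<Sum>y\<le>N. (lowest a b N y)\<^sup>2)"
    by (intro member_le_sum) auto
  then show ?thesis by simp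
qed

lemma cg_support: "x + y \<noteq> N + t \<Longrightarrow> cg a b N t x y = 0"
proof (induction t arbitrary: x y)
  case (Suc t)
  have "sqrt (sigma a x) * cg a b N t (x - 1) y = 0"
    using Suc by (cases x) auto
  moreover have "sqrt (sigma b y) * cg a b N t x (y - 1) = 0"
    using Suc by (cases y) auto
  ultimately show ?case
    by (simp only: cg.simps raise2_def mult.assoc mult_zero_right add_0_left div_0)
qed simp

lemma lower2_cg_0:
  assumes "0 < a" "0 < b"
  shows "lower2 a b (cg a b N 0) x y = 0"
proof (cases "Suc (x + y) = N")
  case True
  then have "N - y = Suc x" by simp
  then show ?thesis
    using True sigma_pos[OF assms(2), of y] by (simp add: lower2_def field_simps)
qed (simp add: lower2_def)

declare cg.simps [simp del]

lemma raise2_cg: "0 < a \<Longrightarrow> 0 < b \<Longrightarrow>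
    raise2 a b (cg a b N t) x y = sqrt (sigma (a + b + real N) (Suc t)) * cg a b N (Suc t) x y"
  using sigma_pos[of "a + b + real N" t] by (simp add: cg.simps)

lemma lower2_divide: "lower2 a b (\<lambda>x y. f x y / c) x y = lower2 a b f x y / c"
  by (simp add: lower2_def add_divide_distrib)

lemma raise2_mult: "raise2 a b (\<lambda>x y. c * f x y) x y = c * raise2 a b f x y"
  by (simp add: raise2_def algebra_simps)

text \<open>A_- A_+ = 2 A_0 - A_+ A_-, where A_0 is the scalar N + t + a + b on the support of
  \<open>cg a b N t\<close>, and A_+ A_- is known by induction. The one-module relation
  \<open>sigma_add_sigma_Suc\<close> for the parameter a + b + N then leaves the right
  factor.\<close>

lemma lower2_cg_Suc:
  assumes "0 < a" "0 < b"
  shows "lower2 a b (cg a b N (Suc t)) x y = sqrt (sigma (a + b + real N) (Suc t)) * cg a b N t x y"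
proof (induction t arbitrary: x y)
  case 0
  let ?h = "a + b + real N"
  have "raise2 a b (lower2 a b (cg a b N 0)) x y = 0"
    using lower2_cg_0[OF assms, of N] by (simp add: raise2_def)
  then have "lower2 a b (raise2 a b (cg a b N 0)) x y = 2 * (real x + real y + a + b) * cg a b N 0 x y"
    using lower2_raise2[OF assms, of "cg a b N 0" x y] by simp
  also have "\<dots> = sigma ?h (Suc 0) * cg a b N 0 x y"
  proof (cases "x + y = N")
    case True
    then have "real N = real x + real y" by auto
    then show ?thesis by (simp add: sigma_def algebra_simps)
  qed (simp add: cg_support)
  finally have "lower2 a b (cg a b N (Suc 0)) x y = sigma ?h (Suc 0) * cg a b N 0 x y / sqrt (sigma ?h (Suc 0))"
    unfolding cg.simps(2) lower2_divide by simp
  then show ?case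
    using real_div_sqrt[of "sigma ?h (Suc 0)"] sigma_pos[of ?h 0] assms
    by (simp only: times_divide_eq_left[symmetric]) simp
next
  case (Suc t)
  let ?h = "a + b + real N"
  have pos: "0 < ?h" using assms by simp
  have "raise2 a b (lower2 a b (cg a b N (Suc t))) x y = sigma ?h (Suc t) * cg a b N (Suc t) x y"
    unfolding Suc raise2_mult raise2_cg[OF assms] mult.assoc[symmetric] by (simp only: sqrt_sigma_square[OF pos])
  then have "lower2 a b (raise2 a b (cg a b N (Suc t))) x y
      = (2 * (real x + real y + a + b) - sigma ?h (Suc t)) * cg a b N (Suc t) x y"
    using lower2_raise2[OF assms, of "cg a b N (Suc t)" x y] by (simp add: algebra_simps)
  also have "\<dots> = sigma ?h (Suc (Suc t)) * cg a b N (Suc t) x y"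
  proof (cases "x + y = N + Suc t")
    case True
    then have "real x + real y = real N + real (Suc t)" by (metis of_nat_add)
    then have "2 * (real x + real y + a + b) - sigma ?h (Suc t) = sigma ?h (Suc (Suc t))"
      using sigma_add_sigma_Suc[of ?h "Suc t"] by simp
    then show ?thesis by simp
  next
    case False
    then show ?thesis by (simp add: cg_support)
  qed
  finally have "lower2 a b (cg a b N (Suc (Suc t))) x y
      = sigma ?h (Suc (Suc t)) * cg a b N (Suc t) x y / sqrt (sigma ?h (Suc (Suc t)))"
    unfolding cg.simps(2)[of a b N "Suc t"] lower2_divide by simp
  then show ?case
    using real_div_sqrt[of "sigma ?h (Suc (Suc t))"] sigma_pos[OF pos, of "Suc t"]
    by (simp add: times_divide_eq_left[symmetric] del: times_divide_eq_left)
qed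

definition ip2 :: "nat \<Rightarrow> (nat \<Rightarrow> nat \<Rightarrow> real) \<Rightarrow> (nat \<Rightarrow> nat \<Rightarrow> real) \<Rightarrow> real" where
  "ip2 D f h = (\<Sum>x\<le>D. f x (D - x) * h x (D - x))"

lemma ip2_commute: "ip2 D f h = ip2 D h f"
  by (simp add: ip2_def mult.commute)

lemma ip2_divide: "ip2 D (\<lambda>x y. f x y / c) h = ip2 D f h / c"
  by (simp add: ip2_def sum_divide_distrib)

text \<open>A_+ and A_- are adjoint; the boundary terms of the index shifts vanish with
  \<open>sigma\<close> at 0.\<close>

lemma ip2_raise2: "ip2 (Suc D) (raise2 a b f) h = ip2 D f (lower2 a b h)"
proof -
  have "ip2 (Suc D) (raise2 a b f) h =
     (\<Sum>x\<le>Suc D. (-1) ^ (Suc D - x) * sqrt (sigma a x) * f (x - 1) (Suc D - x) * h x (Suc D - x)) +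
     (\<Sum>x\<le>Suc D. sqrt (sigma b (Suc D - x)) * f x (Suc D - x - 1) * h x (Suc D - x))"
    by (simp only: ip2_def raise2_def distrib_right sum.distrib)
  also have "(\<Sum>x\<le>Suc D. (-1) ^ (Suc D - x) * sqrt (sigma a x) * f (x - 1) (Suc D - x) * h x (Suc D - x))
     = (\<Sum>x\<le>D. (-1) ^ (D - x) * sqrt (sigma a (Suc x)) * f x (D - x) * h (Suc x) (D - x))"
    by (subst sum.atMost_Suc_shift) simp
  also have "(\<Sum>x\<le>Suc D. sqrt (sigma b (Suc D - x)) * f x (Suc D - x - 1) * h x (Suc D - x))
     = (\<Sum>x\<le>D. sqrt (sigma b (Suc (D - x))) * f x (D - x) * h x (Suc (D - x)))"
    by (subst sum.atMost_Suc) (auto simp: Suc_diff_le intro!: sum.cong)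
  finally show ?thesis
    by (simp add: ip2_def lower2_def algebra_simps sum.distrib)
qed

text \<open>Moving A_+ to the other side lowers both t and t' until one of the two vectors has
  lowest weight. If only one has, A_- kills it; if both have, N and N' equal the common degree
  D.\<close>

lemma ip2_cg:
  assumes "0 < a" "0 < b"
  shows "N + t = D \<Longrightarrow> N' + t' = D \<Longrightarrow> ip2 D (cg a b N t) (cg a b N' t') = of_bool (N = N')"
proof (induction t arbitrary: N' t' D)
  case 0
  show ?case
  proof (cases t')
    case t': 0
    then have "N' = N" using 0 by simp
    have "ip2 N (cg a b N 0) (cg a b N 0) = (\<Sum>x\<le>N. (lowest a b N (N - x))\<^sup>2) / (\<Sum>y\<le>N. (lowest a b N y)\<^sup>2)"
      using lowest_norm_pos[of a b N]
      by (simp add: ip2_def cg.simps sum_divide_distrib power2_eq_square)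
    also have "(\<Sum>x\<le>N. (lowest a b N (N - x))\<^sup>2) = (\<Sum>y\<le>N. (lowest a b N y)\<^sup>2)"
      using sum.nat_diff_reindex[of "\<lambda>y. (lowest a b N y)\<^sup>2" "Suc N"] by (simp add: lessThan_Suc_atMost)
    finally show ?thesis using lowest_norm_pos[of a b N] 0 t' \<open>N' = N\<close> by simp
  next
    case (Suc u)
    then obtain E where E: "D = Suc E" using 0 by (cases D) auto
    have "ip2 D (cg a b N' t') (cg a b N 0)
        = ip2 (Suc E) (raise2 a b (cg a b N' u)) (cg a b N 0) / sqrt (sigma (a + b + real N') (Suc u))"
      unfolding Suc E cg.simps(2) ip2_divide ..
    also have "\<dots> = 0"
      unfolding ip2_raise2 using lower2_cg_0[OF assms, of N] by (simp add: ip2_def)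
    finally show ?thesis using 0 Suc ip2_commute[of D "cg a b N 0" "cg a b N' t'"] by auto
  qed
next
  case (Suc t)
  then obtain E where E: "D = Suc E" by (cases D) auto
  let ?s = "sqrt (sigma (a + b + real N) (Suc t))"
  have s: "?s \<noteq> 0" using sigma_pos[of "a + b + real N" t] assms by simp
  have "ip2 D (cg a b N (Suc t)) (cg a b N' t')
      = ip2 (Suc E) (raise2 a b (cg a b N t)) (cg a b N' t') / ?s"
    unfolding E cg.simps(2) ip2_divide ..
  also have "\<dots> = ip2 E (cg a b N t) (lower2 a b (cg a b N' t')) / ?s"
    unfolding ip2_raise2 ..
  finally have eq: "ip2 D (cg a b N (Suc t)) (cg a b N' t') = \<dots>" .
  show ?case
  proof (cases t')
    case 0
    then show ?thesis unfolding eq using lower2_cg_0[OF assms, of N'] Suc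
      by (simp add: ip2_def)
  next
    case t': (Suc u)
    let ?s' = "sqrt (sigma (a + b + real N') (Suc u))"
    have "lower2 a b (cg a b N' t') = (\<lambda>x y. ?s' * cg a b N' u x y)"
      unfolding t' by (intro ext lower2_cg_Suc assms)
    then have "ip2 E (cg a b N t) (lower2 a b (cg a b N' t')) = ?s' * ip2 E (cg a b N t) (cg a b N' u)"
      by (simp add: ip2_def sum_distrib_left algebra_simps)
    also have "ip2 E (cg a b N t) (cg a b N' u) = of_bool (N = N')"
      using Suc.prems E t' by (intro Suc.IH) auto
    finally have "ip2 E (cg a b N t) (lower2 a b (cg a b N' t')) = ?s' * of_bool (N = N')" .
    then show ?thesis unfolding eq using s Suc.prems t' by auto
  qed
qed

section \<open>Merging neighbouring sites\<close>

definition merge :: "(nat \<Rightarrow> real) \<Rightarrow> nat \<Rightarrow> nat \<Rightarrow> real" where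
  "merge g N = (\<lambda>i. case i of 0 \<Rightarrow> g 0 + g (Suc 0) + real N | Suc i \<Rightarrow> g (Suc (Suc i)))"

lemma merge_simps [simp]: "merge g N 0 = g 0 + g (Suc 0) + real N" "merge g N (Suc i) = g (Suc (Suc i))"
  by (simp_all add: merge_def)

text \<open>Embeds the vectors of the sites \<open>merge g N\<close> into those of the sites \<open>g\<close>.\<close>

fun iota :: "(nat \<Rightarrow> real) \<Rightarrow> nat \<Rightarrow> (nat list \<Rightarrow> real) \<Rightarrow> nat list \<Rightarrow> real" where
  "iota g N z (x # y # r) = cg (g 0) (g (Suc 0)) N (x + y - N) x y * z ((x + y - N) # r)"
| "iota g N z _ = 0"

definition pos :: "(nat \<Rightarrow> real) \<Rightarrow> bool" where
  "pos g \<longleftrightarrow> (\<forall>i. 0 < g i)"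

lemma posD [simp]: "pos g \<Longrightarrow> 0 < g i"
  by (simp add: pos_def)

lemma pos_merge: "pos g \<Longrightarrow> pos (merge g N)"
  unfolding pos_def by (auto simp: merge_def add_pos_pos add_pos_nonneg split: nat.split)

lemma pos_shift: "pos g \<Longrightarrow> pos (shift g)"
  by (simp add: pos_def)

lemma lower_op_multc: "lower_op g k (\<lambda>y. f y * c) x = lower_op g k f x * c"
  using lower_op_cmult[of g k c f x] by (simp add: mult.commute)

lemma raise_op_multc: "raise_op g k (\<lambda>y. f y * c) x = raise_op g k f x * c"
  using raise_op_cmult[of g k c f x] by (simp add: mult.commute)

text \<open>A_- on the first two sites is \<open>lower2\<close> times the parity of the remaining
  sites, and the Clebsch-Gordan vectors carry it to the matrix of the merged site. The truncated
  index for x + y < N is harmless, as \<open>cg\<close> vanishes there.\<close>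

lemma lower_op_iota:
  assumes "pos g"
  shows "lower_op g (Suc (Suc k)) (iota g N z) (x # y # r) = iota g N (lower_op (merge g N) (Suc k) z) (x # y # r)"
proof -
  let ?S = "(-1) ^ sum_list (take k r) :: real" and ?a = "g 0" and ?b = "g (Suc 0)"
  let ?t = "x + y - N"
  have ab: "0 < ?a" "0 < ?b" using assms by auto
  have "lower_op g (Suc (Suc k)) (iota g N z) (x # y # r)
      = ?S * z ((Suc (x + y) - N) # r) * lower2 ?a ?b (cg ?a ?b N (Suc (x + y) - N)) x y
        + cg ?a ?b N ?t x y * lower_op (shift (shift g)) k (\<lambda>r. z (?t # r)) r"
    by (simp add: lower2_def lower_op_cmult lower_op_multc power_add algebra_simps)
  moreover have "z ((Suc (x + y) - N) # r) * lower2 ?a ?b (cg ?a ?b N (Suc (x + y) - N)) x y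
      = sqrt (sigma (?a + ?b + real N) (Suc ?t)) * z (Suc ?t # r) * cg ?a ?b N ?t x y"
  proof (cases "N \<le> x + y")
    case True
    then show ?thesis by (simp add: Suc_diff_le lower2_cg_Suc[OF ab] algebra_simps)
  next
    case False
    then show ?thesis by (simp add: lower2_cg_0[OF ab] cg_support)
  qed
  ultimately show ?thesis by (simp add: algebra_simps)
qed

lemma raise_op_iota:
  assumes "pos g"
  shows "raise_op g (Suc (Suc k)) (iota g N z) (x # y # r) = iota g N (raise_op (merge g N) (Suc k) z) (x # y # r)"
proof -
  let ?S = "(-1) ^ sum_list (take k r) :: real" and ?a = "g 0" and ?b = "g (Suc 0)"
  let ?t = "x + y - N"
  have ab: "0 < ?a" "0 < ?b" using assms by auto
  have "x > 0 \<Longrightarrow> x - 1 + y - N = ?t - 1" "y > 0 \<Longrightarrow> x + (y - 1) - N = ?t - 1" by auto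
  then have "raise_op g (Suc (Suc k)) (iota g N z) (x # y # r)
      = ?S * z ((?t - 1) # r) * raise2 ?a ?b (cg ?a ?b N (?t - 1)) x y
        + cg ?a ?b N ?t x y * raise_op (shift (shift g)) k (\<lambda>r. z (?t # r)) r"
    by (cases x; cases y) (simp_all add: raise2_def raise_op_cmult raise_op_multc power_add algebra_simps)
  moreover have "raise2 ?a ?b (cg ?a ?b N (?t - 1)) x y
      = sqrt (sigma (?a + ?b + real N) ?t) * cg ?a ?b N ?t x y"
  proof (cases ?t)
    case 0
    have "raise2 ?a ?b (cg ?a ?b N 0) x y = sqrt (sigma (?a + ?b + real N) (Suc 0)) * cg ?a ?b N (Suc 0) x y"
      by (rule raise2_cg[OF ab])
    also have "\<dots> = 0" using 0 by (simp add: cg_support)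
    finally show ?thesis using 0 by simp
  next
    case (Suc u)
    then show ?thesis using raise2_cg[OF ab, of N u x y] by simp
  qed
  ultimately show ?thesis by (simp add: algebra_simps)
qed

text \<open>On the support, x + y = N + t. The degree N moves into the parameter of the merged site,
  so A_0 agrees on both sides, whereas the parity of the two sites is (-1)^N times that of
  t.\<close>

lemma Gam_iota:
  assumes "pos g"
  shows "Gam g (Suc (Suc k)) (iota g N z) (x # y # r)
    = (-1) ^ N * iota g N (Gam (merge g N) (Suc k) z) (x # y # r)"
proof -
  let ?t = "x + y - N" and ?c = "cg (g 0) (g (Suc 0)) N (x + y - N) x y"
  have "raise_op g (Suc (Suc k)) (lower_op g (Suc (Suc k)) (iota g N z)) (x # y # r)
      = raise_op g (Suc (Suc k)) (iota g N (lower_op (merge g N) (Suc k) z)) (x # y # r)"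
  proof (rule raise_op_cong)
    fix w :: "nat list" assume "length w = length (x # y # r)"
    then obtain x' y' r' where "w = x' # y' # r'" by (auto simp: length_Suc_conv)
    then show "lower_op g (Suc (Suc k)) (iota g N z) w = iota g N (lower_op (merge g N) (Suc k) z) w"
      using lower_op_iota[OF assms] by (simp only:)
  qed
  also have "\<dots> = ?c * raise_op (merge g N) (Suc k) (lower_op (merge g N) (Suc k) z) (?t # r)"
    unfolding raise_op_iota[OF assms] by simp
  finally have rl: "raise_op g (Suc (Suc k)) (lower_op g (Suc (Suc k)) (iota g N z)) (x # y # r) = \<dots>" .
  have sums: "(\<Sum>i<Suc (Suc k). g i) + real N = (\<Sum>i<Suc k. merge g N i)"
    by (simp add: sum.lessThan_Suc_shift del: sum.lessThan_Suc)
  show ?thesis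
  proof (cases "N \<le> x + y")
    case True
    then obtain t where t: "x + y = N + t" by (auto simp: le_iff_add)
    then have tt: "x + y - N = t" by simp
    have xy: "real x + real y = real N + real t" using arg_cong[OF t, of real] by simp
    have sg: "(-1) ^ x * (-1) ^ y = (-1) ^ N * ((-1) ^ t :: real)"
      using arg_cong[OF t, of "\<lambda>n. (-1) ^ n :: real"] by (simp only: power_add)
    let ?d = "cg (g 0) (g (Suc 0)) N t x y"
    have "Gam g (Suc (Suc k)) (iota g N z) (x # y # r) = (-1) ^ x * (-1) ^ y * (-1) ^ sum_list (take k r) *
       ((real x + real y + real (sum_list (take k r)) + (\<Sum>i<Suc (Suc k). g i) - 1/2) * (?d * z (t # r))
        - ?d * raise_op (merge g N) (Suc k) (lower_op (merge g N) (Suc k) z) (t # r))"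
      unfolding Gam_def rl tt iota.simps by (simp add: power_add mult.assoc add.assoc)
    also have "real x + real y + real (sum_list (take k r)) + (\<Sum>i<Suc (Suc k). g i) - 1/2
        = real (sum_list (take (Suc k) (t # r))) + (\<Sum>i<Suc k. merge g N i) - 1/2"
      unfolding xy sums[symmetric] by simp
    also have "(-1) ^ x * (-1) ^ y * (-1) ^ sum_list (take k r) *
       ((real (sum_list (take (Suc k) (t # r))) + (\<Sum>i<Suc k. merge g N i) - 1/2) * (?d * z (t # r))
        - ?d * raise_op (merge g N) (Suc k) (lower_op (merge g N) (Suc k) z) (t # r))
       = (-1) ^ N * (?d * Gam (merge g N) (Suc k) z (t # r))"
      unfolding sg by (simp only: Gam_def take_Suc_Cons sum_list.Cons power_add)
        (simp only: right_diff_distrib mult.assoc mult.left_commute[of ?d])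
    finally show ?thesis unfolding iota.simps tt .
  next
    case False
    then have "?c = 0" by (simp add: cg_support)
    then show ?thesis unfolding Gam_def rl by simp
  qed
qed

lemma Gam_cmult: "Gam g k (\<lambda>y. c * f y) x = c * Gam g k f x"
proof -
  have "lower_op g k (\<lambda>y. c * f y) = (\<lambda>x. c * lower_op g k f x)"
    by (simp add: fun_eq_iff lower_op_cmult)
  then show ?thesis by (simp add: Gam_def raise_op_cmult algebra_simps)
qed

lemma Gam_add: "Gam g k (\<lambda>y. f y + h y) x = Gam g k f x + Gam g k h x"
proof -
  have "lower_op g k (\<lambda>y. f y + h y) = (\<lambda>x. lower_op g k f x + lower_op g k h x)"
    by (simp add: fun_eq_iff lower_op_add)
  then show ?thesis by (simp add: Gam_def raise_op_add algebra_simps)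
qed

text \<open>A_+ A_- has the eigenvalue \<open>sigma (g 0) t\<close>, whose dependence on the parity
  of t is just what makes the Casimir element a scalar on one module. With \<open>Gam_iota\<close>
  this gives the eigenvalue of a merged pair.\<close>

lemma Gam_1:
  assumes "pos g"
  shows "Gam g (Suc 0) z (t # r) = (g 0 - 1/2) * z (t # r)"
proof -
  have "raise_op g (Suc 0) (lower_op g (Suc 0) z) (t # r) = sigma (g 0) t * z (t # r)"
    using assms by (cases t) (simp_all add: mult.assoc[symmetric] sigma_nonneg)
  then have "Gam g (Suc 0) z (t # r) = (-1) ^ t * ((real t + g 0 - 1/2) * z (t # r) - sigma (g 0) t * z (t # r))"
    by (simp only: Gam_def) simp
  then show ?thesis
    by (cases "even t") (simp_all add: sigma_def algebra_simps)
qed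

definition deg_lists :: "nat \<Rightarrow> nat \<Rightarrow> nat list set" where
  "deg_lists n N = {x. length x = n \<and> sum_list x = N}"

lemma deg_lists_0: "deg_lists 0 N = (if N = 0 then {[]} else {})"
  by (auto simp: deg_lists_def)

lemma deg_lists_Suc: "deg_lists (Suc n) N = (\<Union>a\<le>N. (#) a ` deg_lists n (N - a))"
proof (intro equalityI subsetI)
  fix x assume "x \<in> deg_lists (Suc n) N"
  then obtain a r where "x = a # r" "length r = n" "a + sum_list r = N"
    by (auto simp: deg_lists_def length_Suc_conv)
  then show "x \<in> (\<Union>a\<le>N. (#) a ` deg_lists n (N - a))"
    by (auto simp: deg_lists_def intro!: bexI[of _ a])
qed (auto simp: deg_lists_def)

lemma finite_deg_lists [simp]: "finite (deg_lists n N)"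
proof (induction n arbitrary: N)
  case (Suc n)
  then show ?case unfolding deg_lists_Suc by blast
qed (simp add: deg_lists_0)

definition ip :: "nat \<Rightarrow> nat \<Rightarrow> (nat list \<Rightarrow> real) \<Rightarrow> (nat list \<Rightarrow> real) \<Rightarrow> real" where
  "ip n N u v = (\<Sum>x\<in>deg_lists n N. u x * v x)"

lemma ip_Suc: "ip (Suc n) N u v = (\<Sum>a\<le>N. ip n (N - a) (\<lambda>r. u (a # r)) (\<lambda>r. v (a # r)))"
proof -
  have "ip (Suc n) N u v = (\<Sum>a\<le>N. \<Sum>x\<in>(#) a ` deg_lists n (N - a). u x * v x)"
    unfolding ip_def deg_lists_Suc by (intro sum.UNION_disjoint) auto
  also have "\<dots> = (\<Sum>a\<le>N. ip n (N - a) (\<lambda>r. u (a # r)) (\<lambda>r. v (a # r)))"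
    unfolding ip_def by (simp add: sum.reindex)
  finally show ?thesis .
qed

lemma ip_cmult: "ip n N (\<lambda>x. c * u x) (\<lambda>x. d * v x) = c * d * ip n N u v"
  by (simp add: ip_def sum_distrib_left algebra_simps)

lemma ip_iota:
  assumes "pos g"
  shows "ip (Suc (Suc n)) N (iota g P u) (iota g Q v)
    = (if P = Q \<and> P \<le> N then ip (Suc n) (N - P) u v else 0)"
proof -
  let ?c = "cg (g 0) (g (Suc 0))"
  let ?I = "\<lambda>d. ip n (N - d) (\<lambda>r. u ((d - P) # r)) (\<lambda>r. v ((d - Q) # r))"
  have ab: "0 < g 0" "0 < g (Suc 0)" using assms by auto
  have "ip (Suc (Suc n)) N (iota g P u) (iota g Q v)
      = (\<Sum>x\<le>N. \<Sum>y\<le>N - x. ?c P (x + y - P) x y * ?c Q (x + y - Q) x y * ?I (x + y))"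
    by (simp add: ip_Suc ip_cmult)
  \<comment> \<open>Regrouped by d = x + y, on which alone the factor \<open>?I\<close> depends; the
    inner sum is then an orthogonality relation of Clebsch-Gordan vectors.\<close>
  also have "\<dots> = (\<Sum>d\<le>N. \<Sum>x\<le>d. ?c P (d - P) x (d - x) * ?c Q (d - Q) x (d - x) * ?I d)"
  proof -
    let ?f = "\<lambda>x y. ?c P (x + y - P) x y * ?c Q (x + y - Q) x y * ?I (x + y)"
    have "(\<Sum>x\<le>N. \<Sum>y\<le>N - x. ?f x y) = (\<Sum>(x, y)\<in>(SIGMA x:{..N}. {..N - x}). ?f x y)"
      by (rule sum.Sigma) auto
    also have "(SIGMA x:{..N}. {..N - x}) = {(x, y). x + y \<le> N}" by auto
    also have "(\<Sum>(x, y)\<in>{(x, y). x + y \<le> N}. ?f x y) = (\<Sum>d\<le>N. \<Sum>x\<le>d. ?f x (d - x))"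
      by (rule sum.triangle_reindex_eq)
    finally show ?thesis by simp
  qed
  also have "\<dots> = (\<Sum>d\<le>N. ip2 d (?c P (d - P)) (?c Q (d - Q)) * ?I d)"
    by (simp add: ip2_def sum_distrib_right)
  also have "\<dots> = (\<Sum>d\<le>N. if P = Q \<and> P \<le> d then ?I d else 0)"
  proof (rule sum.cong)
    fix d assume "d \<in> {..N}"
    consider "P \<le> d" "Q \<le> d" | "\<not> P \<le> d" | "\<not> Q \<le> d" by blast
    then show "ip2 d (?c P (d - P)) (?c Q (d - Q)) * ?I d = (if P = Q \<and> P \<le> d then ?I d else 0)"
    proof cases
      case 1
      then show ?thesis using ip2_cg[OF ab, of P "d - P" d Q "d - Q"] by simp
    qed (auto simp: ip2_def cg_support)
  qed simp
  also have "\<dots> = (if P = Q \<and> P \<le> N then ip (Suc n) (N - P) u v else 0)"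
  proof (cases "P = Q \<and> P \<le> N")
    case True
    have "(\<Sum>d\<le>N. if P \<le> d then ?I d else 0) = (\<Sum>d\<in>{P..N}. ?I d)"
      by (subst sum.inter_filter[symmetric]) (auto intro!: sum.cong)
    also have "\<dots> = (\<Sum>t\<le>N - P. ?I (t + P))"
      using True by (intro sum.reindex_bij_witness[of _ "\<lambda>t. t + P" "\<lambda>d. d - P"]) auto
    finally show ?thesis using True by (simp add: ip_Suc add.commute)
  next
    case False
    then show ?thesis by (auto intro!: sum.neutral)
  qed
  finally show ?thesis .
qed

section \<open>Merging the second and the third site\<close>

definition merge23 :: "(nat \<Rightarrow> real) \<Rightarrow> nat \<Rightarrow> nat \<Rightarrow> real" where
  "merge23 g N = (\<lambda>i. case i of 0 \<Rightarrow> g 0 | Suc i \<Rightarrow> merge (shift g) N i)"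

lemma merge23_simps [simp]: "merge23 g N 0 = g 0" "merge23 g N (Suc i) = merge (shift g) N i"
  by (simp_all add: merge23_def)

lemma pos_merge23: "pos g \<Longrightarrow> pos (merge23 g N)"
  using pos_merge[OF pos_shift, of g N] unfolding pos_def by (auto simp: merge23_def split: nat.split)

text \<open>This is (-1)^(N(N-1)/2), a free choice of phase. It is the part of the sign of
  \<open>lowest b c N N\<close> other than (-1)^N, see \<open>lowest_sign\<close>, and serves to
  make the three-site prefactor positive.\<close>

definition sgn23 :: "nat \<Rightarrow> real" where
  "sgn23 N = (\<Prod>y<N. (-1) ^ y)"

lemma sgn23_square: "sgn23 N * sgn23 N = 1"
  by (simp add: sgn23_def flip: prod.distrib power_add)

text \<open>The merged site carries the parity \<open>(-1)\<^sup>N\<close> of its lowest weight vector.  The factor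
  \<open>(-1) ^ (N * x)\<close> compensates this in the action of \<open>A\<^sub>\<plusminus>\<close> on the site to its left.\<close>

fun iota23 :: "(nat \<Rightarrow> real) \<Rightarrow> nat \<Rightarrow> (nat list \<Rightarrow> real) \<Rightarrow> nat list \<Rightarrow> real" where
  "iota23 g N z (x # r) = sgn23 N * (-1) ^ (N * x) * iota (shift g) N (\<lambda>r. z (x # r)) r"
| "iota23 g N z [] = 0"

lemma lower_op_iota23:
  assumes "pos g"
  shows "lower_op g (Suc (Suc (Suc k))) (iota23 g N z) (x # y # w # r)
    = iota23 g N (lower_op (merge23 g N) (Suc (Suc k)) z) (x # y # w # r)"
proof -
  let ?c = "cg (g (Suc 0)) (g (Suc (Suc 0))) N (y + w - N) y w"
  have "lower_op (shift g) (Suc (Suc k)) (\<lambda>r. iota23 g N z (x # r)) (y # w # r)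
     = sgn23 N * (-1) ^ (N * x) * iota (shift g) N (lower_op (merge (shift g) N) (Suc k) (\<lambda>r. z (x # r))) (y # w # r)"
    unfolding iota23.simps lower_op_cmult lower_op_iota[OF pos_shift[OF assms]] ..
  moreover have "sqrt (sigma (g 0) (Suc x)) * ((-1) ^ (y + w + sum_list (take k r)) * iota23 g N z (Suc x # y # w # r))
     = sqrt (sigma (g 0) (Suc x)) * (sgn23 N * (-1) ^ (N * x) * (-1) ^ (y + w - N + sum_list (take k r)) * (?c * z (Suc x # (y + w - N) # r)))"
  proof (cases "N \<le> y + w")
    case True
    then obtain t where t: "y + w = N + t" by (auto simp: le_iff_add)
    then have tt: "y + w - N = t" "w + y - N = t" by auto
    have "(-1) ^ N * ((-1) ^ N * a) = a" for a :: real
      by (simp flip: mult.assoc power_add)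
    then show ?thesis unfolding t by (simp add: power_add t tt algebra_simps)
  next
    case False
    then show ?thesis by (simp add: cg_support)
  qed
  ultimately show ?thesis
    by (simp only: lower_op.simps(1) take_Suc_Cons sum_list.Cons iota23.simps iota.simps merge23_simps add.assoc)
       (simp add: algebra_simps)
qed

lemma raise_op_iota23:
  assumes "pos g"
  shows "raise_op g (Suc (Suc (Suc k))) (iota23 g N z) (x # y # w # r)
    = iota23 g N (raise_op (merge23 g N) (Suc (Suc k)) z) (x # y # w # r)"
proof -
  let ?c = "cg (g (Suc 0)) (g (Suc (Suc 0))) N (y + w - N) y w"
  have "raise_op (shift g) (Suc (Suc k)) (\<lambda>r. iota23 g N z (x # r)) (y # w # r)
     = sgn23 N * (-1) ^ (N * x) * iota (shift g) N (raise_op (merge (shift g) N) (Suc k) (\<lambda>r. z (x # r))) (y # w # r)"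
    unfolding iota23.simps raise_op_cmult raise_op_iota[OF pos_shift[OF assms]] ..
  moreover have "sqrt (sigma (g 0) x) * ((-1) ^ (y + w + sum_list (take k r)) * iota23 g N z ((x - 1) # y # w # r))
     = sqrt (sigma (g 0) x) * (sgn23 N * (-1) ^ (N * x) * (-1) ^ (y + w - N + sum_list (take k r)) * (?c * z ((x - 1) # (y + w - N) # r)))"
  proof (cases "N \<le> y + w")
    case True
    then obtain t where t: "y + w = N + t" by (auto simp: le_iff_add)
    then have tt: "y + w - N = t" "w + y - N = t" by auto
    show ?thesis unfolding t by (cases x) (simp_all add: power_add t tt algebra_simps)
  next
    case False
    then show ?thesis by (simp add: cg_support)
  qed
  ultimately show ?thesis
    by (simp only: raise_op.simps(1) take_Suc_Cons sum_list.Cons iota23.simps iota.simps merge23_simps add.assoc)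
       (simp add: algebra_simps)
qed

lemma Gam_iota23:
  assumes "pos g"
  shows "Gam g (Suc (Suc (Suc k))) (iota23 g N z) (x # y # w # r)
    = (-1) ^ N * iota23 g N (Gam (merge23 g N) (Suc (Suc k)) z) (x # y # w # r)"
proof -
  let ?t = "y + w - N"
  let ?c = "sgn23 N * (-1) ^ (N * x) * cg (g (Suc 0)) (g (Suc (Suc 0))) N ?t y w"
  have "raise_op g (Suc (Suc (Suc k))) (lower_op g (Suc (Suc (Suc k))) (iota23 g N z)) (x # y # w # r)
      = raise_op g (Suc (Suc (Suc k))) (iota23 g N (lower_op (merge23 g N) (Suc (Suc k)) z)) (x # y # w # r)"
  proof (rule raise_op_cong)
    fix v :: "nat list" assume "length v = length (x # y # w # r)"
    then obtain x' y' w' r' where "v = x' # y' # w' # r'" by (auto simp: length_Suc_conv)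
    then show "lower_op g (Suc (Suc (Suc k))) (iota23 g N z) v = iota23 g N (lower_op (merge23 g N) (Suc (Suc k)) z) v"
      using lower_op_iota23[OF assms] by (simp only:)
  qed
  also have "\<dots> = ?c * raise_op (merge23 g N) (Suc (Suc k)) (lower_op (merge23 g N) (Suc (Suc k)) z) (x # ?t # r)"
    unfolding raise_op_iota23[OF assms] by simp
  finally have rl: "raise_op g (Suc (Suc (Suc k))) (lower_op g (Suc (Suc (Suc k))) (iota23 g N z)) (x # y # w # r) = \<dots>" .
  have sums: "(\<Sum>i<Suc (Suc (Suc k)). g i) + real N = (\<Sum>i<Suc (Suc k). merge23 g N i)"
    by (simp add: sum.lessThan_Suc_shift del: sum.lessThan_Suc)
  show ?thesis
  proof (cases "N \<le> y + w")
    case True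
    then obtain t where t: "y + w = N + t" by (auto simp: le_iff_add)
    then have tt: "y + w - N = t" by simp
    have yw: "real y + real w = real N + real t" using arg_cong[OF t, of real] by simp
    have sg: "(-1) ^ y * (-1) ^ w = (-1) ^ N * ((-1) ^ t :: real)"
      using arg_cong[OF t, of "\<lambda>n. (-1) ^ n :: real"] by (simp only: power_add)
    let ?d = "sgn23 N * (-1) ^ (N * x) * cg (g (Suc 0)) (g (Suc (Suc 0))) N t y w"
    have "Gam g (Suc (Suc (Suc k))) (iota23 g N z) (x # y # w # r)
      = (-1) ^ x * ((-1) ^ y * (-1) ^ w) * (-1) ^ sum_list (take k r) *
       ((real x + (real y + real w) + real (sum_list (take k r)) + (\<Sum>i<Suc (Suc (Suc k)). g i) - 1/2) * (?d * z (x # t # r))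
        - ?d * raise_op (merge23 g N) (Suc (Suc k)) (lower_op (merge23 g N) (Suc (Suc k)) z) (x # t # r))"
      unfolding Gam_def rl tt iota23.simps iota.simps by (simp add: power_add mult.assoc add.assoc)
    also have "real x + (real y + real w) + real (sum_list (take k r)) + (\<Sum>i<Suc (Suc (Suc k)). g i) - 1/2
        = real (sum_list (take (Suc (Suc k)) (x # t # r))) + (\<Sum>i<Suc (Suc k). merge23 g N i) - 1/2"
      unfolding yw sums[symmetric] by simp
    also have "(-1) ^ x * ((-1) ^ y * (-1) ^ w) * (-1) ^ sum_list (take k r) *
       ((real (sum_list (take (Suc (Suc k)) (x # t # r))) + (\<Sum>i<Suc (Suc k). merge23 g N i) - 1/2) * (?d * z (x # t # r))
        - ?d * raise_op (merge23 g N) (Suc (Suc k)) (lower_op (merge23 g N) (Suc (Suc k)) z) (x # t # r))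
       = (-1) ^ N * (?d * Gam (merge23 g N) (Suc (Suc k)) z (x # t # r))"
      unfolding sg by (simp only: Gam_def take_Suc_Cons sum_list.Cons power_add)
        (simp only: right_diff_distrib mult.assoc mult.left_commute)
    finally show ?thesis unfolding iota23.simps iota.simps tt by (simp add: mult.assoc)
  next
    case False
    then have "cg (g (Suc 0)) (g (Suc (Suc 0))) N ?t y w = 0" by (simp add: cg_support)
    then show ?thesis unfolding Gam_def rl by simp
  qed
qed

lemma ip_iota23:
  assumes "pos g"
  shows "ip (Suc (Suc (Suc n))) N (iota23 g P u) (iota23 g Q v)
    = (if P = Q \<and> P \<le> N then ip (Suc (Suc n)) (N - P) u v else 0)"
proof -
  have sq: "sgn23 R * (-1) ^ (R * a) * (sgn23 R * (-1) ^ (R * a)) = 1" for a R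
  proof -
    have "sgn23 R * (-1) ^ (R * a) * (sgn23 R * (-1) ^ (R * a))
      = (sgn23 R * sgn23 R) * ((-1) ^ (R * a) * (-1) ^ (R * a))" by (simp only: mult_ac)
    then show ?thesis by (simp add: sgn23_square flip: power_add)
  qed
  have "ip (Suc (Suc (Suc n))) N (iota23 g P u) (iota23 g Q v)
    = (\<Sum>a\<le>N. (sgn23 P * (-1) ^ (P * a)) * (sgn23 Q * (-1) ^ (Q * a))
        * ip (Suc (Suc n)) (N - a) (iota (shift g) P (\<lambda>r. u (a # r))) (iota (shift g) Q (\<lambda>r. v (a # r))))"
    unfolding ip_Suc[of "Suc (Suc n)"] iota23.simps ip_cmult ..
  also have "\<dots> = (\<Sum>a\<le>N. if P = Q \<and> P \<le> N - a then ip (Suc n) (N - a - P) (\<lambda>r. u (a # r)) (\<lambda>r. v (a # r)) else 0)"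
    unfolding ip_iota[OF pos_shift[OF assms]] by (intro sum.cong refl) (simp add: sq)
  also have "\<dots> = (if P = Q \<and> P \<le> N then ip (Suc (Suc n)) (N - P) u v else 0)"
  proof (cases "P = Q \<and> P \<le> N")
    case True
    have "(\<Sum>a\<le>N. if P \<le> N - a then ip (Suc n) (N - a - P) (\<lambda>r. u (a # r)) (\<lambda>r. v (a # r)) else 0)
        = (\<Sum>a\<le>N - P. ip (Suc n) (N - a - P) (\<lambda>r. u (a # r)) (\<lambda>r. v (a # r)))"
      using True by (intro sum.mono_neutral_cong_right) auto
    then show ?thesis using True by (simp add: ip_Suc[of "Suc n"] add.commute)
  next
    case False
    then show ?thesis by (auto intro!: sum.neutral)
  qed
  finally show ?thesis .
qed

section \<open>The two bases\<close>

text \<open>The innermost vector is |0> of the only remaining site: the entries of s use up the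
  whole degree prescribed by the eigenvalue of A_0.\<close>

primrec Sv :: "(nat \<Rightarrow> real) \<Rightarrow> nat list \<Rightarrow> nat list \<Rightarrow> real" where
  "Sv g [] = (\<lambda>x. of_bool (x = [0]))"
| "Sv g (a # s) = iota g a (Sv (merge g a) s)"

fun Jv :: "(nat \<Rightarrow> real) \<Rightarrow> nat list \<Rightarrow> nat list \<Rightarrow> real" where
  "Jv g [] = (\<lambda>x. of_bool (x = [0]))"
| "Jv g [a] = iota g a (\<lambda>x. of_bool (x = [0]))"
| "Jv g (a # b # j) = iota23 g a (Jv (merge23 g a) (b # j))"

lemma iota_support:
  assumes "\<And>x. z x \<noteq> 0 \<Longrightarrow> x \<in> deg_lists n N" "iota g a z x \<noteq> 0"
  shows "x \<in> deg_lists (Suc n) (a + N)"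
proof -
  obtain y w r where x: "x = y # w # r" using assms(2) by (cases "(g, a, z, x)" rule: iota.cases) auto
  have "y + w = a + (y + w - a)"
    using assms(2) cg_support[of y w a "y + w - a" "g 0" "g (Suc 0)"] x by force
  moreover have "(y + w - a) # r \<in> deg_lists n N" using assms x by auto
  ultimately show ?thesis by (auto simp: x deg_lists_def)
qed

lemma iota23_support:
  assumes "\<And>x. z x \<noteq> 0 \<Longrightarrow> x \<in> deg_lists (Suc n) N" "iota23 g a z x \<noteq> 0"
  shows "x \<in> deg_lists (Suc (Suc n)) (a + N)"
proof (cases x)
  case (Cons y r)
  then have nz: "iota (shift g) a (\<lambda>r. z (y # r)) r \<noteq> 0" using assms(2) by auto
  then obtain w t where "z (y # w # t) \<noteq> 0"
    by (cases "(shift g, a, \<lambda>r. z (y # r), r)" rule: iota.cases) auto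
  from assms(1)[OF this] have "y \<le> N" by (auto simp: deg_lists_def)
  have "r \<in> deg_lists (Suc n) (a + (N - y))"
    using nz by (rule iota_support[rotated]) (use assms(1) in \<open>force simp: deg_lists_def\<close>)
  then show ?thesis using Cons \<open>y \<le> N\<close> by (auto simp: deg_lists_def)
qed (use assms in simp)

lemma Sv_support: "Sv g s x \<noteq> 0 \<Longrightarrow> x \<in> deg_lists (Suc (length s)) (sum_list s)"
proof (induction s arbitrary: g x)
  case (Cons a s)
  then show ?case using iota_support[of "Sv (merge g a) s" "Suc (length s)" "sum_list s" g a x] by simp
qed (auto simp: deg_lists_def split: if_splits)

lemma Jv_support: "Jv g j x \<noteq> 0 \<Longrightarrow> x \<in> deg_lists (Suc (length j)) (sum_list j)"
proof (induction g j arbitrary: x rule: Jv.induct)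
  case (2 g a)
  have "[0] \<in> deg_lists 1 0" by (simp add: deg_lists_def)
  then show ?case using 2 iota_support[of "\<lambda>x. of_bool (x = [0])" 1 0 g a x] by auto
next
  case (3 g a b j)
  then show ?case
    using iota23_support[of "Jv (merge23 g a) (b # j)" "Suc (length j)" "sum_list (b # j)" g a x] by simp
qed (auto simp: deg_lists_def split: if_splits)

lemma ip_single: "ip (Suc 0) 0 (\<lambda>x. of_bool (x = [0])) (\<lambda>x. of_bool (x = [0])) = 1"
proof -
  have "deg_lists (Suc 0) 0 = {[0]}" by (auto simp: deg_lists_def length_Suc_conv)
  then show ?thesis by (simp add: ip_def)
qed

lemma ip_Sv: "pos g \<Longrightarrow> ip (Suc (length s)) (sum_list s) (Sv g s) (Sv g s) = 1"
  by (induction s arbitrary: g) (simp_all add: ip_single ip_iota pos_merge)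

lemma ip_Jv: "pos g \<Longrightarrow> ip (Suc (length j)) (sum_list j) (Jv g j) (Jv g j) = 1"
proof (induction g j rule: Jv.induct)
  case (2 g a)
  then show ?case using ip_Sv[of g "[a]"] by simp
qed (simp_all add: ip_single ip_iota23 pos_merge23)

section \<open>Eigenvalues of the model vectors\<close>

lemma eigen_merge:
  fixes p N :: nat and c :: real
  shows "(-1) ^ N * ((-1) ^ p * (real p + (c + real N) - 1/2) * z) = (-1) ^ (N + p) * (real (N + p) + c - 1/2) * (z :: real)"
  by (simp add: power_add algebra_simps)

lemma sum_merge: "(\<Sum>i<Suc k. merge g a i) = (\<Sum>i<Suc (Suc k). g i) + real a"
  by (simp add: sum.lessThan_Suc_shift del: sum.lessThan_Suc)

lemma sum_merge23: "(\<Sum>i<Suc (Suc k). merge23 g a i) = (\<Sum>i<Suc (Suc (Suc k)). g i) + real a"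
  by (simp add: sum.lessThan_Suc_shift del: sum.lessThan_Suc)

text \<open>The factor (-1)^a and the a inside the merged parameter join (-1)^p and p, so the shape
  of the eigenvalue survives a merge.\<close>

lemma Gam_iota_eigen:
  assumes g: "pos g" and x: "length x = Suc (Suc n)"
    and z: "\<And>x. length x = Suc n \<Longrightarrow> Gam (merge g a) (Suc k) z x
      = (-1) ^ p * (real p + (\<Sum>i<Suc k. merge g a i) - 1/2) * z x"
  shows "Gam g (Suc (Suc k)) (iota g a z) x
    = (-1) ^ (a + p) * (real (a + p) + (\<Sum>i<Suc (Suc k). g i) - 1/2) * iota g a z x"
proof -
  obtain y w r where xr: "x = y # w # r" "length r = n" using x by (auto simp: length_Suc_conv)
  show ?thesis
    using xr z[of "(y + w - a) # r"] unfolding xr(1) Gam_iota[OF g] sum_merge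
    by (simp only: iota.simps eigen_merge[symmetric] length_Cons) (simp add: algebra_simps)
qed

lemma Gam_Sv:
  "pos g \<Longrightarrow> 0 < k \<Longrightarrow> k \<le> length s \<Longrightarrow> length x = Suc (length s) \<Longrightarrow>
    Gam g (Suc k) (Sv g s) x
      = (-1) ^ sum_list (take k s) * (real (sum_list (take k s)) + (\<Sum>i<Suc k. g i) - 1/2) * Sv g s x"
proof (induction s arbitrary: g k x)
  case (Cons a s)
  then obtain l where k: "k = Suc l" by (cases k) auto
  have "Gam g (Suc (Suc l)) (iota g a (Sv (merge g a) s)) x
    = (-1) ^ (a + sum_list (take l s)) * (real (a + sum_list (take l s)) + (\<Sum>i<Suc (Suc l). g i) - 1/2)
      * iota g a (Sv (merge g a) s) x"
  proof (rule Gam_iota_eigen[OF Cons.prems(1), where n = "length s"])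
    fix w :: "nat list" assume w: "length w = Suc (length s)"
    show "Gam (merge g a) (Suc l) (Sv (merge g a) s) w
      = (-1) ^ sum_list (take l s) * (real (sum_list (take l s)) + (\<Sum>i<Suc l. merge g a i) - 1/2)
        * Sv (merge g a) s w"
    proof (cases l)
      case 0
      then show ?thesis using w Gam_1[OF pos_merge[OF Cons.prems(1)], of a] by (cases w) auto
    next
      case (Suc m)
      then show ?thesis using Cons.prems k w by (intro Cons.IH pos_merge) auto
    qed
  qed (use Cons.prems in simp)
  then show ?case by (simp only: k Sv.simps take_Suc_Cons sum_list.Cons)
qed simp

text \<open>For a fixed first entry, \<open>iota23\<close> is a scalar times \<open>iota\<close> on
  the remaining sites. Hence the Casimir operators starting at site 2 treat \<open>Jv\<close> as
  those starting at site 1 treat \<open>Sv\<close>.\<close>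

lemma Gam_shift_Jv:
  "pos g \<Longrightarrow> 0 < k \<Longrightarrow> k < length j \<Longrightarrow> length r = length j \<Longrightarrow>
    Gam (shift g) (Suc k) (\<lambda>r. Jv g j (x # r)) r
      = (-1) ^ sum_list (take k j) * (real (sum_list (take k j)) + (\<Sum>i<Suc k. g (Suc i)) - 1/2) * Jv g j (x # r)"
proof (induction g j arbitrary: k r rule: Jv.induct)
  case (3 g a b j)
  then obtain l where k: "k = Suc l" by (cases k) auto
  let ?z = "\<lambda>r. Jv (merge23 g a) (b # j) (x # r)"
  have sg: "shift (merge23 g a) = merge (shift g) a" by simp
  have "Gam (shift g) (Suc (Suc l)) (iota (shift g) a ?z) r
    = (-1) ^ (a + sum_list (take l (b # j))) * (real (a + sum_list (take l (b # j))) + (\<Sum>i<Suc (Suc l). g (Suc i)) - 1/2)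
      * iota (shift g) a ?z r"
  proof (rule Gam_iota_eigen[OF pos_shift[OF 3(2)], where n = "length j"])
    fix w :: "nat list" assume w: "length w = Suc (length j)"
    show "Gam (merge (shift g) a) (Suc l) ?z w
      = (-1) ^ sum_list (take l (b # j)) * (real (sum_list (take l (b # j))) + (\<Sum>i<Suc l. merge (shift g) a i) - 1/2)
        * ?z w"
    proof (cases l)
      case 0
      then show ?thesis using w Gam_1[OF pos_merge[OF pos_shift[OF 3(2)]], of a] by (cases w) auto
    next
      case (Suc m)
      then have "Gam (shift (merge23 g a)) (Suc l) ?z w
        = (-1) ^ sum_list (take l (b # j)) * (real (sum_list (take l (b # j))) + (\<Sum>i<Suc l. merge23 g a (Suc i)) - 1/2)
        * ?z w"
        using 3 k w by (intro 3(1) pos_merge23) auto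
      then show ?thesis by simp
    qed
  qed (use 3 in simp)
  then show ?case
    by (simp only: k Jv.simps iota23.simps Gam_cmult take_Suc_Cons sum_list.Cons) (simp only: mult.assoc mult.left_commute)
qed auto

lemma Gam_Jv:
  "pos g \<Longrightarrow> j \<noteq> [] \<Longrightarrow> length x = Suc (length j) \<Longrightarrow>
    Gam g (Suc (length j)) (Jv g j) x
      = (-1) ^ sum_list j * (real (sum_list j) + (\<Sum>i<Suc (length j). g i) - 1/2) * Jv g j x"
proof (induction g j arbitrary: x rule: Jv.induct)
  case (2 g a)
  then show ?case using Gam_Sv[of g 1 "[a]" x] by simp
next
  case (3 g a b j)
  then obtain y w t r where x: "x = y # w # t # r" "length r = length j" by (auto simp: length_Suc_conv)
  have "Gam (merge23 g a) (Suc (length (b # j))) (Jv (merge23 g a) (b # j)) (y # (w + t - a) # r)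
    = (-1) ^ sum_list (b # j) * (real (sum_list (b # j)) + (\<Sum>i<Suc (length (b # j)). merge23 g a i) - 1/2)
      * Jv (merge23 g a) (b # j) (y # (w + t - a) # r)"
    using 3(2) x by (intro 3(1) pos_merge23) simp_all
  then show ?case
    unfolding x(1) Jv.simps length_Cons Gam_iota23[OF 3(2)] sum_merge23 sum_list.Cons[of a]
    by (simp only: iota23.simps iota.simps eigen_merge[symmetric]) (simp add: algebra_simps)
qed simp

section \<open>Uniqueness of the joint eigenvectors\<close>

lemma lower_op_zero:
  assumes "\<And>y. length y = length x \<Longrightarrow> f y = 0"
  shows "lower_op g k f x = 0"
proof -
  have "lower_op g k f x = lower_op g k (\<lambda>y. 0) x" using assms by (intro lower_op_cong)
  then show ?thesis using lower_op_cmult[of g k 0 "\<lambda>y. 0" x] by simp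
qed

lemma raise_op_zero:
  assumes "\<And>y. length y = length x \<Longrightarrow> f y = 0"
  shows "raise_op g k f x = 0"
proof -
  have "raise_op g k f x = raise_op g k (\<lambda>y. 0) x" using assms by (intro raise_op_cong)
  then show ?thesis using raise_op_cmult[of g k 0 "\<lambda>y. 0" x] by simp
qed

lemma lower_op_snoc: "length x = n \<Longrightarrow> lower_op g (Suc n) v (x @ [b]) =
    (-1) ^ b * lower_op g n (\<lambda>x. v (x @ [b])) x + sqrt (sigma (g n) (Suc b)) * v (x @ [Suc b])"
proof (induction n arbitrary: g v x)
  case (Suc n)
  then obtain a r where x: "x = a # r" "length r = n" by (auto simp: length_Suc_conv)
  show ?case
    using Suc.IH[OF x(2), of "shift g" "\<lambda>r. v (a # r)"] x(2)
    by (simp only: x(1) append_Cons lower_op.simps(1)) (simp add: power_add algebra_simps)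
qed simp

lemma raise_op_snoc: "length x = n \<Longrightarrow> raise_op g (Suc n) v (x @ [b]) =
    (-1) ^ b * raise_op g n (\<lambda>x. v (x @ [b])) x + sqrt (sigma (g n) b) * v (x @ [b - 1])"
proof (induction n arbitrary: g v x)
  case (Suc n)
  then obtain a r where x: "x = a # r" "length r = n" by (auto simp: length_Suc_conv)
  show ?case
    using Suc.IH[OF x(2), of "shift g" "\<lambda>r. v (a # r)"] x(2)
    by (simp only: x(1) append_Cons raise_op.simps(1)) (simp add: power_add algebra_simps)
qed simp

lemma lower_op_append: "k \<le> length x \<Longrightarrow> lower_op g k v (x @ y) = lower_op g k (\<lambda>x. v (x @ y)) x"
proof (induction k arbitrary: g v x)
  case (Suc k)
  then show ?case by (cases x) auto
qed simp

lemma raise_op_append: "k \<le> length x \<Longrightarrow> raise_op g k v (x @ y) = raise_op g k (\<lambda>x. v (x @ y)) x"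
proof (induction k arbitrary: g v x)
  case (Suc k)
  then show ?case by (cases x) auto
qed simp

lemma Gam_append:
  assumes "k \<le> length x"
  shows "Gam g k v (x @ y) = Gam g k (\<lambda>x. v (x @ y)) x"
proof -
  have "raise_op g k (\<lambda>x. lower_op g k v (x @ y)) x = raise_op g k (lower_op g k (\<lambda>x. v (x @ y))) x"
    using assms by (intro raise_op_cong) (simp add: lower_op_append)
  then show ?thesis using assms by (simp add: Gam_def raise_op_append)
qed

text \<open>The equation A_+ w = 0 at first entry a involves w at a - 1, already known to vanish,
  and A_+ on the remaining sites. So the induction hypothesis for one site less applies slice by
  slice.\<close>

lemma raise_op_inject:
  assumes "pos g" "\<And>x. length x = Suc n \<Longrightarrow> raise_op g (Suc n) w x = 0"
  shows "length x = Suc n \<Longrightarrow> w x = 0"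
  using assms
proof (induction n arbitrary: g w x)
  case 0
  then obtain a where x: "x = [a]" by (auto simp: length_Suc_conv)
  have "sigma (g 0) (Suc a) \<noteq> 0" using sigma_pos[of "g 0" a] 0 by simp
  then show ?case using 0(3)[of "[Suc a]"] by (simp add: x)
next
  case (Suc n)
  note IH = Suc.IH and raise_op_w = Suc.prems(3) and pos_g = Suc.prems(2)
  have step: "w (a # r) = 0"
    if "\<And>y. length y = Suc n \<Longrightarrow> sqrt (sigma (g 0) a) * w ((a - 1) # y) = 0" "length r = Suc n" for a r
  proof (rule IH[OF that(2) pos_shift[OF pos_g], where w = "\<lambda>r. w (a # r)"])
    fix y :: "nat list" assume y: "length y = Suc n"
    then show "raise_op (shift g) (Suc n) (\<lambda>r. w (a # r)) y = 0"
      using raise_op_w[of "a # y"] that(1)[OF y]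
      by (simp only: raise_op.simps(1) mult.assoc mult_zero_right add_0_left length_Cons)
  qed
  have "\<forall>r. length r = Suc n \<longrightarrow> w (a # r) = 0" for a
  proof (induction a)
    case 0
    show ?case using step[of 0] by simp
  next
    case (Suc a)
    then show ?case using step[of "Suc a"] by simp
  qed
  then show ?case using Suc.prems(1) by (auto simp: length_Suc_conv)
qed

lemma Gam_eigen_raise_op_lower_op:
  assumes "Gam g k w x = \<theta> * w x" "w x = 0"
  shows "raise_op g k (lower_op g k w) x = 0"
  using assms by (simp add: Gam_def)

text \<open>Where w vanishes, the eigenvalue equation reduces to A_+ A_- w = 0. If w vanishes for
  last entries up to c, then A_- w vanishes at last entry c - 1, so A_+ on the other sites kills its
  slice at c. By injectivity this slice is 0, and up to a nonzero factor it is w at last entry c +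
  1.\<close>

lemma eigen_slice_right:
  assumes g: "pos g" and w: "\<And>x. length x = Suc (Suc n) \<Longrightarrow> Gam g (Suc (Suc n)) w x = \<theta> * w x"
    and z: "\<And>x. length x = Suc n \<Longrightarrow> w (x @ [0]) = 0" and x: "length x = Suc (Suc n)"
  shows "w x = 0"
proof -
  have "\<forall>x. length x = Suc n \<longrightarrow> w (x @ [b]) = 0" for b
  proof (induction b rule: less_induct)
    case (less b)
    show ?case
    proof (cases b)
      case (Suc c)
      have c: "w (x @ [c]) = 0" if "length x = Suc n" for x using less[of c] that Suc by auto
      have "raise_op g (Suc n) (\<lambda>x. lower_op g (Suc (Suc n)) w (x @ [c])) x = 0" if x: "length x = Suc n" for x
      proof -
        have "sqrt (sigma (g (Suc n)) c) * lower_op g (Suc (Suc n)) w (x @ [c - 1]) = 0"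
        proof (cases c)
          case (Suc d)
          then have "w (x @ [d]) = 0" if "length x = Suc n" for x using less[of d] \<open>b = Suc c\<close> that by auto
          then show ?thesis using Suc x c by (simp only: lower_op_snoc[OF x]) (simp add: lower_op_zero)
        qed simp
        moreover have "raise_op g (Suc (Suc n)) (lower_op g (Suc (Suc n)) w) (x @ [c]) = 0"
          using Gam_eigen_raise_op_lower_op[OF w[of "x @ [c]"]] x c by simp
        ultimately have "(-1) ^ c * raise_op g (Suc n) (\<lambda>x. lower_op g (Suc (Suc n)) w (x @ [c])) x = 0"
          unfolding raise_op_snoc[OF x] by linarith
        then show ?thesis by simp
      qed
      then have L: "lower_op g (Suc (Suc n)) w (x @ [c]) = 0" if "length x = Suc n" for x
        using raise_op_inject[OF g, of n "\<lambda>x. lower_op g (Suc (Suc n)) w (x @ [c])"] that by blast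
      have "sqrt (sigma (g (Suc n)) (Suc c)) * w (x @ [Suc c]) = 0" if "length x = Suc n" for x
        using L[OF that] c that unfolding lower_op_snoc[OF that] by (simp add: lower_op_zero)
      moreover have "sigma (g (Suc n)) (Suc c) \<noteq> 0" using sigma_pos[of "g (Suc n)" c] g by simp
      ultimately show ?thesis using Suc by simp
    qed (use z in simp)
  qed
  then show ?thesis using x by (metis append_butlast_last_id length_butlast diff_Suc_1 length_0_conv nat.distinct(1))
qed

text \<open>The mirror image of \<open>eigen_slice_right\<close>; the first site now carries the
  parity of the others as a sign.\<close>

lemma eigen_slice_left:
  assumes g: "pos g" and w: "\<And>x. length x = Suc (Suc n) \<Longrightarrow> Gam g (Suc (Suc n)) w x = \<theta> * w x"
    and z: "\<And>r. length r = Suc n \<Longrightarrow> w (0 # r) = 0" and x: "length x = Suc (Suc n)"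
  shows "w x = 0"
proof -
  let ?S = "\<lambda>r. (-1) ^ sum_list (take (Suc n) r) :: real"
  have "\<forall>r. length r = Suc n \<longrightarrow> w (b # r) = 0" for b
  proof (induction b rule: less_induct)
    case (less b)
    show ?case
    proof (cases b)
      case (Suc c)
      have c: "w (c # r) = 0" if "length r = Suc n" for r using less[of c] that Suc by auto
      have "raise_op (shift g) (Suc n) (\<lambda>r. lower_op g (Suc (Suc n)) w (c # r)) r = 0" if r: "length r = Suc n" for r
      proof -
        have "sqrt (sigma (g 0) c) * lower_op g (Suc (Suc n)) w ((c - 1) # r) = 0"
        proof (cases c)
          case (Suc d)
          then have d: "w (d # r) = 0" if "length r = Suc n" for r using less[of d] \<open>b = Suc c\<close> that by auto
          then have "lower_op (shift g) (Suc n) (\<lambda>r. w (d # r)) r = 0" using r by (intro lower_op_zero) simp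
          then show ?thesis using Suc r c by (simp only: lower_op.simps(1)) simp
        qed simp
        moreover have "raise_op g (Suc (Suc n)) (lower_op g (Suc (Suc n)) w) (c # r) = 0"
          using Gam_eigen_raise_op_lower_op[OF w[of "c # r"]] r c by simp
        ultimately show ?thesis
          by (simp only: raise_op.simps(1) mult.assoc mult_zero_right add_0_left)
      qed
      then have "lower_op g (Suc (Suc n)) w (c # r) = 0" if "length r = Suc n" for r
        using raise_op_inject[OF pos_shift[OF g], of n "\<lambda>r. lower_op g (Suc (Suc n)) w (c # r)"] that by blast
      moreover have "lower_op (shift g) (Suc n) (\<lambda>r. w (c # r)) r = 0" if "length r = Suc n" for r
        using that c by (intro lower_op_zero) simp
      ultimately have "?S r * sqrt (sigma (g 0) (Suc c)) * w (Suc c # r) = 0" if "length r = Suc n" for r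
        using that by (simp only: lower_op.simps(1)) simp
      moreover have "sigma (g 0) (Suc c) \<noteq> 0" using sigma_pos[of "g 0" c] g by simp
      ultimately show ?thesis using Suc by simp
    qed (use z in simp)
  qed
  then show ?thesis using x by (auto simp: length_Suc_conv)
qed

text \<open>A symmetric form of proportionality, which restricts to slices without asking which of
  the vectors is nonzero there.\<close>

definition dependent_on :: "nat \<Rightarrow> (nat list \<Rightarrow> real) \<Rightarrow> (nat list \<Rightarrow> real) \<Rightarrow> bool" where
  "dependent_on n u v \<longleftrightarrow> (\<exists>c d. (c \<noteq> 0 \<or> d \<noteq> 0) \<and> (\<forall>x. length x = n \<longrightarrow> c * u x + d * v x = 0))"

lemma Gam_linear:
  "Gam g k (\<lambda>x. c * u x + d * v x) x = c * Gam g k u x + d * Gam g k v x"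
  by (simp only: Gam_add Gam_cmult)

text \<open>The slice with last entry 0 keeps all eigenvalue equations except that of the total
  Casimir operator, which in turn extends a dependence from the slice to the whole vectors. With one
  site left, the degree L leaves a single coordinate.\<close>

lemma prefix_eigen_unique:
  assumes "pos g"
    and "\<And>k x. k \<in> {1..n} \<Longrightarrow> length x = Suc n \<Longrightarrow> Gam g (Suc k) u x = \<theta> k * u x"
    and "\<And>k x. k \<in> {1..n} \<Longrightarrow> length x = Suc n \<Longrightarrow> Gam g (Suc k) v x = \<theta> k * v x"
    and "\<And>x. length x = Suc n \<Longrightarrow> sum_list x \<noteq> L \<Longrightarrow> u x = 0 \<and> v x = 0"
  shows "dependent_on (Suc n) u v"
  using assms
proof (induction n arbitrary: u v)
  case 0
  have uv: "u x = 0 \<and> v x = 0" if "length x = Suc 0" "x \<noteq> [L]" for x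
  proof -
    obtain y where y: "x = [y]" using \<open>length x = Suc 0\<close> by (auto simp: length_Suc_conv)
    then show ?thesis using \<open>x \<noteq> [L]\<close> 0(4)[of "[y]"] by simp
  qed
  show ?case
  proof (cases "u [L] = 0 \<and> v [L] = 0")
    case True
    then have "1 * u x + 0 * v x = 0" if "length x = Suc 0" for x
      using uv[OF that] by (cases "x = [L]") auto
    then show ?thesis unfolding dependent_on_def by (intro exI[of _ "1::real"] exI[of _ "0::real"]) simp
  next
    case False
    have "v [L] * u x + - u [L] * v x = 0" if "length x = Suc 0" for x
      using uv[OF that] by (cases "x = [L]") auto
    moreover have "v [L] \<noteq> 0 \<or> - u [L] \<noteq> 0" using False by auto
    ultimately show ?thesis unfolding dependent_on_def by blast
  qed
next
  case (Suc n)
  have "dependent_on (Suc n) (\<lambda>x. u (x @ [0])) (\<lambda>x. v (x @ [0]))"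
  proof (rule Suc.IH)
    fix k and x :: "nat list" assume k: "k \<in> {1..n}" and x: "length x = Suc n"
    have kx: "Suc k \<le> length x" "k \<in> {1..Suc n}" "length (x @ [0]) = Suc (Suc n)" using k x by auto
    show "Gam g (Suc k) (\<lambda>x. u (x @ [0])) x = \<theta> k * u (x @ [0])"
      "Gam g (Suc k) (\<lambda>x. v (x @ [0])) x = \<theta> k * v (x @ [0])"
      using Suc.prems(2,3)[OF kx(2,3)] unfolding Gam_append[OF kx(1)] by auto
  qed (use Suc.prems(1,4) in auto)
  then obtain c d where cd: "c \<noteq> 0 \<or> d \<noteq> 0"
    "\<And>x. length x = Suc n \<Longrightarrow> c * u (x @ [0]) + d * v (x @ [0]) = 0"
    unfolding dependent_on_def by blast
  have "c * u x + d * v x = 0" if "length x = Suc (Suc n)" for x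
  proof (rule eigen_slice_right[OF Suc.prems(1) _ _ that, where w = "\<lambda>x. c * u x + d * v x" and \<theta> = "\<theta> (Suc n)"])
    show "Gam g (Suc (Suc n)) (\<lambda>x. c * u x + d * v x) x = \<theta> (Suc n) * (c * u x + d * v x)"
      if "length x = Suc (Suc n)" for x
      using Suc.prems(2,3)[of "Suc n" x] that by (simp add: Gam_linear algebra_simps)
  qed (use cd in auto)
  then show ?case unfolding dependent_on_def using cd(1) by blast
qed

text \<open>On the slice with first entry 0, the operators starting at site 2 become those of
  \<open>prefix_eigen_unique\<close>; the total Casimir operator then extends the
  dependence.\<close>

lemma suffix_eigen_unique:
  assumes g: "pos g"
    and u: "\<And>k a r. k \<in> {1..n} \<Longrightarrow> length r = Suc n \<Longrightarrow> Gam (shift g) (Suc k) (\<lambda>r. u (a # r)) r = \<theta> k * u (a # r)"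
      "\<And>x. length x = Suc (Suc n) \<Longrightarrow> Gam g (Suc (Suc n)) u x = \<eta> * u x"
    and v: "\<And>k a r. k \<in> {1..n} \<Longrightarrow> length r = Suc n \<Longrightarrow> Gam (shift g) (Suc k) (\<lambda>r. v (a # r)) r = \<theta> k * v (a # r)"
      "\<And>x. length x = Suc (Suc n) \<Longrightarrow> Gam g (Suc (Suc n)) v x = \<eta> * v x"
    and s: "\<And>x. length x = Suc (Suc n) \<Longrightarrow> sum_list x \<noteq> L \<Longrightarrow> u x = 0 \<and> v x = 0"
  shows "dependent_on (Suc (Suc n)) u v"
proof -
  have "dependent_on (Suc n) (\<lambda>r. u (0 # r)) (\<lambda>r. v (0 # r))"
    by (rule prefix_eigen_unique[OF pos_shift[OF g], where L = L]) (use u(1) v(1) s in auto)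
  then obtain c d where cd: "c \<noteq> 0 \<or> d \<noteq> 0"
    "\<And>x. length x = Suc n \<Longrightarrow> c * u (0 # x) + d * v (0 # x) = 0"
    unfolding dependent_on_def by blast
  have "c * u x + d * v x = 0" if "length x = Suc (Suc n)" for x
  proof (rule eigen_slice_left[OF g _ _ that, where w = "\<lambda>x. c * u x + d * v x" and \<theta> = \<eta>])
    show "Gam g (Suc (Suc n)) (\<lambda>x. c * u x + d * v x) x = \<eta> * (c * u x + d * v x)"
      if "length x = Suc (Suc n)" for x
      using u(2) v(2) that by (simp add: Gam_linear algebra_simps)
  qed (use cd in auto)
  then show ?thesis unfolding dependent_on_def using cd(1) by blast
qed

lemma dependent_on_proportional:
  assumes "dependent_on n u v" "length y = n" "v y \<noteq> 0"
  shows "\<exists>c. \<forall>x. length x = n \<longrightarrow> u x = c * v x"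
proof -
  obtain c d where cd: "c \<noteq> 0 \<or> d \<noteq> 0" "\<And>x. length x = n \<Longrightarrow> c * u x + d * v x = 0"
    using assms(1) unfolding dependent_on_def by blast
  have "c \<noteq> 0" using cd(1) cd(2)[OF assms(2)] assms(3) by auto
  then have "u x = - d / c * v x" if "length x = n" for x
  proof -
    have "c * u x = - d * v x" using cd(2)[OF that] by simp
    then show ?thesis using \<open>c \<noteq> 0\<close> by (simp add: field_simps)
  qed
  then show ?thesis by blast
qed

section \<open>From the conditions on |s> and |j> to real eigenvalue equations\<close>

lemma lower_op_par_cong: "(\<And>i. i < k \<Longrightarrow> g i = h i) \<Longrightarrow> lower_op g k v x = lower_op h k v x"
proof (induction k arbitrary: g h v x)
  case (Suc k)
  have "lower_op (shift g) k w r = lower_op (shift h) k w r" for w r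
    by (rule Suc.IH) (rule Suc.prems, simp)
  moreover have "g 0 = h 0" by (rule Suc.prems) simp
  ultimately show ?case by (cases x) simp_all
qed simp

lemma raise_op_par_cong: "(\<And>i. i < k \<Longrightarrow> g i = h i) \<Longrightarrow> raise_op g k v x = raise_op h k v x"
proof (induction k arbitrary: g h v x)
  case (Suc k)
  have "raise_op (shift g) k w r = raise_op (shift h) k w r" for w r
    by (rule Suc.IH) (rule Suc.prems, simp)
  moreover have "g 0 = h 0" by (rule Suc.prems) simp
  ultimately show ?case by (cases x) simp_all
qed simp

lemma Gam_par_cong:
  assumes "\<And>i. i < k \<Longrightarrow> g i = h i"
  shows "Gam g k v x = Gam h k v x"
proof -
  have "lower_op g k v = lower_op h k v" using assms by (intro ext lower_op_par_cong)
  moreover have "raise_op g k w x = raise_op h k w x" for w using assms by (intro raise_op_par_cong)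
  ultimately show ?thesis using assms by (simp add: Gam_def)
qed

text \<open>The value 1 beyond site n makes \<open>pos\<close> hold at every index; the operators
  read only the first n values.\<close>

definition site_pars :: "(nat \<Rightarrow> real) \<Rightarrow> nat \<Rightarrow> nat \<Rightarrow> real" where
  "site_pars \<gamma> n i = (if i < n then \<gamma> (Suc i) else 1)"

lemma pos_site_pars: "(\<And>i. i \<in> {1..n} \<Longrightarrow> \<gamma> i > 1/2) \<Longrightarrow> pos (site_pars \<gamma> n)"
  unfolding pos_def site_pars_def by (auto intro: less_trans[of 0 "1/2"])

lemma alg_act_space:
  "v \<in> tensor_space n \<Longrightarrow> 1 \<le> k \<Longrightarrow> k \<le> l \<Longrightarrow> l \<le> n \<Longrightarrow> alg_act \<gamma> n k l a v \<in> tensor_space n"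
proof (induction a arbitrary: v)
  case (Scale c a)
  then have "alg_act \<gamma> n k l a v \<in> tensor_space n" by simp
  then show ?case unfolding tensor_space_def by (auto elim: rev_finite_subset)
qed (simp_all add: letter_act_space add_space)

lemma is_eigen_iff:
  assumes "v \<in> tensor_space n" "w \<in> tensor_space n" "T v = w"
  shows "is_eigen T c v \<longleftrightarrow> (\<forall>x. length x = n \<longrightarrow> w x = of_real c * v x)"
  unfolding is_eigen_def fun_eq_iff assms(3)
  using assms(1,2) unfolding tensor_space_def by (auto, metis mult_zero_right)

lemma is_eigen_prefix:
  assumes v: "v \<in> tensor_space n" and k: "1 \<le> k" "k \<le> n"
  shows "is_eigen (Gamma_op \<gamma> n 1 k) c v \<longleftrightarrow>
    (\<forall>x. length x = n \<longrightarrow> Gam (site_pars \<gamma> n) k (\<lambda>y. Re (v y)) x = c * Re (v x) \<and>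
       Gam (site_pars \<gamma> n) k (\<lambda>y. Im (v y)) x = c * Im (v x))"
proof -
  have "Gam (shift \<gamma>) k f x = Gam (site_pars \<gamma> n) k f x" for f x
    using k by (intro Gam_par_cong) (simp add: site_pars_def)
  moreover have "Gamma_op \<gamma> n 1 k v \<in> tensor_space n"
    unfolding Gamma_op_def using v k by (intro alg_act_space) auto
  ultimately show ?thesis
    using is_eigen_iff[OF v _ refl, of "Gamma_op \<gamma> n 1 k" c] Gamma_op_prefix[OF v k, of _ \<gamma>]
    by (simp add: complex_eq_iff)
qed

lemma is_eigen_suffix:
  assumes v: "v \<in> tensor_space (Suc m)" and k: "1 \<le> k" "k \<le> m"
  shows "is_eigen (Gamma_op \<gamma> (Suc m) 2 (Suc k)) c v \<longleftrightarrow>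
    (\<forall>a r. length r = m \<longrightarrow>
       Gam (shift (site_pars \<gamma> (Suc m))) k (\<lambda>y. Re (v (a # y))) r = c * Re (v (a # r)) \<and>
       Gam (shift (site_pars \<gamma> (Suc m))) k (\<lambda>y. Im (v (a # y))) r = c * Im (v (a # r)))"
proof -
  have eq: "Gam (shift (shift \<gamma>)) k f x = Gam (shift (site_pars \<gamma> (Suc m))) k f x" for f x
    using k by (intro Gam_par_cong) (simp add: site_pars_def)
  have op: "Gamma_op \<gamma> (Suc m) 2 (Suc k) v (a # r)
    = Complex (Gam (shift (site_pars \<gamma> (Suc m))) k (\<lambda>y. Re (v (a # y))) r)
        (Gam (shift (site_pars \<gamma> (Suc m))) k (\<lambda>y. Im (v (a # y))) r)" if "length r = m" for a r
    using Gamma_op_suffix[OF v k(1), of a r \<gamma>] k that by (simp only: eq) simp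
  have "Gamma_op \<gamma> (Suc m) 2 (Suc k) v \<in> tensor_space (Suc m)"
    unfolding Gamma_op_def using v k by (intro alg_act_space) auto
  then have "is_eigen (Gamma_op \<gamma> (Suc m) 2 (Suc k)) c v \<longleftrightarrow>
      (\<forall>a r. length r = m \<longrightarrow> Gamma_op \<gamma> (Suc m) 2 (Suc k) v (a # r) = of_real c * v (a # r))"
    using is_eigen_iff[OF v _ refl, of "Gamma_op \<gamma> (Suc m) 2 (Suc k)" c] by (auto simp: length_Suc_conv)
  then show ?thesis by (simp add: op complex_eq_iff)
qed

lemma is_eigen_A0:
  assumes v: "v \<in> tensor_space n" and n: "1 \<le> n"
  shows "is_eigen (A0_op \<gamma> n) (real N + (\<Sum>t = 1..n. \<gamma> t)) v \<longleftrightarrow> (\<forall>x. sum_list x \<noteq> N \<longrightarrow> v x = 0)"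
proof -
  have "(\<Sum>i<n. \<gamma> (Suc i)) = (\<Sum>t = 1..n. \<gamma> t)"
    by (rule sum.reindex_bij_witness[of _ "\<lambda>t. t - 1" Suc]) auto
  then have "is_eigen (A0_op \<gamma> n) (real N + (\<Sum>t = 1..n. \<gamma> t)) v
     \<longleftrightarrow> (\<forall>x. (real (sum_list x) + (\<Sum>t = 1..n. \<gamma> t)) = (real N + (\<Sum>t = 1..n. \<gamma> t)) \<or> v x = 0)"
    unfolding is_eigen_def fun_eq_iff A0_op_eq[OF assms] by (simp only: mult_cancel_right of_real_eq_iff disj_commute)
  then show ?thesis by auto
qed

lemma overlap_eq_sum:
  assumes "finite A" "\<And>x. u x \<noteq> 0 \<Longrightarrow> x \<in> A"
  shows "overlap u v = (\<Sum>x\<in>A. cnj (u x) * v x)"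
  unfolding overlap_def using assms by (intro sum.mono_neutral_left) auto

lemma overlap_of_real:
  assumes "\<And>x. u x \<noteq> 0 \<Longrightarrow> x \<in> deg_lists n N"
  shows "overlap (\<lambda>x. of_real (u x)) (\<lambda>x. of_real (v x)) = of_real (ip n N u v)"
  using assms by (subst overlap_eq_sum[of "deg_lists n N"]) (auto simp: ip_def)

lemma of_real_space:
  assumes "\<And>x. u x \<noteq> 0 \<Longrightarrow> x \<in> deg_lists n N"
  shows "(\<lambda>x. of_real (u x)) \<in> tensor_space n"
  unfolding tensor_space_def
  using assms by (auto intro: finite_subset[of _ "deg_lists n N"]) (simp add: deg_lists_def)

lemma gamma_eigenvalue_site_pars:
  "1 \<le> k \<Longrightarrow> k \<le> n \<Longrightarrow> gamma_eigenvalue \<gamma> 1 k q = (-1) ^ q * (real q + (\<Sum>i<k. site_pars \<gamma> n i) - 1/2)"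
proof -
  assume "1 \<le> k" "k \<le> n"
  then have "(\<Sum>i<k. site_pars \<gamma> n i) = (\<Sum>t = 1..k. \<gamma> t)"
    by (intro sum.reindex_bij_witness[of _ "\<lambda>t. t - 1" Suc]) (auto simp: site_pars_def)
  then show ?thesis by (simp add: gamma_eigenvalue_def)
qed

lemma gamma_eigenvalue_shift_site_pars:
  "1 \<le> k \<Longrightarrow> Suc k \<le> n \<Longrightarrow> gamma_eigenvalue \<gamma> 2 (Suc k) q = (-1) ^ q * (real q + (\<Sum>i<k. site_pars \<gamma> n (Suc i)) - 1/2)"
proof -
  assume "1 \<le> k" "Suc k \<le> n"
  then have "(\<Sum>i<k. site_pars \<gamma> n (Suc i)) = (\<Sum>t = 2..Suc k. \<gamma> t)"
    by (intro sum.reindex_bij_witness[of _ "\<lambda>t. t - 2" "\<lambda>i. Suc (Suc i)"]) (auto simp: site_pars_def)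
  then show ?thesis by (simp add: gamma_eigenvalue_def)
qed

lemma Gam_zero: "Gam g k (\<lambda>y. 0) x = 0"
  using Gam_cmult[of g k 0 "\<lambda>y. 0" x] by simp

lemma psum_full: "length s = m \<Longrightarrow> psum s m = sum_list s"
  by (simp add: psum_def)

lemma is_s_vector_Sv:
  assumes g: "\<And>i. i \<in> {1..n} \<Longrightarrow> \<gamma> i > 1/2" and n: "n = Suc (length s)"
  shows "is_s_vector \<gamma> n s (\<lambda>x. of_real (Sv (site_pars \<gamma> n) s x))"
proof -
  let ?g = "site_pars \<gamma> n"
  let ?v = "\<lambda>x. complex_of_real (Sv ?g s x)"
  have pg: "pos ?g" using g by (rule pos_site_pars)
  have sp: "?v \<in> tensor_space n" unfolding n by (rule of_real_space[OF Sv_support])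
  have "overlap ?v ?v = 1"
    using overlap_of_real[where u = "Sv ?g s" and v = "Sv ?g s", OF Sv_support] ip_Sv[OF pg] by simp
  moreover have "is_eigen (Gamma_op \<gamma> n 1 (k + 1)) (gamma_eigenvalue \<gamma> 1 (k + 1) (psum s k)) ?v"
    if "k \<in> {1..n - 1}" for k
  proof -
    have kk: "1 \<le> Suc k" "Suc k \<le> n" using that n by auto
    have "is_eigen (Gamma_op \<gamma> n 1 (Suc k)) (gamma_eigenvalue \<gamma> 1 (Suc k) (psum s k)) ?v"
      unfolding is_eigen_prefix[OF sp kk] gamma_eigenvalue_site_pars[OF kk] psum_def
      using Gam_Sv[OF pg, of k s] that n by (simp add: Gam_zero del: sum.lessThan_Suc)
    then show ?thesis by simp
  qed
  moreover have "is_eigen (A0_op \<gamma> n) (real (psum s (n - 1)) + (\<Sum>t = 1..n. \<gamma> t)) ?v"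
    using is_eigen_A0[OF sp, of \<gamma> "psum s (n - 1)"] Sv_support[of ?g s] n
    by (auto simp: psum_full deg_lists_def)
  ultimately show ?thesis using sp by (simp add: is_s_vector_def)
qed

lemma is_j_vector_Jv:
  assumes g: "\<And>i. i \<in> {1..n} \<Longrightarrow> \<gamma> i > 1/2" and n: "n = Suc (length j)" "j \<noteq> []"
  shows "is_j_vector \<gamma> n j (\<lambda>x. of_real (Jv (site_pars \<gamma> n) j x))"
proof -
  let ?g = "site_pars \<gamma> n"
  let ?v = "\<lambda>x. complex_of_real (Jv ?g j x)"
  have pg: "pos ?g" using g by (rule pos_site_pars)
  have sp: "?v \<in> tensor_space n" unfolding n by (rule of_real_space[OF Jv_support])
  have sp': "?v \<in> tensor_space (Suc (length j))" using sp n by simp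
  have "overlap ?v ?v = 1"
    using overlap_of_real[where u = "Jv ?g j" and v = "Jv ?g j", OF Jv_support] ip_Jv[OF pg] by simp
  moreover have "is_eigen (Gamma_op \<gamma> n 2 (k + 1)) (gamma_eigenvalue \<gamma> 2 (k + 1) (psum j (k - 1))) ?v"
    if k: "k \<in> {2..n - 1}" for k
  proof -
    obtain l where l: "k = Suc l" using k by (cases k) auto
    then have kk: "1 \<le> Suc l" "Suc l \<le> length j" "Suc (Suc l) \<le> n" using k n by auto
    have "is_eigen (Gamma_op \<gamma> (Suc (length j)) 2 (Suc (Suc l))) (gamma_eigenvalue \<gamma> 2 (Suc (Suc l)) (psum j l)) ?v"
      unfolding is_eigen_suffix[OF sp' kk(1,2)] gamma_eigenvalue_shift_site_pars[OF kk(1,3)] psum_def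
      using Gam_shift_Jv[OF pg, of l j] k l n by (simp add: Gam_zero del: sum.lessThan_Suc)
    then show ?thesis using l n by simp
  qed
  moreover have "is_eigen (Gamma_op \<gamma> n 1 n) (gamma_eigenvalue \<gamma> 1 n (psum j (n - 1))) ?v"
  proof -
    have kk: "1 \<le> n" "n \<le> n" using n by auto
    show ?thesis
      unfolding is_eigen_prefix[OF sp kk] gamma_eigenvalue_site_pars[OF kk]
      using Gam_Jv[OF pg n(2)] n by (simp add: Gam_zero psum_full del: sum.lessThan_Suc)
  qed
  moreover have "is_eigen (A0_op \<gamma> n) (real (psum j (n - 1)) + (\<Sum>t = 1..n. \<gamma> t)) ?v"
    using is_eigen_A0[OF sp, of \<gamma> "psum j (n - 1)"] Jv_support[of ?g j] n
    by (auto simp: psum_full deg_lists_def)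
  ultimately show ?thesis using sp by (simp add: is_j_vector_def)
qed

lemma ip_nonzero_obtain:
  assumes "ip n N u u = 1"
  obtains y where "length y = n" "u y \<noteq> 0"
proof -
  have "\<exists>y\<in>deg_lists n N. u y * u y \<noteq> 0"
  proof (rule ccontr)
    assume "\<not> ?thesis"
    then have "ip n N u u = 0" unfolding ip_def by (intro sum.neutral) blast
    then show False using assms by simp
  qed
  then show ?thesis using that by (auto simp: deg_lists_def)
qed

text \<open>The operators being real, the real and the imaginary part of an eigenvector are
  separately multiples of S. The two factors form one complex number, of modulus 1 as both vectors
  are unit vectors.\<close>

lemma unit_vector_phase:
  assumes v: "v \<in> tensor_space n" "overlap v v = 1" and S: "\<And>x. S x \<noteq> 0 \<Longrightarrow> x \<in> deg_lists n N" "ip n N S S = 1"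
    and Re: "\<And>x. length x = n \<Longrightarrow> Re (v x) = a * S x" and Im: "\<And>x. length x = n \<Longrightarrow> Im (v x) = b * S x"
  shows "\<exists>c. norm c = 1 \<and> v = (\<lambda>x. c * of_real (S x))"
proof -
  have eq: "v = (\<lambda>x. Complex a b * of_real (S x))"
  proof
    fix x
    show "v x = Complex a b * of_real (S x)"
    proof (cases "length x = n")
      case False
      then have "v x = 0" "S x = 0" using v S(1)[of x] by (auto simp: tensor_space_def deg_lists_def)
      then show ?thesis by simp
    qed (simp add: complex_eq_iff Re Im)
  qed
  have "overlap v v = (\<Sum>x\<in>deg_lists n N. cnj (v x) * v x)"
    using S(1) by (intro overlap_eq_sum) (auto simp: eq)
  also have "\<dots> = (\<Sum>x\<in>deg_lists n N. (cnj (Complex a b) * Complex a b) * of_real (S x * S x))"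
    by (simp add: eq mult_ac)
  also have "\<dots> = (cnj (Complex a b) * Complex a b) * of_real (ip n N S S)"
    by (simp add: ip_def sum_distrib_left)
  finally have "cnj (Complex a b) * Complex a b = 1" using v S by simp
  then have "Complex a b * cnj (Complex a b) = 1" by (simp add: mult.commute)
  then have "(norm (Complex a b))\<^sup>2 = 1" using complex_norm_square[of "Complex a b"] by (metis of_real_eq_1_iff)
  then have "norm (Complex a b) = 1" by (simp add: power2_eq_1_iff) (smt (verit) norm_ge_zero)
  then show ?thesis using eq by blast
qed

lemma is_s_vector_unique:
  assumes g: "\<And>i. i \<in> {1..n} \<Longrightarrow> \<gamma> i > 1/2" and n: "n = Suc (length s)" and v: "is_s_vector \<gamma> n s v"
  shows "\<exists>c. norm c = 1 \<and> v = (\<lambda>x. c * of_real (Sv (site_pars \<gamma> n) s x))"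
proof -
  let ?g = "site_pars \<gamma> n"
  have pg: "pos ?g" using g by (rule pos_site_pars)
  have sp: "v \<in> tensor_space n" and ov: "overlap v v = 1" using v by (auto simp: is_s_vector_def)
  let ?\<theta> = "\<lambda>k. gamma_eigenvalue \<gamma> 1 (Suc k) (psum s k)"
  have ev: "Gam ?g (Suc k) (\<lambda>y. Re (v y)) x = ?\<theta> k * Re (v x)"
    "Gam ?g (Suc k) (\<lambda>y. Im (v y)) x = ?\<theta> k * Im (v x)"
    if "k \<in> {1..length s}" "length x = Suc (length s)" for k x
    using v that is_eigen_prefix[OF sp, of "Suc k" \<gamma> "?\<theta> k"] n by (auto simp: is_s_vector_def)
  have es: "Gam ?g (Suc k) (Sv ?g s) x = ?\<theta> k * Sv ?g s x"
    if "k \<in> {1..length s}" "length x = Suc (length s)" for k x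
  proof -
    have kk: "1 \<le> Suc k" "Suc k \<le> n" using that n by auto
    show ?thesis
      unfolding gamma_eigenvalue_site_pars[OF kk] psum_def using that by (intro Gam_Sv[OF pg]) auto
  qed
  have zv: "v x = 0" if "sum_list x \<noteq> sum_list s" for x
    using v that is_eigen_A0[OF sp, of \<gamma> "psum s (n - 1)"] n by (auto simp: is_s_vector_def psum_full)
  have zs: "Sv ?g s x = 0" if "sum_list x \<noteq> sum_list s" for x
    using Sv_support[of ?g s x] that by (auto simp: deg_lists_def)
  obtain y where y: "length y = Suc (length s)" "Sv ?g s y \<noteq> 0"
    using ip_nonzero_obtain[OF ip_Sv[OF pg]] .
  have "dependent_on (Suc (length s)) (\<lambda>x. Re (v x)) (Sv ?g s)"
    by (rule prefix_eigen_unique[OF pg, where \<theta> = ?\<theta> and L = "sum_list s"]) (use ev es zv zs in auto)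
  from dependent_on_proportional[OF this y] obtain a where a: "\<And>x. length x = n \<Longrightarrow> Re (v x) = a * Sv ?g s x"
    using n by blast
  have "dependent_on (Suc (length s)) (\<lambda>x. Im (v x)) (Sv ?g s)"
    by (rule prefix_eigen_unique[OF pg, where \<theta> = ?\<theta> and L = "sum_list s"]) (use ev es zv zs in auto)
  from dependent_on_proportional[OF this y] obtain b where b: "\<And>x. length x = n \<Longrightarrow> Im (v x) = b * Sv ?g s x"
    using n by blast
  show ?thesis
    using unit_vector_phase[OF sp ov, where S = "Sv ?g s" and N = "sum_list s", OF _ _ a b]
      Sv_support[of ?g s] ip_Sv[OF pg, of s] n by simp
qed

lemma is_j_vector_unique:
  assumes g: "\<And>i. i \<in> {1..n} \<Longrightarrow> \<gamma> i > 1/2" and n: "n = Suc (length j)" "j \<noteq> []" and v: "is_j_vector \<gamma> n j v"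
  shows "\<exists>c. norm c = 1 \<and> v = (\<lambda>x. c * of_real (Jv (site_pars \<gamma> n) j x))"
proof -
  let ?g = "site_pars \<gamma> n"
  obtain m where m: "length j = Suc m" using n(2) by (cases j) auto
  have pg: "pos ?g" using g by (rule pos_site_pars)
  have sp: "v \<in> tensor_space n" and ov: "overlap v v = 1" using v by (auto simp: is_j_vector_def)
  have sp': "v \<in> tensor_space (Suc (Suc m))" using sp n m by simp
  let ?\<theta> = "\<lambda>k. gamma_eigenvalue \<gamma> 2 (Suc (Suc k)) (psum j k)"
  let ?\<eta> = "gamma_eigenvalue \<gamma> 1 n (psum j (n - 1))"
  have ev: "Gam (shift ?g) (Suc k) (\<lambda>y. Re (v (a # y))) r = ?\<theta> k * Re (v (a # r))"
    "Gam (shift ?g) (Suc k) (\<lambda>y. Im (v (a # y))) r = ?\<theta> k * Im (v (a # r))"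
    if "k \<in> {1..m}" "length r = Suc m" for k a r
  proof -
    have "Suc k \<in> {2..n - 1}" using that n m by auto
    then have "is_eigen (Gamma_op \<gamma> n 2 (Suc k + 1)) (gamma_eigenvalue \<gamma> 2 (Suc k + 1) (psum j (Suc k - 1))) v"
      using v by (simp only: is_j_vector_def)
    then show "Gam (shift ?g) (Suc k) (\<lambda>y. Re (v (a # y))) r = ?\<theta> k * Re (v (a # r))"
      "Gam (shift ?g) (Suc k) (\<lambda>y. Im (v (a # y))) r = ?\<theta> k * Im (v (a # r))"
      using is_eigen_suffix[OF sp', of "Suc k" \<gamma> "?\<theta> k"] that n m by auto
  qed
  have es: "Gam (shift ?g) (Suc k) (\<lambda>y. Jv ?g j (a # y)) r = ?\<theta> k * Jv ?g j (a # r)"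
    if "k \<in> {1..m}" "length r = Suc m" for k a r
  proof -
    have kk: "1 \<le> Suc k" "Suc (Suc k) \<le> n" using that n m by auto
    show ?thesis
      unfolding gamma_eigenvalue_shift_site_pars[OF kk] psum_def
      using that m by (intro Gam_shift_Jv[OF pg]) auto
  qed
  have ev': "Gam ?g (Suc (Suc m)) (\<lambda>y. Re (v y)) x = ?\<eta> * Re (v x)"
    "Gam ?g (Suc (Suc m)) (\<lambda>y. Im (v y)) x = ?\<eta> * Im (v x)" if "length x = Suc (Suc m)" for x
    using v that is_eigen_prefix[OF sp, of n \<gamma> ?\<eta>] n m by (auto simp: is_j_vector_def)
  have es': "Gam ?g (Suc (Suc m)) (Jv ?g j) x = ?\<eta> * Jv ?g j x" if "length x = Suc (Suc m)" for x
  proof -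
    have kk: "1 \<le> n" "n \<le> n" using n by auto
    show ?thesis
      unfolding gamma_eigenvalue_site_pars[OF kk]
      using Gam_Jv[OF pg n(2), of x] that n m by (simp add: psum_full del: sum.lessThan_Suc)
  qed
  have zv: "v x = 0" if "sum_list x \<noteq> sum_list j" for x
    using v that is_eigen_A0[OF sp, of \<gamma> "psum j (n - 1)"] n by (auto simp: is_j_vector_def psum_full)
  have zs: "Jv ?g j x = 0" if "sum_list x \<noteq> sum_list j" for x
    using Jv_support[of ?g j x] that by (auto simp: deg_lists_def)
  obtain y where y: "length y = Suc (Suc m)" "Jv ?g j y \<noteq> 0"
    using ip_nonzero_obtain[OF ip_Jv[OF pg, of j]] m by metis
  have "dependent_on (Suc (Suc m)) (\<lambda>x. Re (v x)) (Jv ?g j)"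
    by (rule suffix_eigen_unique[OF pg, where \<theta> = ?\<theta> and \<eta> = ?\<eta> and L = "sum_list j"])
      (use ev es ev' es' zv zs in auto)
  from dependent_on_proportional[OF this y] obtain a where a: "\<And>x. length x = n \<Longrightarrow> Re (v x) = a * Jv ?g j x"
    using n m by metis
  have "dependent_on (Suc (Suc m)) (\<lambda>x. Im (v x)) (Jv ?g j)"
    by (rule suffix_eigen_unique[OF pg, where \<theta> = ?\<theta> and \<eta> = ?\<eta> and L = "sum_list j"])
      (use ev es ev' es' zv zs in auto)
  from dependent_on_proportional[OF this y] obtain b where b: "\<And>x. length x = n \<Longrightarrow> Im (v x) = b * Jv ?g j x"
    using n m by metis
  show ?thesis
    using unit_vector_phase[OF sp ov, where S = "Jv ?g j" and N = "sum_list j", OF _ _ a b]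
      Jv_support[of ?g j] ip_Jv[OF pg, of j] n by simp
qed

section \<open>The tridiagonal action for three sites\<close>

text \<open>
  For three sites of parameters \<open>a\<close>, \<open>b\<close>, \<open>c\<close> and total degree \<open>M\<close>, this is \<open>X\<^sub>k\<close>, and the parameters
  of the Bannai--Ito polynomials are \<open>\<rho>\<^sub>1 = (a + b - 1) / 2\<close>, \<open>\<rho>\<^sub>2, r\<^sub>1 = X\<^sub>k \<plusminus> (2 c - 1) / 4\<close> and
  \<open>r\<^sub>2 = (a - b) / 2\<close>.
\<close>

definition par_x :: "real \<Rightarrow> real \<Rightarrow> real \<Rightarrow> nat \<Rightarrow> real" where
  "par_x a b c M = (-1) ^ M / 2 * (real M + a + b + c - 1/2)"

definition bi_A :: "real \<Rightarrow> real \<Rightarrow> real \<Rightarrow> nat \<Rightarrow> nat \<Rightarrow> real" where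
  "bi_A a b c M = BI_A ((a + b - 1) / 2) (par_x a b c M + (2 * c - 1) / 4) (par_x a b c M - (2 * c - 1) / 4) ((a - b) / 2)"

definition bi_C :: "real \<Rightarrow> real \<Rightarrow> real \<Rightarrow> nat \<Rightarrow> nat \<Rightarrow> real" where
  "bi_C a b c M = BI_C ((a + b - 1) / 2) (par_x a b c M + (2 * c - 1) / 4) (par_x a b c M - (2 * c - 1) / 4) ((a - b) / 2)"

definition bi_B :: "real \<Rightarrow> real \<Rightarrow> real \<Rightarrow> nat \<Rightarrow> nat \<Rightarrow> real \<Rightarrow> real" where
  "bi_B a b c M = BI_poly ((a + b - 1) / 2) (par_x a b c M + (2 * c - 1) / 4) (par_x a b c M - (2 * c - 1) / 4) ((a - b) / 2)"

lemma bi_A_cases: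
  "even M \<Longrightarrow> even m \<Longrightarrow> bi_A a b c M m = (real m - real M) * (real m + 2 * b) / (4 * (real m + b + c))" (is "_ \<Longrightarrow> _ \<Longrightarrow> ?A1")
  "even M \<Longrightarrow> odd m \<Longrightarrow> bi_A a b c M m =
     (real m + 2 * b + 2 * c - 1) * (real m + real M + 2 * a + 2 * b + 2 * c - 1) / (4 * (real m + b + c))" (is "_ \<Longrightarrow> _ \<Longrightarrow> ?A2")
  "odd M \<Longrightarrow> even m \<Longrightarrow> bi_A a b c M m =
     (real m + real M + 2 * a + 2 * b + 2 * c - 1) * (real m + 2 * b) / (4 * (real m + b + c))" (is "_ \<Longrightarrow> _ \<Longrightarrow> ?A3")
  "odd M \<Longrightarrow> odd m \<Longrightarrow> bi_A a b c M m =
     (real m + 2 * b + 2 * c - 1) * (real m - real M) / (4 * (real m + b + c))" (is "_ \<Longrightarrow> _ \<Longrightarrow> ?A4")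
proof -
  have par: "even k \<Longrightarrow> real (k mod 2) = 0" "odd k \<Longrightarrow> real (k mod 2) = 1"
    "even k \<Longrightarrow> (-1) ^ k = (1::real)" "odd k \<Longrightarrow> (-1) ^ k = (-1::real)" for k :: nat
    by (simp_all add: odd_iff_mod_2_eq_one)
  have cong: "N = N' \<Longrightarrow> D = D' \<Longrightarrow> N / D = N' / D'" for N N' D D' :: real by simp
  show ?A1 if "even M" "even m"
    unfolding bi_A_def BI_A_def par_x_def par(1)[OF that(2)] par(3)[OF that(1)]
    by (rule cong; simp add: field_simps)
  show ?A2 if "even M" "odd m"
    unfolding bi_A_def BI_A_def par_x_def par(2)[OF that(2)] par(3)[OF that(1)]
    by (rule cong; simp add: field_simps)
  show ?A3 if "odd M" "even m"
    unfolding bi_A_def BI_A_def par_x_def par(1)[OF that(2)] par(4)[OF that(1)]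
    by (rule cong; simp add: field_simps)
  show ?A4 if "odd M" "odd m"
    unfolding bi_A_def BI_A_def par_x_def par(2)[OF that(2)] par(4)[OF that(1)]
    by (rule cong; simp add: field_simps)
qed

lemma bi_C_cases:
  "even M \<Longrightarrow> even m \<Longrightarrow> bi_C a b c M m = real m * (real M + 2 * a - real m) / (4 * (real m + b + c - 1))" (is "_ \<Longrightarrow> _ \<Longrightarrow> ?A1")
  "even M \<Longrightarrow> odd m \<Longrightarrow> bi_C a b c M m =
     - ((real m + real M + 2 * b + 2 * c - 1) * (real m + 2 * c - 1) / (4 * (real m + b + c - 1)))" (is "_ \<Longrightarrow> _ \<Longrightarrow> ?A2")
  "odd M \<Longrightarrow> even m \<Longrightarrow> bi_C a b c M m =
     - (real m * (real m + real M + 2 * b + 2 * c - 1) / (4 * (real m + b + c - 1)))" (is "_ \<Longrightarrow> _ \<Longrightarrow> ?A3")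
  "odd M \<Longrightarrow> odd m \<Longrightarrow> bi_C a b c M m =
     (real M + 2 * a - real m) * (real m + 2 * c - 1) / (4 * (real m + b + c - 1))" (is "_ \<Longrightarrow> _ \<Longrightarrow> ?A4")
proof -
  have par: "even k \<Longrightarrow> real (k mod 2) = 0" "odd k \<Longrightarrow> real (k mod 2) = 1"
    "even k \<Longrightarrow> (-1) ^ k = (1::real)" "odd k \<Longrightarrow> (-1) ^ k = (-1::real)" for k :: nat
    by (simp_all add: odd_iff_mod_2_eq_one)
  have cong: "N = N' \<Longrightarrow> D = D' \<Longrightarrow> N / D = N' / D'" for N N' D D' :: real by simp
  have cong': "N = - N' \<Longrightarrow> D = D' \<Longrightarrow> - (N / D) = N' / D'" for N N' D D' :: real by simp
  have cong'': "N = N' \<Longrightarrow> D = D' \<Longrightarrow> - (N / D) = - (N' / D')" for N N' D D' :: real by simp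
  show ?A1 if "even M" "even m"
    unfolding bi_C_def BI_C_def par_x_def par(1)[OF that(2)] par(3)[OF that(1)]
    by (rule cong'; simp add: field_simps)
  show ?A2 if "even M" "odd m"
    unfolding bi_C_def BI_C_def par_x_def par(2)[OF that(2)] par(3)[OF that(1)]
    by (rule cong''; simp add: field_simps)
  show ?A3 if "odd M" "even m"
    unfolding bi_C_def BI_C_def par_x_def par(1)[OF that(2)] par(4)[OF that(1)]
    by (rule cong''; simp add: field_simps)
  show ?A4 if "odd M" "odd m"
    unfolding bi_C_def BI_C_def par_x_def par(2)[OF that(2)] par(4)[OF that(1)]
    by (rule cong'; simp add: field_simps)
qed

lemma sigma_even: "even m \<Longrightarrow> sigma g m = real m"
  and sigma_odd: "odd m \<Longrightarrow> sigma g m = real m + 2 * g - 1"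
  by (simp_all add: sigma_def algebra_simps)

text \<open>
  Below, \<open>Yseq\<close> is the eigenvector of \<open>\<Gamma>\<^bsub>23\<^esub>\<close> and \<open>Useq\<close> the action of \<open>\<Gamma>\<^bsub>12\<^esub>\<close>, both on slices.  The
  divisor in the recurrence for \<open>Yseq\<close> is \<open>bD\<close>, up to sign an eigenvalue difference; \<open>bR\<close> and \<open>bK\<close>
  express the entries of \<open>Yseq\<close> at \<open>m - 1\<close> and \<open>m + 1\<close> as multiples of those at \<open>m\<close>, and \<open>bc\<close> is the
  coefficient of \<open>Yseq\<close> at \<open>m + 1\<close> in the image of \<open>Yseq\<close> at \<open>m\<close> under \<open>Useq\<close>.
\<close>

definition bD :: "real \<Rightarrow> nat \<Rightarrow> nat \<Rightarrow> real" where
  "bD h m i = (if even i then real i else - (2 * real m + real i + 2 * h - 1))"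

definition bR :: "real \<Rightarrow> nat \<Rightarrow> nat \<Rightarrow> real" where
  "bR h m r = (if even r then - (1 / (2 * (real m + h - 1)))
     else (2 * real m + real r + 2 * h - 1) / (2 * (real m + h - 1) * (real r + 1)))"

definition bc :: "real \<Rightarrow> real \<Rightarrow> real \<Rightarrow> nat \<Rightarrow> nat \<Rightarrow> real" where
  "bc a b c M m = (-1) ^ M * (if even m then real m + 2 * b else real m + 2 * b + 2 * c - 1) *
     (if even (M + m) then real m + real M + 2 * b + 2 * c else real m + real M + 2 * a + 2 * b + 2 * c - 1) *
     (if even m then real m + 2 * c else real m + 1) / (4 * (real m + b + c)\<^sup>2)"

definition bK :: "real \<Rightarrow> real \<Rightarrow> nat \<Rightarrow> nat \<Rightarrow> real" where
  "bK h c m r = (-1) ^ (m + r + 1) / sigma c (Suc m) *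
     (if odd r then - 2 * (real m + h) else 2 * (real m + h) * real r / (2 * real m + real r + 2 * h))"

definition theta :: "real \<Rightarrow> nat \<Rightarrow> real" where
  "theta h k = (-1) ^ k * (real k + h - 1/2)"

definition bF :: "real \<Rightarrow> real \<Rightarrow> nat \<Rightarrow> real" where
  "bF b c m = (if even m then real m + 2 * b else real m + 2 * b + 2 * c - 1)"

definition bG :: "real \<Rightarrow> real \<Rightarrow> nat \<Rightarrow> nat \<Rightarrow> real" where
  "bG a h M m = (if even (M + m) then real m + real M + 2 * h else real m + real M + 2 * a + 2 * h - 1)"

section \<open>Rational identities for the recurrence coefficients\<close>

lemma of_nat_add_pos_nonzero:
  "0 < b \<Longrightarrow> 0 < c \<Longrightarrow> real m + b + c \<noteq> 0"
  by (simp add: add_nonneg_pos add_pos_pos less_imp_neq[THEN not_sym] add.assoc)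

lemma bi_A_eq: "bi_A a b c M m =
    bF b c m * (if even (M + m) then real m - real M else bG a (b + c) M m) / (4 * (real m + b + c))"
  by (cases "even M"; cases "even m") (simp_all add: bi_A_cases bF_def bG_def algebra_simps)

lemma bc_bK:
  assumes "0 < b" "0 < c"
  shows "bc a b c M m * bK (b + c) c m r = (-1) ^ (M + m + r + 1) * bF b c m * bG a (b + c) M m *
    (if odd r then - 1 / (2 * (real m + b + c)) else real r / (2 * (real m + b + c) * (2 * real m + real r + 2 * (b + c))))"
proof -
  have "sigma c (Suc m) = (if even m then real m + 2 * c else real m + 1)"
    by (simp add: sigma_even sigma_odd)
  moreover have "sigma c (Suc m) \<noteq> 0" using sigma_pos[OF assms(2), of m] by simp
  ultimately have eq: "bc a b c M m * bK (b + c) c m r = (-1) ^ (M + m + r + 1) * bF b c m * bG a (b + c) M m *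
    ((if odd r then - 2 * (real m + (b + c)) else 2 * (real m + (b + c)) * real r / (2 * real m + real r + 2 * (b + c)))
      / (4 * (real m + b + c)\<^sup>2))"
    unfolding bc_def bK_def bF_def bG_def
    by (simp add: power_add algebra_simps)
  let ?d = "real m + b + c"
  have "?d \<noteq> 0" using assms by (rule of_nat_add_pos_nonzero)
  then have "(if odd r then - 2 * (real m + (b + c)) else 2 * (real m + (b + c)) * real r / (2 * real m + real r + 2 * (b + c)))
      / (4 * ?d\<^sup>2) = (if odd r then - 1 / (2 * ?d) else real r / (2 * ?d * (2 * real m + real r + 2 * (b + c))))"
  proof -
    have md: "real m + (b + c) = ?d" by simp
    have "d \<noteq> 0 \<Longrightarrow> - 2 * d / (4 * d\<^sup>2) = - 1 / (2 * d)"
      "d \<noteq> 0 \<Longrightarrow> 2 * d * x / y / (4 * d\<^sup>2) = x / (2 * d * y)" for d x y :: real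
      by (simp_all add: power2_eq_square)
    from this[OF \<open>?d \<noteq> 0\<close>] show ?thesis unfolding md by (simp only: if_distrib if_split) simp
  qed
  then show ?thesis unfolding eq by simp
qed

text \<open>The contribution of the eigenvector m + 1 and that of A_m are taken together because the
  denominator m + b + c cancels in their sum. The parities of r and q decide which numerator
  remains.\<close>

lemma bK_bi_A:
  assumes pos: "0 < b" "0 < c" and M: "M = m + r + q"
  shows "bc a b c M m * bK (b + c) c m r - 2 * bi_A a b c M m =
    (if odd r then (if odd q then - bF b c m else 0)
     else bF b c m * (if even q then real q else - bG a (b + c) M m) / (2 * real m + real r + 2 * (b + c)))"
proof -
  let ?d = "real m + b + c" and ?e = "2 * real m + real r + 2 * (b + c)"
  have d: "?d \<noteq> 0" using pos by (rule of_nat_add_pos_nonzero)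
  have e: "?e \<noteq> 0" using pos by (smt (verit) of_nat_0_le_iff)
  have rM: "real M = real m + real r + real q" using M by simp
  consider "odd r" "odd q" | "odd r" "even q" | "even r" "even q" | "even r" "odd q" by blast
  then show ?thesis
  proof cases
    case 1
    then have par: "even (M + m)" "even (M + m + r + 1)" using M by auto
    have "bF b c m * bG a (b + c) M m * (- 1 / (2 * ?d)) - 2 * (bF b c m * (real m - real M) / (4 * ?d))
      = - bF b c m * ((bG a (b + c) M m + (real m - real M)) / (2 * ?d))"
    proof -
      have "F * G * (- 1 / (2 * d)) - 2 * (F * x / (4 * d)) = - F * ((G + x) / (2 * d))" if "d \<noteq> 0" for F G x d :: real
        using that by (simp add: field_simps)
      then show ?thesis using d by blast
    qed
    also have "(bG a (b + c) M m + (real m - real M)) / (2 * ?d) = 1"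
      using par d by (simp add: bG_def field_simps)
    finally show ?thesis unfolding bc_bK[OF pos] bi_A_eq using 1 par by simp
  next
    case 2
    then have par: "odd (M + m)" "odd (M + m + r + 1)" using M by auto
    have "X / (2 * x) - 2 * (X / (4 * x)) = 0" for X x :: real by simp
    then have "bF b c m * bG a (b + c) M m * (1 / (2 * ?d)) - 2 * (bF b c m * bG a (b + c) M m / (4 * ?d)) = 0"
      by (simp only: times_divide_eq_right mult_1_right)
    then show ?thesis unfolding bc_bK[OF pos] bi_A_eq using 2 par
      by (simp only: if_True if_False simp_thms) simp
  next
    case 3
    then have par: "even (M + m)" "odd (M + m + r + 1)" using M by auto
    have "- (bF b c m * bG a (b + c) M m) * (real r / (2 * ?d * ?e)) - 2 * (bF b c m * (real m - real M) / (4 * ?d))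
      = - bF b c m * (bG a (b + c) M m * real r + (real m - real M) * ?e) / (2 * ?d * ?e)"
      using d e by (simp add: divide_simps) (simp add: algebra_simps)
    also have "bG a (b + c) M m * real r + (real m - real M) * ?e = - (2 * ?d * real q)"
      using par by (simp add: bG_def rM algebra_simps)
    also have "- bF b c m * - (2 * ?d * real q) / (2 * ?d * ?e) = bF b c m * real q / ?e"
      using d by simp
    finally show ?thesis unfolding bc_bK[OF pos] bi_A_eq using 3 par by simp
  next
    case 4
    then have par: "odd (M + m)" "even (M + m + r + 1)" using M by auto
    have "bF b c m * bG a (b + c) M m * (real r / (2 * ?d * ?e)) - 2 * (bF b c m * bG a (b + c) M m / (4 * ?d))
      = bF b c m * bG a (b + c) M m * (real r - ?e) / (2 * ?d * ?e)"
      using d e by (simp add: divide_simps) (simp add: algebra_simps)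
    also have "real r - ?e = - (2 * ?d)" by simp
    also have "bF b c m * bG a (b + c) M m * - (2 * ?d) / (2 * ?d * ?e) = bF b c m * - bG a (b + c) M m / ?e"
    proof -
      have "x * - (2 * d) / (2 * d * y) = x * - 1 / y" if "d \<noteq> 0" for x y d :: real
        using that by simp
      from this[OF d] show ?thesis by (simp only: mult_minus_right mult_1_right)
    qed
    finally show ?thesis unfolding bc_bK[OF pos] bi_A_eq using 4 par by simp
  qed
qed

lemma bi_C_eq: "bi_C a b c M m = (-1) ^ (M + m) * (sigma c m *
    (if even (M + m) then real M + 2 * a - real m else real m + real M + 2 * b + 2 * c - 1) / (4 * (real m + b + c - 1)))"
  by (cases "even M"; cases "even m") (simp_all add: bi_C_cases sigma_even sigma_odd mult.commute)

text \<open>The same cancellation for the eigenvector m - 1 and C_m: the denominator m + b + c - 1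
  disappears.\<close>

lemma bR_bi_C:
  assumes pos: "0 < b" "0 < c" and M: "M = m + r + q"
  shows "(-1) ^ M * sigma a (r + q + 1) * (sigma c m * (-1) ^ (m + r + 1) * bR (b + c) m r) - 2 * bi_C a b c M m
    = sigma c m * (if even r then (if even q then 0 else 1)
        else (if odd q then sigma a (r + q + 1) else - real q) / (real r + 1))"
\<comment> \<open>At m = 0 the denominator m + b + c - 1 may vanish, but all terms have the factor
  \<open>sigma c 0 = 0\<close>.\<close>
proof (cases "m = 0")
  case True
  then show ?thesis by (simp add: bi_C_eq)
next
  case False
  define K where "K = sigma c m"
  define S where "S = sigma a (r + q + 1)"
  define D where "D = real m + (b + c) - 1"
  define T where "T = (if even (r + q) then real M + 2 * a - real m else real m + real M + 2 * b + 2 * c - 1)"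
  define e where "e = real r + 1"
  have D0: "D \<noteq> 0" unfolding D_def using False pos by (cases m) simp_all
  have e0: "e \<noteq> 0" unfolding e_def by simp
  have rM: "real M = real m + real r + real q" using M by simp
  have par: "even (M + m) = even (r + q)" unfolding M by auto
  have C: "bi_C a b c M m = (-1) ^ (M + m) * (K * T / (4 * D))"
    unfolding bi_C_eq par K_def T_def D_def by (simp add: add.assoc)
  have S1: "S = real M + 2 * a - real m" if "even (r + q)" using that M by (simp add: S_def sigma_odd)
  have S2: "S = real r + real q + 1" if "odd (r + q)" using that M by (simp add: S_def sigma_even)
  consider "even r" "even q" | "even r" "odd q" | "odd r" "odd q" | "odd r" "even q" by blast
  then have "(-1) ^ (M + m + r + 1) * S * K * bR (b + c) m r - 2 * bi_C a b c M m
    = K * (if even r then (if even q then 0 else 1) else (if odd q then S else - real q) / e)"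
  proof cases
    case 1
    then have sg: "even (M + m)" "odd (M + m + r + 1)" using M by auto
    have R: "bR (b + c) m r = - (1 / (2 * D))" using 1 by (simp add: bR_def D_def)
    have "S = T" using 1 S1 by (simp add: T_def)
    then show ?thesis unfolding C R using sg 1 by simp
  next
    case 2
    then have sg: "odd (M + m)" "even (M + m + r + 1)" using M by auto
    have R: "bR (b + c) m r = - (1 / (2 * D))" using 2 by (simp add: bR_def D_def)
    have T: "T = S + 2 * D" using 2 S2 by (simp add: T_def D_def rM)
    have "S * K * - (1 / (2 * D)) + 2 * (K * (S + 2 * D) / (4 * D)) = K"
      using D0 by (simp add: field_simps)
    then show ?thesis unfolding C R T using sg 2 by simp
  next
    case 3
    then have sg: "even (M + m)" "even (M + m + r + 1)" using M by auto
    have R: "bR (b + c) m r = (e + 2 * D) / (2 * D * e)" using 3 by (simp add: bR_def D_def e_def)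
    have T: "T = S" using 3 S1 by (simp add: T_def)
    have "S * K * ((e + 2 * D) / (2 * D * e)) - 2 * (K * S / (4 * D)) = K * (S / e)"
      using D0 e0 by (simp add: field_simps)
    then show ?thesis unfolding C R T using sg 3 by simp
  next
    case 4
    then have sg: "odd (M + m)" "odd (M + m + r + 1)" using M by auto
    have R: "bR (b + c) m r = (e + 2 * D) / (2 * D * e)" using 4 by (simp add: bR_def D_def e_def)
    have T: "T = real q + e + 2 * D" using 4 by (simp add: T_def D_def e_def rM)
    have S: "S = e + real q" using 4 S2 by (simp add: e_def)
    have s: "(-1) ^ (M + m + r + 1) = (-1 :: real)" "(-1) ^ (M + m) = (-1 :: real)"
      using sg by simp_all
    show ?thesis unfolding C R T S s using D0 e0 4 by (simp add: field_simps)
  qed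
  moreover have "(-1) ^ M * S * (K * (-1) ^ (m + r + 1) * bR (b + c) m r) = (-1) ^ (M + m + r + 1) * S * K * bR (b + c) m r"
    by (simp add: power_add mult_ac)
  ultimately show ?thesis unfolding S_def K_def e_def by (simp only:)
qed

text \<open>This is the action of \<open>Useq\<close> on the m-th eigenvector, read at entry i = m +
  r with q = M - i and divided by that entry of the eigenvector. The neighbours m - 1 and m + 1
  enter through their ratios to it, which leaves an identity of rational functions.\<close>

lemma tri_coeff:
  assumes pos: "0 < b" "0 < c" and M: "M = m + r + q"
  shows "theta (a + b) q + (-1) ^ (M + m) * sigma a q * sigma c (m + r + 1) / bD (b + c) m (r + 1)
    = (-1) ^ M * sigma a (r + q + 1) * (sigma c m * (-1) ^ (m + r + 1) * bR (b + c) m r)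
      + (theta (a + b) 0 - 2 * bi_A a b c M m - 2 * bi_C a b c M m) + bc a b c M m * bK (b + c) c m r"
proof -
  define e where "e = 2 * real m + real r + 2 * (b + c)"
  define f where "f = real r + 1"
  have e0: "e \<noteq> 0" unfolding e_def using pos by (smt (verit) of_nat_0_le_iff)
  have f0: "f \<noteq> 0" unfolding f_def by simp
  have rM: "real M = real m + real r + real q" using M by simp
  have par: "even (M + m) = even (r + q)" unfolding M by auto
  have th: "theta (a + b) 0 = a + b - 1/2"
    "even q \<Longrightarrow> theta (a + b) q = real q + a + b - 1/2"
    "odd q \<Longrightarrow> theta (a + b) q = - (real q + a + b - 1/2)"
    by (simp_all add: theta_def)
  have D: "bD (b + c) m (r + 1) = (if odd r then f else - e)"
    by (simp add: bD_def e_def f_def)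
  let ?s = "(-1) ^ (M + m) :: real"
  let ?tc = "sigma c m * (if even r then (if even q then 0 else 1)
        else (if odd q then sigma a (r + q + 1) else - real q) / f)"
  let ?ka = "if odd r then (if odd q then - bF b c m else 0)
     else bF b c m * (if even q then real q else - bG a (b + c) M m) / e"
  have "theta (a + b) q + ?s * sigma a q * sigma c (m + r + 1) / (if odd r then f else - e)
    = theta (a + b) 0 + ?tc + ?ka"
  proof -
    consider "even r" "even q" | "even r" "odd q" | "odd r" "odd q" | "odd r" "even q" by blast
    then show ?thesis
    proof cases
      case 1
      then have s: "?s = 1" using par by simp
      have S: "sigma c (m + r + 1) = e - bF b c m"
        using 1 by (simp add: sigma_even sigma_odd bF_def e_def)
      have "real q - real q * sigma c (m + r + 1) / e = bF b c m * real q / e"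
        unfolding S using e0 by (simp add: field_simps)
      then show ?thesis using 1 s by (simp add: th sigma_even)
    next
      case 2
      then have s: "?s = -1" using par by simp
      have "e = sigma c (m + r + 1) + bF b c m"
        using 2 by (simp add: sigma_even sigma_odd bF_def e_def)
      moreover have G: "bG a (b + c) M m = e + sigma a q"
        using 2 par by (simp add: bG_def e_def rM sigma_odd)
      ultimately have "sigma a q * sigma c (m + r + 1) / e = sigma a q - bF b c m * sigma a q / e"
        using e0 by (simp add: field_simps)
      moreover have "bF b c m * - bG a (b + c) M m / e = - bF b c m - bF b c m * sigma a q / e"
        unfolding G using e0 by (simp add: field_simps)
      moreover have "sigma c m - bF b c m = real m - (real m + 2 * b)"
        by (simp add: sigma_even sigma_odd bF_def)
      moreover have "?s * sigma a q * sigma c (m + r + 1) / (if odd r then f else - e)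
          = sigma a q * sigma c (m + r + 1) / e" "?tc = sigma c m" "?ka = bF b c m * - bG a (b + c) M m / e"
        using 2 s by simp_all
      moreover have "sigma a q = real q + 2 * a - 1" using 2 by (simp add: sigma_odd)
      ultimately show ?thesis unfolding th(1) th(3)[OF 2(2)] by linarith
    next
      case 3
      then have s: "?s = 1" using par by simp
      have S: "sigma a (r + q + 1) = f + sigma a q" using 3 by (simp add: sigma_odd f_def)
      have C: "sigma c (m + r + 1) = sigma c m + f"
        using 3 by (cases "even m") (simp_all add: sigma_even sigma_odd f_def)
      have "sigma a q * (sigma c m + f) / f = sigma c m * ((f + sigma a q) / f) + (sigma a q - sigma c m)"
        using f0 by (simp add: field_simps)
      moreover have "sigma c m - bF b c m = real m - (real m + 2 * b)"
        by (simp add: sigma_even sigma_odd bF_def)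
      moreover have "?s * sigma a q * sigma c (m + r + 1) / (if odd r then f else - e)
          = sigma a q * (sigma c m + f) / f" "?tc = sigma c m * ((f + sigma a q) / f)" "?ka = - bF b c m"
        using 3 s unfolding C S by simp_all
      moreover have "sigma a q = real q + 2 * a - 1" using 3 by (simp add: sigma_odd)
      ultimately show ?thesis unfolding th(1) th(3)[OF 3(2)] by linarith
    next
      case 4
      then have s: "?s = -1" using par by simp
      have C: "sigma c (m + r + 1) = sigma c m + f"
        using 4 by (cases "even m") (simp_all add: sigma_even sigma_odd f_def)
      have "real q - real q * (sigma c m + f) / f = sigma c m * (- real q / f)"
        using f0 by (simp add: field_simps)
      moreover have "?s * sigma a q * sigma c (m + r + 1) / (if odd r then f else - e)
          = - (real q * (sigma c m + f) / f)" "?tc = sigma c m * (- real q / f)" "?ka = 0"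
        using 4 s unfolding C by (simp_all add: sigma_even)
      ultimately show ?thesis unfolding th(1) th(2)[OF 4(2)] by linarith
    qed
  qed
  then show ?thesis
    using bR_bi_C[OF pos M, of a] bK_bi_A[OF pos M, of a] unfolding D
    by (simp only: e_def[symmetric] f_def[symmetric])
qed

section \<open>Explicit eigenvectors and the tridiagonal action\<close>

primrec bY :: "real \<Rightarrow> real \<Rightarrow> nat \<Rightarrow> nat \<Rightarrow> real" where
  "bY b c m 0 = 1"
| "bY b c m (Suc r) = (-1) ^ m * sigma c (m + Suc r) / bD (b + c) m (Suc r) * bY b c m r"

definition Yseq :: "real \<Rightarrow> real \<Rightarrow> nat \<Rightarrow> nat \<Rightarrow> real" where
  "Yseq b c m i = (if i < m then 0 else bY b c m (i - m))"

definition Useq :: "real \<Rightarrow> real \<Rightarrow> nat \<Rightarrow> (nat \<Rightarrow> real) \<Rightarrow> nat \<Rightarrow> real" where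
  "Useq a b M y i = theta (a + b) (M - i) * y i + (-1) ^ M * sigma a (M - i) * y (Suc i)"

text \<open>The coefficient of the eigenvector m - 1 in the image of the m-th one. It is read off at
  entry m - 1, where the m-th eigenvector vanishes and only its entry m contributes.\<close>

definition btau :: "real \<Rightarrow> nat \<Rightarrow> nat \<Rightarrow> real" where
  "btau a M m = (-1) ^ M * sigma a (M + 1 - m)"

lemma bD_nonzero: "0 < h \<Longrightarrow> 0 < i \<Longrightarrow> bD h m i \<noteq> 0"
proof -
  assume h: "0 < h" "0 < i"
  then have "1 \<le> real i" by simp
  then have "0 < 2 * real m + real i + 2 * h - 1" using h by (smt (verit) of_nat_0_le_iff)
  then show ?thesis using h by (simp add: bD_def)
qed

text \<open>Eigenvectors for neighbouring eigenvalues are multiples of each other entry by entry,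
  with a factor depending on r. In the induction step only the divisors \<open>bD\<close> differ,
  and \<open>bR\<close> compensates their quotient, which is the fact \<open>R\<close>.\<close>

lemma bY_lower:
  assumes pos: "0 < b" "0 < c"
  shows "bY b c m (Suc r) = sigma c (Suc m) * (-1) ^ (m + r) * bR (b + c) (Suc m) r * bY b c (Suc m) r"
proof (induction r)
  case 0
  have "2 * real m + 2 * (b + c) \<noteq> 0" using pos by (smt (verit) of_nat_0_le_iff)
  then show ?case by (simp add: bD_def bR_def add.assoc divide_simps) (simp add: algebra_simps)
next
  case (Suc r)
  let ?h = "b + c"
  have nz: "bD ?h m (Suc (Suc r)) \<noteq> 0" "bD ?h (Suc m) (Suc r) \<noteq> 0"
    using pos by (intro bD_nonzero; simp)+
  have d: "real m + ?h \<noteq> 0" using pos by (smt (verit) of_nat_0_le_iff)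
  have R: "bR ?h (Suc m) (Suc r) / bD ?h (Suc m) (Suc r) = bR ?h (Suc m) r / bD ?h m (Suc (Suc r))"
  proof (cases "even r")
    case True
    define P where "P = 2 * real m + real r + 2 * ?h + 2"
    define Q where "Q = 2 * (real m + ?h)"
    have "P \<noteq> 0" unfolding P_def using pos by (smt (verit) of_nat_0_le_iff)
    moreover have "bD ?h (Suc m) (Suc r) = - P" using True by (simp add: bD_def P_def)
    moreover have "bR ?h (Suc m) (Suc r) = P / (Q * (real r + 2))"
      using True by (simp add: bR_def P_def Q_def add_ac)
    moreover have "bD ?h m (Suc (Suc r)) = real r + 2" using True by (simp add: bD_def)
    moreover have "bR ?h (Suc m) r = - (1 / Q)" using True by (simp add: bR_def Q_def)
    ultimately show ?thesis by simp
  next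
    case False
    define P where "P = 2 * real m + real r + 2 * ?h + 1"
    define Q where "Q = 2 * (real m + ?h)"
    have "P \<noteq> 0" unfolding P_def using pos by (smt (verit) of_nat_0_le_iff)
    moreover have "bD ?h (Suc m) (Suc r) = real r + 1" using False by (simp add: bD_def)
    moreover have "bR ?h (Suc m) (Suc r) = - (1 / Q)" using False by (simp add: bR_def Q_def)
    moreover have "bD ?h m (Suc (Suc r)) = - P" using False by (simp add: bD_def P_def)
    moreover have "bR ?h (Suc m) r = P / (Q * (real r + 1))"
      using False by (simp add: bR_def P_def Q_def add_ac)
    ultimately show ?thesis by simp
  qed
  have "bY b c m (Suc (Suc r)) = (-1) ^ m * sigma c (Suc m + Suc r) / bD ?h m (Suc (Suc r))
     * (sigma c (Suc m) * (-1) ^ (m + r) * bR ?h (Suc m) r * bY b c (Suc m) r)"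
    unfolding bY.simps(2)[of b c m "Suc r"] Suc by simp
  also have "\<dots> = sigma c (Suc m) * (-1) ^ (m + Suc r) * (bR ?h (Suc m) r / bD ?h m (Suc (Suc r)))
     * ((-1) ^ Suc m * sigma c (Suc m + Suc r) * bY b c (Suc m) r)"
    by (simp add: power_add mult_ac)
  also have "\<dots> = sigma c (Suc m) * (-1) ^ (m + Suc r) * bR ?h (Suc m) (Suc r)
     * ((-1) ^ Suc m * sigma c (Suc m + Suc r) / bD ?h (Suc m) (Suc r) * bY b c (Suc m) r)"
    unfolding R[symmetric] by simp
  finally show ?case by (simp only: bY.simps(2)[of b c "Suc m" r])
qed

lemma bR_nonzero:
  assumes "0 < h"
  shows "bR h (Suc m) r \<noteq> 0"
proof -
  have "real m + h \<noteq> 0" "2 * real m + real r + 2 * h + 1 \<noteq> 0"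
    using assms by (smt (verit) of_nat_0_le_iff)+
  moreover have "real (Suc m) + h - 1 = real m + h" "2 * real (Suc m) + real r + 2 * h - 1 = 2 * real m + real r + 2 * h + 1"
    by simp_all
  ultimately show ?thesis unfolding bR_def by (simp del: of_nat_Suc)
qed

lemma bK_bR:
  assumes "0 < h" "0 < c"
  shows "sigma c (Suc m) * (-1) ^ (m + r) * bR h (Suc m) r * bK h c m (Suc r) = 1"
proof -
  have "sigma c (Suc m) \<noteq> 0" using sigma_pos[OF assms(2), of m] by simp
  moreover have "real m + h \<noteq> 0" "2 * real m + real r + 2 * h + 1 \<noteq> 0"
    using assms by (smt (verit) of_nat_0_le_iff)+
  moreover have "(-1) ^ (m + r) * ((-1) ^ (m + r) * x) = x" for x :: real
    by (simp flip: mult.assoc power_add)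
  ultimately show ?thesis
    by (simp add: bR_def bK_def divide_simps power_add) (simp add: algebra_simps)?
qed

lemma bY_upper:
  assumes pos: "0 < b" "0 < c"
  shows "bY b c (Suc m) r = bK (b + c) c m (Suc r) * bY b c m (Suc r)"
proof -
  have "bK (b + c) c m (Suc r) * bY b c m (Suc r)
    = (sigma c (Suc m) * (-1) ^ (m + r) * bR (b + c) (Suc m) r * bK (b + c) c m (Suc r)) * bY b c (Suc m) r"
    unfolding bY_lower[OF pos] by (simp add: mult_ac)
  then show ?thesis using bK_bR[of "b + c" c m r] pos by simp
qed

text \<open>This matches the entry 0 of the eigenvector m + 1 at position m, so that
  \<open>tri_coeff\<close> covers the diagonal entry as well.\<close>

lemma bK_0: "bK h c m 0 = 0"
  by (simp add: bK_def)

text \<open>Left of m - 1 everything vanishes, at m - 1 only \<open>btau\<close> survives, and from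
  m on all three vectors are expressed through the m-th one, where \<open>tri_coeff\<close>
  applies.\<close>

lemma Useq_Yseq:
  assumes pos: "0 < b" "0 < c" and "i \<le> M" "m \<le> M"
  shows "Useq a b M (Yseq b c m) i = (if m = 0 then 0 else btau a M m * Yseq b c (m - 1) i)
    + (theta (a + b) 0 - 2 * bi_A a b c M m - 2 * bi_C a b c M m) * Yseq b c m i + bc a b c M m * Yseq b c (Suc m) i"
proof -
  consider "Suc i < m" | "Suc i = m" | "m \<le> i" by linarith
  then show ?thesis
  proof cases
    case 1
    then show ?thesis by (auto simp: Useq_def Yseq_def)
  next
    case 2
    then have "M - i = M + 1 - m" using assms by simp
    then show ?thesis using 2 by (auto simp: Useq_def Yseq_def btau_def)
  next
    case 3
    define r where "r = i - m"
    define q where "q = M - i"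
    have i: "i = m + r" and M: "M = m + r + q" using 3 assms by (auto simp: r_def q_def)
    let ?y = "bY b c m r"
    have u: "Yseq b c m i = ?y" "Yseq b c m (Suc i) = bY b c m (Suc r)" "M - i = q"
      using i M by (auto simp: Yseq_def Suc_diff_le)
    have up: "Yseq b c (Suc m) i = bK (b + c) c m r * ?y"
    proof (cases r)
      case 0
      then show ?thesis using i by (simp add: Yseq_def bK_0)
    next
      case (Suc r')
      then show ?thesis using i bY_upper[OF pos, of m r'] by (simp add: Yseq_def)
    qed
    have low: "(if m = 0 then 0 else btau a M m * Yseq b c (m - 1) i)
      = (-1) ^ M * sigma a (r + q + 1) * (sigma c m * (-1) ^ (m + r + 1) * bR (b + c) m r) * ?y"
    proof (cases m)
      case (Suc m')
      then have "M + 1 - m = r + q + 1" "i - m' = Suc r" using i M by auto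
      then show ?thesis using Suc i M bY_lower[OF pos, of m' r]
        by (simp add: Yseq_def btau_def mult_ac power_add)
    qed simp
    have "Useq a b M (Yseq b c m) i = (theta (a + b) q
        + (-1) ^ (M + m) * sigma a q * sigma c (m + r + 1) / bD (b + c) m (r + 1)) * ?y"
      unfolding Useq_def u by (simp add: power_add algebra_simps)
    then show ?thesis unfolding tri_coeff[OF pos M] low up u(1) by (simp add: algebra_simps)
  qed
qed

text \<open>The factor 4 comes from \<theta> = 2 x + 1/2: up to a constant, the operator with
  eigenvalues \<theta> is twice that with eigenvalues x, so products of opposite off-diagonal
  entries differ by 4.\<close>

lemma bi_A_bi_C:
  assumes "0 < b" "0 < c" "m < M"
  shows "4 * (bi_A a b c M m * bi_C a b c M (Suc m)) = btau a M (Suc m) * bc a b c M m"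
proof -
  define d where "d = real m + b + c"
  have d0: "d \<noteq> 0" unfolding d_def using assms by (intro of_nat_add_pos_nonzero)
  have s: "sigma a (M - m) = (if even (M + m) then real M - real m else real M - real m + 2 * a - 1)"
    using assms(3) by (simp add: sigma_even sigma_odd of_nat_diff)
  have sc: "sigma c (Suc m) = (if even m then real m + 2 * c else real m + 1)"
    by (simp add: sigma_even sigma_odd)
  define G where "G = bG a (b + c) M m"
  define F where "F = bF b c m"
  define K where "K = sigma c (Suc m)"
  have A: "bi_A a b c M m = F * (if even (M + m) then real m - real M else G) / (4 * d)"
    unfolding bi_A_eq F_def G_def d_def ..
  have C: "bi_C a b c M (Suc m) = (-1) ^ (M + Suc m) * (K * (if even (M + m) then G else real M - real m + 2 * a - 1) / (4 * d))"
    unfolding bi_C_eq K_def G_def bG_def d_def by (simp add: add_ac)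
  have c: "bc a b c M m = (-1) ^ M * (F * G * K / (4 * d\<^sup>2))"
    unfolding bc_def F_def bF_def G_def bG_def K_def sc d_def by (simp add: algebra_simps)
  have t: "btau a M (Suc m) = (-1) ^ M * (if even (M + m) then real M - real m else real M - real m + 2 * a - 1)"
    unfolding btau_def using assms(3) s by simp
  have sg: "(-1) ^ M * x * ((-1) ^ M * y) = x * y" for x y :: real
    by (cases "even M") simp_all
  show ?thesis
  proof (cases "even (M + m)")
    case True
    then have "(-1) ^ (M + Suc m) = (-1 :: real)" by simp
    moreover have "4 * (F * (real m - real M) / (4 * d) * (-1 * (K * G / (4 * d)))) = (real M - real m) * (F * G * K / (4 * d\<^sup>2))"
      using d0 by (simp add: field_simps power2_eq_square)
    ultimately show ?thesis
      unfolding A C c t sg using True by (simp only: if_True)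
  next
    case False
    then have "(-1) ^ (M + Suc m) = (1 :: real)" by simp
    moreover have "4 * (F * G / (4 * d) * (1 * (K * y / (4 * d)))) = y * (F * G * K / (4 * d\<^sup>2))" for y
      using d0 by (simp add: field_simps power2_eq_square)
    ultimately show ?thesis
      unfolding A C c t sg using False by (simp only: if_False)
  qed
qed

lemma btau_sign:
  assumes "0 < a" "m < M"
  shows "0 < (-1) ^ M * btau a M (Suc m)"
proof -
  obtain q where "M - m = Suc q" using assms(2) by (metis Suc_diff_Suc)
  then have "0 < sigma a (M - m)" using sigma_pos[OF assms(1), of q] by simp
  then show ?thesis by (simp add: btau_def flip: mult.assoc power_add)
qed

lemma Yseq_diag [simp]: "Yseq b c m m = 1"
  and Yseq_below: "i < m \<Longrightarrow> Yseq b c m i = 0"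
  by (simp_all add: Yseq_def)

text \<open>The system is unitriangular: at entry m only vectors of index at most m contribute, and
  those below m have been removed by induction.\<close>

lemma Yseq_independent:
  assumes "\<And>i. i \<le> M \<Longrightarrow> (\<Sum>m\<le>M. G m * Yseq b c m i) = 0"
  shows "m \<le> M \<Longrightarrow> G m = 0"
proof (induction m rule: less_induct)
  case (less m)
  have "G k * Yseq b c k m = 0" if "k \<noteq> m" "k \<le> M" for k
    using less(1)[of k] that by (cases "k < m") (simp_all add: Yseq_below)
  then have "(\<Sum>k\<le>M. G k * Yseq b c k m) = (\<Sum>k\<in>{m}. G k * Yseq b c k m)"
    using less(2) by (intro sum.mono_neutral_right) auto
  then show ?case using assms[OF less(2)] by simp
qed

lemma Yseq_spans: "\<exists>e. \<forall>i\<le>M. y i = (\<Sum>m\<le>M. e m * Yseq b c m i)"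
proof -
  have "\<exists>e. \<forall>i<n. y i = (\<Sum>m<n. e m * Yseq b c m i)" for n
  proof (induction n)
    case (Suc n)
    then obtain e where e: "\<forall>i<n. y i = (\<Sum>m<n. e m * Yseq b c m i)" by blast
    let ?e = "e(n := y n - (\<Sum>m<n. e m * Yseq b c m n))"
    have "(\<Sum>m<n. ?e m * Yseq b c m i) = (\<Sum>m<n. e m * Yseq b c m i)" for i
      by (intro sum.cong) auto
    then have "\<forall>i<Suc n. y i = (\<Sum>m<Suc n. ?e m * Yseq b c m i)"
      using e by (auto simp: less_Suc_eq Yseq_below simp del: fun_upd_apply) auto
    then show ?case by blast
  qed simp
  from this[of "Suc M"] show ?thesis by (simp add: lessThan_Suc_atMost less_Suc_eq_le)
qed

text \<open>With \<rho>_1 = (a + b - 1) / 2 this is 2 (\<rho>_1 - A_m - C_m) + 1/2, the diagonal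
  recurrence coefficient under \<theta> = 2 x + 1/2.\<close>

definition balpha :: "real \<Rightarrow> real \<Rightarrow> real \<Rightarrow> nat \<Rightarrow> nat \<Rightarrow> real" where
  "balpha a b c M m = theta (a + b) 0 - 2 * bi_A a b c M m - 2 * bi_C a b c M m"

lemma Useq_sum:
  assumes z: "\<And>i. i \<le> M \<Longrightarrow> z i = (\<Sum>m\<le>M. e m * Yseq b c m i)" and i: "i \<le> M"
  shows "Useq a b M z i = (\<Sum>m\<le>M. e m * Useq a b M (Yseq b c m) i)"
proof -
  \<comment> \<open>Entry M + 1 lies outside the given expansion; at i = M its coefficient
    \<open>sigma a 0\<close> vanishes.\<close>
  have "sigma a (M - i) * z (Suc i) = sigma a (M - i) * (\<Sum>m\<le>M. e m * Yseq b c m (Suc i))"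
    using z[of "Suc i"] i by (cases "i = M") auto
  then show ?thesis
    unfolding Useq_def z[OF i] mult.assoc
    by (simp add: sum_distrib_left sum.distrib algebra_simps)
qed

lemma Useq_expansion:
  assumes pos: "0 < b" "0 < c"
    and z: "\<And>i. i \<le> M \<Longrightarrow> z i = (\<Sum>m\<le>M. e m * Yseq b c m i)"
    and ev: "\<And>i. i \<le> M \<Longrightarrow> Useq a b M z i = \<theta> * z i"
    and m: "m \<le> M"
  shows "(if m < M then btau a M (Suc m) * e (Suc m) else 0)
    = (\<theta> - balpha a b c M m) * e m - (if m = 0 then 0 else bc a b c M (m - 1) * e (m - 1))"
proof -
  let ?Y = "Yseq b c"
  let ?up = "\<lambda>m. if m < M then btau a M (Suc m) * e (Suc m) else 0"
  let ?dn = "\<lambda>m. if m = 0 then 0 else bc a b c M (m - 1) * e (m - 1)"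
  define G where "G = (\<lambda>m. ?up m + balpha a b c M m * e m + ?dn m - \<theta> * e m)"
  have "(\<Sum>m\<le>M. G m * ?Y m i) = 0" if i: "i \<le> M" for i
  proof -
    have "\<theta> * z i = (\<Sum>m\<le>M. e m * ((if m = 0 then 0 else btau a M m * ?Y (m - 1) i)
        + balpha a b c M m * ?Y m i + bc a b c M m * ?Y (Suc m) i))"
    proof -
      have "\<theta> * z i = (\<Sum>m\<le>M. e m * Useq a b M (Yseq b c m) i)"
        unfolding ev[OF i, symmetric] by (rule Useq_sum[OF _ i]) (rule z)
      also have "\<dots> = (\<Sum>m\<le>M. e m * ((if m = 0 then 0 else btau a M m * ?Y (m - 1) i)
        + balpha a b c M m * ?Y m i + bc a b c M m * ?Y (Suc m) i))"
        unfolding balpha_def using i by (intro sum.cong refl) (simp add: Useq_Yseq[OF pos])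
      finally show ?thesis .
    qed
    also have "\<dots> = (\<Sum>m\<le>M. e m * (if m = 0 then 0 else btau a M m * ?Y (m - 1) i))
        + (\<Sum>m\<le>M. balpha a b c M m * e m * ?Y m i) + (\<Sum>m\<le>M. e m * bc a b c M m * ?Y (Suc m) i)"
      by (simp add: sum.distrib algebra_simps)
    also have "(\<Sum>m\<le>M. e m * (if m = 0 then 0 else btau a M m * ?Y (m - 1) i)) = (\<Sum>m<M. e (Suc m) * btau a M (Suc m) * ?Y m i)"
      by (subst sum.atMost_shift) (simp add: mult.assoc)
    also have "\<dots> = (\<Sum>m\<le>M. ?up m * ?Y m i)"
      by (intro sum.mono_neutral_cong_left) auto
    \<comment> \<open>The term m = M leads to the eigenvector M + 1, which vanishes at all entries
      up to M.\<close>
    also have "(\<Sum>m\<le>M. e m * bc a b c M m * ?Y (Suc m) i) = (\<Sum>m<M. e m * bc a b c M m * ?Y (Suc m) i)"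
      using i by (intro sum.mono_neutral_right) (auto simp: Yseq_below)
    also have "\<dots> = (\<Sum>m\<le>M. ?dn m * ?Y m i)"
      by (subst sum.atMost_shift) (simp add: mult_ac)
    finally have "\<theta> * (\<Sum>m\<le>M. e m * ?Y m i) = (\<Sum>m\<le>M. ?up m * ?Y m i)
      + (\<Sum>m\<le>M. balpha a b c M m * e m * ?Y m i) + (\<Sum>m\<le>M. ?dn m * ?Y m i)"
      unfolding z[OF i] .
    moreover have "(\<Sum>m\<le>M. G m * ?Y m i) = (\<Sum>m\<le>M. ?up m * ?Y m i)
      + (\<Sum>m\<le>M. balpha a b c M m * e m * ?Y m i) + (\<Sum>m\<le>M. ?dn m * ?Y m i) - \<theta> * (\<Sum>m\<le>M. e m * ?Y m i)"
      unfolding G_def sum_distrib_left sum.distrib[symmetric] sum_subtractf[symmetric]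
      by (intro sum.cong refl) (simp only: distrib_right left_diff_distrib mult.assoc)
    ultimately show ?thesis by linarith
  qed
  then have "G m = 0" using m by (rule Yseq_independent)
  then show ?thesis unfolding G_def by (simp only: left_diff_distrib)
qed

section \<open>Expansion coefficients as Bannai-Ito polynomials\<close>

lemma bi_B_0 [simp]: "bi_B a b c M 0 x = 1"
  by (simp add: bi_B_def)

lemma bi_B_Suc:
  "bi_B a b c M (Suc m) x = (x - ((a + b - 1) / 2 - bi_A a b c M m - bi_C a b c M m)) * bi_B a b c M m x
    - (if m = 0 then 0 else bi_A a b c M (m - 1) * bi_C a b c M m * bi_B a b c M (m - 1) x)"
  by (cases m) (simp_all add: bi_B_def bi_A_def bi_C_def)

lemma bi_C_0: "bi_C a b c M 0 = 0"
  by (simp add: bi_C_eq)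

text \<open>The coefficients obey the three-term recurrence of \<open>Useq_expansion\<close>.
  Splitting off the product of the factors 2 / \<open>btau\<close> makes it monic in x, hence that
  of the Bannai-Ito polynomials. It starts with \<open>e 0 = z 0\<close>, as only
  \<open>Yseq b c 0\<close> is nonzero at entry 0.\<close>

lemma expansion_bi_B:
  assumes pos: "0 < a" "0 < b" "0 < c"
    and z: "\<And>i. i \<le> M \<Longrightarrow> z i = (\<Sum>m\<le>M. e m * Yseq b c m i)"
    and ev: "\<And>i. i \<le> M \<Longrightarrow> Useq a b M z i = \<theta> * z i"
  shows "m \<le> M \<Longrightarrow> e m = z 0 * (\<Prod>i<m. 2 / btau a M (Suc i)) * bi_B a b c M m ((\<theta> - 1/2) / 2)"
proof (induction m rule: less_induct)
  case (less m)
  let ?x = "(\<theta> - 1/2) / 2"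
  let ?p = "\<lambda>m. \<Prod>i<m. 2 / btau a M (Suc i)"
  let ?B = "\<lambda>m. bi_B a b c M m ?x"
  show ?case
  proof (cases m)
    case 0
    have "(\<Sum>m\<le>M. e m * Yseq b c m 0) = (\<Sum>m\<in>{0}. e m * Yseq b c m 0)"
      by (intro sum.mono_neutral_right) (auto simp: Yseq_below)
    then show ?thesis using 0 z[of 0] by simp
  next
    case (Suc l)
    then have l: "l < M" using less by simp
    have t: "btau a M (Suc l) \<noteq> 0" using btau_sign[OF pos(1) l] by auto
    have al: "\<theta> - balpha a b c M l = 2 * (?x - ((a + b - 1) / 2 - bi_A a b c M l - bi_C a b c M l))"
      by (simp add: balpha_def theta_def field_simps)
    have "btau a M (Suc l) * e (Suc l) = 2 * (?x - ((a + b - 1) / 2 - bi_A a b c M l - bi_C a b c M l)) * e l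
       - (if l = 0 then 0 else bc a b c M (l - 1) * e (l - 1))"
      using Useq_expansion[OF pos(2,3) z ev, of l] l unfolding al by simp
    also have "e l = z 0 * ?p l * ?B l" using Suc l by (intro less.IH) auto
    also have "(if l = 0 then 0 else bc a b c M (l - 1) * e (l - 1))
       = (if l = 0 then 0 else 2 * (z 0 * ?p l) * (bi_A a b c M (l - 1) * bi_C a b c M l * ?B (l - 1)))"
    proof (cases l)
      case (Suc k)
      then have k: "k < M" "k < m" using l \<open>m = Suc l\<close> by auto
      have tk: "btau a M (Suc k) \<noteq> 0" using btau_sign[OF pos(1) k(1)] by auto
      have "e k = z 0 * ?p k * ?B k" using k by (intro less.IH) auto
      moreover have q: "bi_A a b c M k * bi_C a b c M (Suc k) = btau a M (Suc k) * bc a b c M k / 4"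
        using bi_A_bi_C[OF pos(2,3) k(1), of a] by simp
      ultimately have "bc a b c M k * e k
          = 2 * (z 0 * (?p k * (2 / btau a M (Suc k)))) * (bi_A a b c M k * bi_C a b c M (Suc k) * ?B k)"
        unfolding q using tk by (simp add: field_simps)
      then show ?thesis unfolding Suc by (simp only: prod.lessThan_Suc diff_Suc_1 nat.distinct if_False)
    qed simp
    finally have "btau a M (Suc l) * e (Suc l) = 2 * (z 0 * ?p l) * ?B (Suc l)"
      unfolding bi_B_Suc by (cases "l = 0") (simp_all add: algebra_simps)
    then have "e (Suc l) = 2 * (z 0 * ?p l) * ?B (Suc l) / btau a M (Suc l)"
      using t by (simp add: field_simps)
    then show ?thesis using Suc by simp
  qed
qed

text \<open>At \<open>x = \<rho>\<^sub>1\<close> the recurrence telescopes.\<close>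

lemma bi_B_at_rho1: "bi_B a b c M m ((a + b - 1) / 2) = (\<Prod>i<m. bi_A a b c M i)"
proof (induction m rule: less_induct)
  case (less m)
  show ?case
  proof (cases m)
    case (Suc l)
    show ?thesis
    proof (cases l)
      case 0
      then show ?thesis using Suc by (simp add: bi_B_Suc bi_C_0)
    next
      case (Suc k)
      then show ?thesis using \<open>m = Suc l\<close> less[of l] less[of k] by (simp add: bi_B_Suc algebra_simps)
    qed
  qed simp
qed

lemma theta_diff: "theta (b + c) (m + i) - theta (b + c) m = (-1) ^ m * bD (b + c) m i"
  by (cases "even i"; cases "even m") (simp_all add: theta_def bD_def algebra_simps)

lemma theta_inj:
  assumes "0 < b" "0 < c" "i \<noteq> m"
  shows "theta (b + c) i \<noteq> theta (b + c) m"
proof -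
  have "theta (b + c) (k + d) \<noteq> theta (b + c) k" if "0 < d" for k d
    using theta_diff[of b c k d] bD_nonzero[of "b + c" d k] assms that by auto
  then show ?thesis using assms(3) by (metis less_imp_add_positive linorder_neqE_nat)
qed

text \<open>Entries below m vanish because the eigenvalues are distinct, entry m is free, and each
  later entry follows from its predecessor on dividing by an eigenvalue difference.\<close>

lemma lower_bidiagonal_eigen:
  assumes pos: "0 < b" "0 < c"
    and ev: "\<And>i. i \<le> M \<Longrightarrow> theta (b + c) i * y i - sigma c i * y (i - 1) = theta (b + c) m * y i"
  shows "i \<le> M \<Longrightarrow> y i = y m * Yseq b c m i"
proof (induction i)
  case 0
  show ?case
  proof (cases "m = 0")
    case False
    then have "theta (b + c) 0 * y 0 = theta (b + c) m * y 0" using ev[of 0] by simp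
    then show ?thesis using theta_inj[OF pos, of 0 m] False by (simp add: Yseq_below)
  qed simp
next
  case (Suc i)
  have eq: "(theta (b + c) (Suc i) - theta (b + c) m) * y (Suc i) = sigma c (Suc i) * y i"
    using ev[OF Suc.prems] by (simp add: algebra_simps)
  consider "Suc i < m" | "Suc i = m" | "m \<le> i" by linarith
  then show ?case
  proof cases
    case 1
    then have "y i = 0" using Suc by (simp add: Yseq_below)
    then show ?thesis using eq theta_inj[OF pos, of "Suc i" m] 1 by (simp add: Yseq_below)
  next
    case 2
    then show ?thesis by simp
  next
    case 3
    then obtain r where r: "i = m + r" by (auto simp: le_iff_add)
    have d: "theta (b + c) (Suc i) - theta (b + c) m = (-1) ^ m * bD (b + c) m (Suc r)"
      using theta_diff[of b c m "Suc r"] r by simp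
    have nz: "bD (b + c) m (Suc r) \<noteq> 0" using pos by (intro bD_nonzero) auto
    have "(-1) ^ m * bD (b + c) m (Suc r) * y (Suc i) = sigma c (Suc i) * (y m * bY b c m r)"
      using eq Suc r unfolding d by (simp add: Yseq_def)
    then have "(-1) ^ m * ((-1) ^ m * (bD (b + c) m (Suc r) * y (Suc i))) = (-1) ^ m * (sigma c (Suc i) * (y m * bY b c m r))"
      by (simp only: mult.assoc)
    moreover have "(-1) ^ m * ((-1) ^ m * x) = x" for x :: real
      by (simp flip: mult.assoc power_add)
    ultimately have "y (Suc i) = (-1) ^ m * (sigma c (Suc i) * (y m * bY b c m r)) / bD (b + c) m (Suc r)"
      using nz by (simp add: field_simps)
    then show ?thesis using r by (simp add: Yseq_def mult_ac)
  qed
qed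

section \<open>Recoupling of three sites\<close>

text \<open>The rescaling removes the square roots from the matrices of \<open>\<Gamma>\<^bsub>12\<^esub>\<close> and \<open>\<Gamma>\<^bsub>23\<^esub>\<close>.\<close>

definition slice_scale :: "real \<Rightarrow> real \<Rightarrow> nat \<Rightarrow> nat \<Rightarrow> real" where
  "slice_scale a c M i = (\<Prod>j<i. sqrt (sigma a (M - j)) / sqrt (sigma c (Suc j)))"

lemma slice_scale_pos:
  assumes "0 < a" "0 < c"
  shows "i \<le> M \<Longrightarrow> 0 < slice_scale a c M i"
proof -
  assume i: "i \<le> M"
  have "0 < sqrt (sigma a (M - j)) / sqrt (sigma c (Suc j))" if "j < i" for j
  proof -
    have "M - j \<noteq> 0" using that i by simp
    then obtain q where "M - j = Suc q" using not0_implies_Suc by blast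
    then show ?thesis using assms sigma_pos[of a q] sigma_pos[of c j] by simp
  qed
  then show ?thesis unfolding slice_scale_def by (intro prod_pos) simp
qed

definition slice :: "(nat \<Rightarrow> real) \<Rightarrow> nat \<Rightarrow> (nat list \<Rightarrow> real) \<Rightarrow> nat \<Rightarrow> real" where
  "slice g M v i = v [M - i, 0, i] / slice_scale (g 0) (g (Suc (Suc 0))) M i"

lemma lower_op_3: "lower_op g (Suc (Suc (Suc 0))) v [x, y, w] =
    (-1) ^ (y + w) * sqrt (sigma (g 0) (Suc x)) * v [Suc x, y, w]
    + (-1) ^ w * sqrt (sigma (g (Suc 0)) (Suc y)) * v [x, Suc y, w]
    + sqrt (sigma (g (Suc (Suc 0))) (Suc w)) * v [x, y, Suc w]"
  by simp

text \<open>On vectors killed by A_-, lowering the sites 1 and 2 is, up to sign, lowering site 3. As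
  A_+ on site 2 cannot end in the middle entry 0, the operator A_+ A_- links the slice entry i only
  to i + 1.\<close>

lemma slice_Gam12:
  assumes g: "pos g" and v: "\<And>x y w. lower_op g (Suc (Suc (Suc 0))) v [x, y, w] = 0" and i: "i \<le> M"
  shows "Gam g (Suc (Suc 0)) v [M - i, 0, i] / slice_scale (g 0) (g (Suc (Suc 0))) M i
    = Useq (g 0) (g (Suc 0)) M (slice g M v) i"
proof -
  let ?a = "g 0" and ?b = "g (Suc 0)" and ?c = "g (Suc (Suc 0))" and ?x = "M - i"
  let ?l = "slice_scale ?a ?c M"
  have ac: "0 < ?a" "0 < ?c" using g by auto
  have rl: "raise_op g (Suc (Suc 0)) (lower_op g (Suc (Suc 0)) v) [?x, 0, i]
    = - ((-1) ^ i * sqrt (sigma ?a ?x) * sqrt (sigma ?c (Suc i)) * v [?x - 1, 0, Suc i])"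
  proof (cases ?x)
    case (Suc x)
    have "lower_op g (Suc (Suc (Suc 0))) v [x, 0, i] = 0" by (rule v)
    then have "(-1) ^ i * (sqrt (sigma ?a (Suc x)) * v [Suc x, 0, i] + sqrt (sigma ?b (Suc 0)) * v [x, Suc 0, i])
      = - (sqrt (sigma ?c (Suc i)) * v [x, 0, Suc i])"
      unfolding lower_op_3 by (simp add: algebra_simps)
    then have "(-1) ^ i * ((-1) ^ i * (sqrt (sigma ?a (Suc x)) * v [Suc x, 0, i] + sqrt (sigma ?b (Suc 0)) * v [x, Suc 0, i]))
      = (-1) ^ i * - (sqrt (sigma ?c (Suc i)) * v [x, 0, Suc i])"
      by (simp only:)
    moreover have "(-1) ^ i * ((-1) ^ i * z) = z" for z :: real
      by (simp flip: mult.assoc power_add)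
    ultimately have "sqrt (sigma ?a (Suc x)) * v [Suc x, 0, i] + sqrt (sigma ?b (Suc 0)) * v [x, Suc 0, i]
      = (-1) ^ i * - (sqrt (sigma ?c (Suc i)) * v [x, 0, Suc i])"
      by (simp only:)
    moreover have "raise_op g (Suc (Suc 0)) (lower_op g (Suc (Suc 0)) v) [?x, 0, i]
      = sqrt (sigma ?a (Suc x)) * (sqrt (sigma ?a (Suc x)) * v [Suc x, 0, i] + sqrt (sigma ?b (Suc 0)) * v [x, Suc 0, i])"
      unfolding Suc by simp
    ultimately show ?thesis unfolding Suc by simp
  qed simp
  have rM: "real ?x = real M - real i" "even (?x + i) = even M" using i by (auto simp: of_nat_diff)
  have scale: "sqrt (sigma ?a ?x) * sqrt (sigma ?c (Suc i)) * v [?x - 1, 0, Suc i] / ?l i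
    = sigma ?a ?x * slice g M v (Suc i)"
  proof (cases ?x)
    case (Suc x)
    have s: "0 < sqrt (sigma ?a ?x)" "0 < sqrt (sigma ?c (Suc i))"
      using sigma_pos[OF ac(1), of x] sigma_pos[OF ac(2), of i] Suc by simp_all
    have l: "0 < ?l i" using slice_scale_pos[OF ac i] .
    have l': "?l (Suc i) = ?l i * (sqrt (sigma ?a ?x) / sqrt (sigma ?c (Suc i)))"
      by (simp add: slice_scale_def)
    have "sigma ?a ?x = sqrt (sigma ?a ?x) * sqrt (sigma ?a ?x)"
      by (rule sqrt_sigma_square[OF ac(1), symmetric])
    moreover have "M - Suc i = ?x - 1" by simp
    ultimately show ?thesis
      unfolding slice_def l' using s l by (simp add: field_simps)
  qed simp
  have "Gam g (Suc (Suc 0)) v [?x, 0, i] = theta (?a + ?b) ?x * v [?x, 0, i]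
    + (-1) ^ ?x * ((-1) ^ i * (sqrt (sigma ?a ?x) * sqrt (sigma ?c (Suc i)) * v [?x - 1, 0, Suc i]))"
    unfolding Gam_def rl by (simp add: theta_def algebra_simps)
  also have "(-1) ^ ?x * ((-1) ^ i * (sqrt (sigma ?a ?x) * sqrt (sigma ?c (Suc i)) * v [?x - 1, 0, Suc i]))
    = (-1) ^ M * (sqrt (sigma ?a ?x) * sqrt (sigma ?c (Suc i)) * v [?x - 1, 0, Suc i])"
    using i by (simp add: mult.assoc[symmetric] power_add[symmetric])
  finally show ?thesis
    unfolding Useq_def
    using scale by (simp add: add_divide_distrib slice_def mult.assoc times_divide_eq_right[symmetric] del: times_divide_eq_right)
qed

text \<open>Here lowering the sites 2 and 3 is, up to sign, lowering site 1, and only A_+ on site 3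
  can end in the middle entry 0, which links i to i - 1.\<close>

lemma slice_Gam23:
  assumes g: "pos g" and v: "\<And>x y w. lower_op g (Suc (Suc (Suc 0))) v [x, y, w] = 0" and i: "i \<le> M"
  shows "Gam (shift g) (Suc (Suc 0)) (\<lambda>r. v ((M - i) # r)) [0, i] / slice_scale (g 0) (g (Suc (Suc 0))) M i
    = theta (g (Suc 0) + g (Suc (Suc 0))) i * slice g M v i - sigma (g (Suc (Suc 0))) i * slice g M v (i - 1)"
proof -
  let ?a = "g 0" and ?b = "g (Suc 0)" and ?c = "g (Suc (Suc 0))" and ?x = "M - i"
  let ?l = "slice_scale ?a ?c M" and ?v = "\<lambda>r. v ((M - i) # r)"
  have ac: "0 < ?a" "0 < ?c" using g by auto
  have rl: "raise_op (shift g) (Suc (Suc 0)) (lower_op (shift g) (Suc (Suc 0)) ?v) [0, i]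
    = (-1) ^ i * (sqrt (sigma ?a (Suc ?x)) * sqrt (sigma ?c i) * v [Suc ?x, 0, i - 1])"
  proof (cases i)
    case (Suc j)
    have "lower_op g (Suc (Suc (Suc 0))) v [?x, 0, j] = 0" by (rule v)
    then have "(-1) ^ j * sqrt (sigma ?b (Suc 0)) * v [?x, Suc 0, j] + sqrt (sigma ?c (Suc j)) * v [?x, 0, Suc j]
      = - ((-1) ^ j * sqrt (sigma ?a (Suc ?x)) * v [Suc ?x, 0, j])"
      unfolding lower_op_3 by (simp add: algebra_simps)
    moreover have "raise_op (shift g) (Suc (Suc 0)) (lower_op (shift g) (Suc (Suc 0)) ?v) [0, i]
      = sqrt (sigma ?c (Suc j)) * ((-1) ^ j * sqrt (sigma ?b (Suc 0)) * v [?x, Suc 0, j] + sqrt (sigma ?c (Suc j)) * v [?x, 0, Suc j])"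
      unfolding Suc by simp
    ultimately show ?thesis unfolding Suc by simp
  qed simp
  have scale: "sqrt (sigma ?a (Suc ?x)) * sqrt (sigma ?c i) * v [Suc ?x, 0, i - 1] / ?l i
    = sigma ?c i * slice g M v (i - 1)"
  proof (cases i)
    case (Suc j)
    then have x: "M - j = Suc ?x" using i by simp
    have s: "0 < sqrt (sigma ?a (Suc ?x))" "0 < sqrt (sigma ?c (Suc j))"
      using sigma_pos[OF ac(1), of ?x] sigma_pos[OF ac(2), of j] by simp_all
    have l: "0 < ?l j" using slice_scale_pos[OF ac, of j M] i Suc by simp
    have l': "?l i = ?l j * (sqrt (sigma ?a (Suc ?x)) / sqrt (sigma ?c (Suc j)))"
      using Suc x by (simp add: slice_scale_def)
    have "sigma ?c (Suc j) = sqrt (sigma ?c (Suc j)) * sqrt (sigma ?c (Suc j))"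
      by (rule sqrt_sigma_square[OF ac(2), symmetric])
    then show ?thesis
      unfolding slice_def l' using s l x Suc by (simp add: field_simps)
  qed simp
  have "Gam (shift g) (Suc (Suc 0)) ?v [0, i] = theta (?b + ?c) i * v [?x, 0, i]
    - (-1) ^ i * ((-1) ^ i * (sqrt (sigma ?a (Suc ?x)) * sqrt (sigma ?c i) * v [Suc ?x, 0, i - 1]))"
    unfolding Gam_def rl by (simp add: theta_def algebra_simps)
  also have "(-1) ^ i * ((-1) ^ i * (sqrt (sigma ?a (Suc ?x)) * sqrt (sigma ?c i) * v [Suc ?x, 0, i - 1]))
    = sqrt (sigma ?a (Suc ?x)) * sqrt (sigma ?c i) * v [Suc ?x, 0, i - 1]"
    by (simp add: mult.assoc[symmetric] power_add[symmetric])
  finally show ?thesis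
    using scale by (simp add: diff_divide_distrib slice_def)
qed

text \<open>The equation A_- v = 0 at (x, y, w) expresses the coordinate with middle entry y + 1 by
  those with middle entry y.\<close>

lemma slice_inject:
  assumes g: "pos g" and v: "\<And>x y w. lower_op g (Suc (Suc (Suc 0))) v [x, y, w] = 0"
    and z: "\<And>i. i \<le> M \<Longrightarrow> v [M - i, 0, i] = 0"
  shows "x + y + w = M \<Longrightarrow> v [x, y, w] = 0"
proof (induction y arbitrary: x w)
  case 0
  then show ?case using z[of w] by auto
next
  case (Suc y)
  have "sqrt (sigma (g (Suc 0)) (Suc y)) \<noteq> 0" using sigma_pos[of "g (Suc 0)" y] g by simp
  moreover have "v [Suc x, y, w] = 0" "v [x, y, Suc w] = 0" using Suc.IH Suc.prems by auto
  ultimately show ?case using v[of x y w] unfolding lower_op_3 by simp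
qed

lemma lower_op_sum: "lower_op g k (\<lambda>x. \<Sum>m\<in>A. c m * F m x) x = (\<Sum>m\<in>A. c m * lower_op g k (F m) x)"
proof (induction A rule: infinite_finite_induct)
  case (insert m A)
  then show ?case by (simp add: lower_op_add lower_op_cmult)
qed (simp_all add: lower_op_zero)

text \<open>Up to these signs, exchanging the outer sites reverses a slice.\<close>

definition hat :: "nat \<Rightarrow> (nat \<Rightarrow> real) \<Rightarrow> nat \<Rightarrow> real" where
  "hat M y j = ((-1) ^ Suc M) ^ j * y (M - j)"

lemma hat_eq_iff: "(\<forall>j\<le>M. hat M y j = hat M z j) \<longleftrightarrow> (\<forall>i\<le>M. y i = z i)"
proof
  assume h: "\<forall>j\<le>M. hat M y j = hat M z j"
  show "\<forall>i\<le>M. y i = z i"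
  proof (intro allI impI)
    fix i assume "i \<le> M"
    then show "y i = z i" using h[rule_format, of "M - i"] by (simp add: hat_def)
  qed
qed (simp add: hat_def)

lemma hat_sign: "(-1) ^ M * ((-1) ^ Suc M) ^ Suc j = - (((-1) ^ Suc M) ^ j :: real)"
  by (cases "even M") simp_all

text \<open>Reversal brings the upper bidiagonal \<open>Useq\<close> into the lower bidiagonal form
  to which \<open>lower_bidiagonal_eigen\<close> applies.\<close>

lemma hat_lower:
  assumes "j \<le> M"
  shows "theta h j * hat M y j - sigma a j * hat M y (j - 1)
    = ((-1) ^ Suc M) ^ j * (theta h j * y (M - j) + (-1) ^ M * sigma a j * y (Suc (M - j)))"
proof (cases j)
  case (Suc i)
  have e: "M - i = Suc (M - Suc i)" using assms Suc by simp
  have "((-1) ^ Suc M) ^ Suc i * (-1) ^ M = - (((-1) ^ Suc M) ^ i :: real)"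
    using hat_sign[of M i] by (simp only: mult.commute)
  then have "((-1) ^ Suc M) ^ Suc i * ((-1) ^ M * sigma a (Suc i) * y (M - i)) = - (((-1) ^ Suc M) ^ i) * sigma a (Suc i) * y (M - i)"
    by (simp only: mult.assoc[symmetric])
  then show ?thesis unfolding Suc hat_def e[symmetric] distrib_left by (simp only: diff_Suc_1) (simp add: mult_ac)
qed (simp add: hat_def)

text \<open>Conversely, reversal turns the lower bidiagonal \<Gamma>_23 into \<open>Useq\<close>
  with c in the place of a.\<close>

lemma Useq_hat:
  assumes "j \<le> M"
  shows "Useq c b M (hat M y) j = ((-1) ^ Suc M) ^ j *
    (theta (c + b) (M - j) * y (M - j) - sigma c (M - j) * y (M - j - 1))"
proof -
  have "(-1) ^ M * sigma c (M - j) * (((-1) ^ Suc M) ^ Suc j * y (M - Suc j))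
     = ((-1) ^ M * ((-1) ^ Suc M) ^ Suc j) * (sigma c (M - j) * y (M - Suc j))"
    by (simp only: mult_ac)
  then show ?thesis
    unfolding Useq_def hat_def hat_sign by (simp add: algebra_simps del: power_Suc)
qed

lemma sum_list_3: "x \<in> deg_lists 3 M \<longleftrightarrow> (\<exists>p q r. x = [p, q, r] \<and> p + q + r = M)"
  by (auto simp: deg_lists_def eval_nat_numeral length_Suc_conv)

lemma lower_op_Sv3: "pos g \<Longrightarrow> lower_op g (Suc (Suc (Suc 0))) (Sv g [k, l]) [x, y, w] = 0"
  by (simp only: Sv.simps lower_op_iota iota.simps lower_op_iota[OF pos_merge]) simp

lemma lower_op_Jv3: "pos g \<Longrightarrow> lower_op g (Suc (Suc (Suc 0))) (Jv g [m, l]) [x, y, w] = 0"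
  by (simp only: Jv.simps lower_op_iota23 iota23.simps iota.simps lower_op_iota[OF pos_merge23]) simp

lemma ip_Sv3:
  assumes "pos g" "k \<le> M" "k' \<le> M"
  shows "ip 3 M (Sv g [k, M - k]) (Sv g [k', M - k']) = of_bool (k = k')"
  using assms by (auto simp: eval_nat_numeral ip_iota pos_merge ip_single)

lemma ip_Jv3:
  assumes "pos g" "m \<le> M" "m' \<le> M"
  shows "ip 3 M (Jv g [m, M - m]) (Jv g [m', M - m']) = of_bool (m = m')"
  using assms by (auto simp: eval_nat_numeral ip_iota23 ip_iota pos_merge23 ip_single)

lemma slice_sum: "slice g M (\<lambda>x. \<Sum>m\<in>A. c m * F m x) i = (\<Sum>m\<in>A. c m * slice g M (F m) i)"
  by (simp add: slice_def sum_divide_distrib)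

lemma slice_Jv:
  assumes "pos g" "m \<le> M" "i \<le> M"
  shows "slice g M (Jv g [m, M - m]) i
    = slice g M (Jv g [m, M - m]) m * Yseq (g (Suc 0)) (g (Suc (Suc 0))) m i"
proof (rule lower_bidiagonal_eigen[where M = M])
  fix i assume i: "i \<le> M"
  have "Gam (shift g) (Suc (Suc 0)) (\<lambda>r. Jv g [m, M - m] ((M - i) # r)) [0, i]
      = theta (g (Suc 0) + g (Suc (Suc 0))) m * Jv g [m, M - m] [M - i, 0, i]"
    using Gam_shift_Jv[OF assms(1), of 1 "[m, M - m]" "[0, i]" "M - i"]
    by (simp add: theta_def add.assoc)
  then show "theta (g (Suc 0) + g (Suc (Suc 0))) i * slice g M (Jv g [m, M - m]) i
      - sigma (g (Suc (Suc 0))) i * slice g M (Jv g [m, M - m]) (i - 1)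
      = theta (g (Suc 0) + g (Suc (Suc 0))) m * slice g M (Jv g [m, M - m]) i"
    using slice_Gam23[OF assms(1) lower_op_Jv3[OF assms(1)] i, of m "M - m"]
    by (simp add: slice_def del: Jv.simps)
qed (use assms in auto)

lemma Useq_slice_Sv:
  assumes "pos g" "i \<le> M"
  shows "Useq (g 0) (g (Suc 0)) M (slice g M (Sv g [k, M - k])) i
    = theta (g 0 + g (Suc 0)) k * slice g M (Sv g [k, M - k]) i"
proof -
  have "Gam g (Suc (Suc 0)) (Sv g [k, M - k]) [M - i, 0, i]
      = theta (g 0 + g (Suc 0)) k * Sv g [k, M - k] [M - i, 0, i]"
    using Gam_Sv[OF assms(1), of 1 "[k, M - k]" "[M - i, 0, i]"] by (simp add: theta_def add.assoc)
  then show ?thesis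
    using slice_Gam12[OF assms(1) lower_op_Sv3[OF assms(1)] assms(2), of k "M - k"]
    by (simp add: slice_def del: Sv.simps)
qed

lemma hat_slice_Sv:
  assumes "pos g" "k \<le> M" "j \<le> M"
  shows "hat M (slice g M (Sv g [k, M - k])) j
    = hat M (slice g M (Sv g [k, M - k])) k * Yseq (g (Suc 0)) (g 0) k j"
proof (rule lower_bidiagonal_eigen[where M = M])
  fix j assume j: "j \<le> M"
  then show "theta (g (Suc 0) + g 0) j * hat M (slice g M (Sv g [k, M - k])) j
      - sigma (g 0) j * hat M (slice g M (Sv g [k, M - k])) (j - 1)
      = theta (g (Suc 0) + g 0) k * hat M (slice g M (Sv g [k, M - k])) j"
    using Useq_slice_Sv[OF assms(1), of "M - j" M k] unfolding hat_lower[OF j]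
    by (simp add: Useq_def hat_def add.commute del: Sv.simps)
qed (use assms in auto)

text \<open>At entries (x, 0) the sign in \<open>raise2\<close> is 1, so raising keeps the
  coordinate positive. This pins down the phase of \<open>Sv\<close>.\<close>

lemma Sv3_corner:
  assumes "pos g" "k \<le> M"
  shows "0 < Sv g [k, M - k] [M, 0, 0]"
proof -
  have top: "0 < cg a b N t (N + t) 0" if "0 < a" "0 < b" for a b N t
  proof (induction t)
    case 0
    then show ?case using lowest_norm_pos[of a b N] by (simp add: cg.simps)
  next
    case (Suc t)
    have "0 < sqrt (sigma a (Suc (N + t)))" "0 < sqrt (sigma (a + b + real N) (Suc t))"
      using sigma_pos[of a "N + t"] sigma_pos[of "a + b + real N" t] that by simp_all
    then show ?case using Suc by (simp add: cg.simps raise2_def)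
  qed
  have "0 < g 0" "0 < g (Suc 0)" "0 < g (Suc (Suc 0))" using assms by auto
  moreover have "pos (merge g k)" using assms by (intro pos_merge)
  then have "0 < merge g k 0" by (rule posD)
  ultimately have "0 < cg (g 0) (g (Suc 0)) k (M - k) (k + (M - k)) 0"
    "0 < cg (merge g k 0) (g (Suc (Suc 0))) (M - k) 0 (M - k + 0) 0"
    using top by blast+
  then show ?thesis using assms by simp
qed

lemma lowest_sign: "0 < a \<Longrightarrow> 0 < b \<Longrightarrow> y \<le> N \<Longrightarrow> 0 < (-1) ^ y * sgn23 y * lowest a b N y"
proof (induction y)
  case 0
  then show ?case by (simp add: sgn23_def)
next
  case (Suc y)
  have "N - y \<noteq> 0" using Suc.prems by simp
  then obtain q where q: "N - y = Suc q" using not0_implies_Suc by blast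
  have sq: "0 < sqrt (sigma a (N - y)) / sqrt (sigma b (Suc y))"
    using sigma_pos[of a q] sigma_pos[of b y] Suc.prems q by simp
  have eq: "(-1) ^ Suc y * sgn23 (Suc y) * lowest a b N (Suc y)
     = ((-1) ^ y * (-1) ^ y) * ((-1) ^ y * sgn23 y * lowest a b N y) * (sqrt (sigma a (N - y)) / sqrt (sigma b (Suc y)))"
    by (simp add: sgn23_def mult_ac)
  have one: "(-1) ^ y * (-1) ^ y = (1::real)" by (simp flip: power_add)
  have "0 < (-1) ^ y * sgn23 y * lowest a b N y" using Suc by simp
  then show ?case unfolding eq one mult_1_left using sq by (rule mult_pos_pos)
qed

text \<open>The signs are (-1)^m \<open>sgn23 m\<close> from \<open>lowest_sign\<close> and
  \<open>sgn23 m\<close> (-1)^(m(M - m)) from \<open>iota23\<close>; the two \<open>sgn23 m\<close>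
  cancel, and (-1)^(M m) remains.\<close>

lemma slice_Jv_diag_sign:
  assumes "pos g" "m \<le> M"
  shows "0 < (-1) ^ (M * m) * slice g M (Jv g [m, M - m]) m"
proof -
  let ?a = "g 0" and ?b = "g (Suc 0)" and ?c = "g (Suc (Suc 0))"
  have pos: "0 < ?a" "0 < ?b" "0 < ?c" "0 < merge (shift g) m 0"
    using assms(1) posD[OF pos_merge[OF pos_shift[OF assms(1)], of m], of 0] by auto
  have h: "0 < (-1) ^ m * sgn23 m * lowest ?b ?c m m" using pos by (intro lowest_sign) auto
  have c1: "cg ?b ?c m 0 0 m = lowest ?b ?c m m / sqrt (\<Sum>y\<le>m. (lowest ?b ?c m y)\<^sup>2)"
    by (simp add: cg.simps)
  have c2: "cg ?a (merge (shift g) m 0) (M - m) 0 (M - m) 0 = 1 / sqrt (\<Sum>y\<le>M - m. (lowest ?a (merge (shift g) m 0) (M - m) y)\<^sup>2)"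
    by (simp add: cg.simps)
  let ?n = "sqrt (\<Sum>y\<le>m. (lowest ?b ?c m y)\<^sup>2) * sqrt (\<Sum>y\<le>M - m. (lowest ?a (merge (shift g) m 0) (M - m) y)\<^sup>2)"
  have n: "0 < ?n" using lowest_norm_pos by simp
  have l: "0 < slice_scale ?a ?c M m" using pos assms by (intro slice_scale_pos)
  have "Jv g [m, M - m] [M - m, 0, m] = sgn23 m * (-1) ^ (m * (M - m)) * lowest ?b ?c m m / ?n"
    using c1 c2 by simp
  moreover have "(-1) ^ (M * m) * (-1) ^ (m * (M - m)) = ((-1) ^ m :: real)"
  proof -
    obtain d where d: "M = m + d" using assms(2) by (auto simp: le_iff_add)
    have "M * m + m * (M - m) = m * m + 2 * (d * m)" unfolding d by (simp add: algebra_simps)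
    then have "even (M * m + m * (M - m)) = even m" by simp
    then show ?thesis unfolding power_add[symmetric] by (cases "even m") simp_all
  qed
  ultimately have "(-1) ^ (M * m) * slice g M (Jv g [m, M - m]) m
      = ((-1) ^ m * sgn23 m * lowest ?b ?c m m) / ?n / slice_scale ?a ?c M m"
    by (simp add: slice_def del: Jv.simps) (simp add: mult_ac)?
  then show ?thesis using h n l by simp
qed

text \<open>In degree M the slices of the M + 1 vectors \<open>Jv\<close> are nonzero multiples of
  the \<open>Yseq\<close>, which span, and a vector killed by A_- is determined by its slice.
  Orthonormality then identifies the coefficients.\<close>

lemma Jv3_expansion:
  assumes g: "pos g" and v: "\<And>x y w. lower_op g (Suc (Suc (Suc 0))) v [x, y, w] = 0"
    and s: "\<And>x. v x \<noteq> 0 \<Longrightarrow> x \<in> deg_lists 3 M"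
  shows "v x = (\<Sum>m\<le>M. ip 3 M (Jv g [m, M - m]) v * Jv g [m, M - m] x)"
proof -
  let ?f = "\<lambda>m. Jv g [m, M - m]"
  obtain d where d: "\<forall>i\<le>M. slice g M v i = (\<Sum>m\<le>M. d m * Yseq (g (Suc 0)) (g (Suc (Suc 0))) m i)"
    using Yseq_spans by blast
  define c where "c m = d m / slice g M (?f m) m" for m
  have cd: "c m * slice g M (?f m) m = d m" if "m \<le> M" for m
    using slice_Jv_diag_sign[OF g that] by (auto simp: c_def simp del: Jv.simps)
  let ?w = "\<lambda>x. 1 * v x + (-1) * (\<Sum>m\<le>M. c m * ?f m x)"
  have "lower_op g (Suc (Suc (Suc 0))) ?w [x, y, w] = 0" for x y w
    unfolding lower_op_add lower_op_cmult lower_op_sum v lower_op_Jv3[OF g] by simp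
  moreover have "?w [M - i, 0, i] = 0" if i: "i \<le> M" for i
  proof -
    have "slice g M v i = (\<Sum>m\<le>M. c m * slice g M (?f m) i)"
      unfolding d[rule_format, OF i]
    proof (rule sum.cong)
      fix m assume "m \<in> {..M}"
      then have m: "m \<le> M" by simp
      show "d m * Yseq (g (Suc 0)) (g (Suc (Suc 0))) m i = c m * slice g M (?f m) i"
        unfolding slice_Jv[OF g m i] cd[OF m, symmetric] by (simp only: mult.assoc)
    qed simp
    then have "slice g M v i = slice g M (\<lambda>x. \<Sum>m\<le>M. c m * ?f m x) i"
      unfolding slice_sum .
    moreover have "slice_scale (g 0) (g (Suc (Suc 0))) M i \<noteq> 0"
      using slice_scale_pos[of "g 0" "g (Suc (Suc 0))" i M] g i by simp
    ultimately show ?thesis by (simp add: slice_def del: Jv.simps)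
  qed
  ultimately have "?w [x, y, w] = 0" if "x + y + w = M" for x y w
    using that by (rule slice_inject[OF g])
  then have eq: "v x = (\<Sum>m\<le>M. c m * ?f m x)" if "x \<in> deg_lists 3 M" for x
    using that by (auto simp: sum_list_3 simp del: Jv.simps)
  have "ip 3 M (?f m) v = c m" if m: "m \<le> M" for m
  proof -
    have "ip 3 M (?f m) v = (\<Sum>x\<in>deg_lists 3 M. ?f m x * (\<Sum>m\<le>M. c m * ?f m x))"
      unfolding ip_def using eq by (intro sum.cong) simp_all
    also have "\<dots> = (\<Sum>m'\<le>M. c m' * ip 3 M (?f m) (?f m'))"
      unfolding ip_def sum_distrib_left by (subst sum.swap) (simp add: mult_ac del: Jv.simps)
    also have "\<dots> = (\<Sum>m'\<le>M. c m' * of_bool (m = m'))"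
      using ip_Jv3[OF g m] by (intro sum.cong) simp_all
    finally show ?thesis using m by simp
  qed
  then have "(\<Sum>m\<le>M. ip 3 M (?f m) v * ?f m x) = (\<Sum>m\<le>M. c m * ?f m x)" for x
    by (intro sum.cong) simp_all
  moreover have "v x = (\<Sum>m\<le>M. c m * ?f m x)"
  proof (cases "x \<in> deg_lists 3 M")
    case False
    then have "v x = 0" using s by blast
    moreover have "?f m x = 0" if "m \<le> M" for m
      using Jv_support[of g "[m, M - m]" x] False that by (auto simp: eval_nat_numeral simp del: Jv.simps)
    ultimately show ?thesis by (simp del: Jv.simps)
  qed (rule eq)
  ultimately show ?thesis by simp
qed

lemma Sv3_support: "k \<le> M \<Longrightarrow> Sv g [k, M - k] x \<noteq> 0 \<Longrightarrow> x \<in> deg_lists 3 M"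
  using Sv_support[of g "[k, M - k]" x] by (simp add: eval_nat_numeral del: Sv.simps)

lemma Jv3_support: "m \<le> M \<Longrightarrow> Jv g [m, M - m] x \<noteq> 0 \<Longrightarrow> x \<in> deg_lists 3 M"
  using Jv_support[of g "[m, M - m]" x] by (simp add: eval_nat_numeral del: Jv.simps)

text \<open>Otherwise the whole reversed slice would vanish, including its last entry, which is the
  positive corner coordinate.\<close>

lemma hat_diag_nonzero:
  assumes g: "pos g" and k: "k \<le> M"
  shows "hat M (slice g M (Sv g [k, M - k])) k \<noteq> 0"
proof
  assume "hat M (slice g M (Sv g [k, M - k])) k = 0"
  then have "hat M (slice g M (Sv g [k, M - k])) M = 0"
    using hat_slice_Sv[OF g k, of M] by simp
  then show False using Sv3_corner[OF g k] by (simp add: hat_def slice_def slice_scale_def del: Sv.simps)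
qed

lemma Sv3_expansion:
  assumes g: "pos g" and v: "\<And>x y w. lower_op g (Suc (Suc (Suc 0))) v [x, y, w] = 0"
    and s: "\<And>x. v x \<noteq> 0 \<Longrightarrow> x \<in> deg_lists 3 M"
  shows "v x = (\<Sum>k\<le>M. ip 3 M (Sv g [k, M - k]) v * Sv g [k, M - k] x)"
proof -
  let ?f = "\<lambda>k. Sv g [k, M - k]"
  obtain d where d: "\<forall>j\<le>M. hat M (slice g M v) j = (\<Sum>k\<le>M. d k * Yseq (g (Suc 0)) (g 0) k j)"
    using Yseq_spans by blast
  define c where "c k = d k / hat M (slice g M (?f k)) k" for k
  have cd: "c k * hat M (slice g M (?f k)) k = d k" if "k \<le> M" for k
    using hat_diag_nonzero[OF g that] by (simp add: c_def del: Sv.simps)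
  let ?w = "\<lambda>x. 1 * v x + (-1) * (\<Sum>k\<le>M. c k * ?f k x)"
  have "lower_op g (Suc (Suc (Suc 0))) ?w [x, y, w] = 0" for x y w
    unfolding lower_op_add lower_op_cmult lower_op_sum v lower_op_Sv3[OF g] by simp
  moreover have "?w [M - i, 0, i] = 0" if i: "i \<le> M" for i
  proof -
    have "\<forall>j\<le>M. hat M (slice g M v) j = hat M (slice g M (\<lambda>x. \<Sum>k\<le>M. c k * ?f k x)) j"
    proof (intro allI impI)
      fix j assume j: "j \<le> M"
      have "hat M (slice g M v) j = (\<Sum>k\<le>M. c k * hat M (slice g M (?f k)) j)"
        unfolding d[rule_format, OF j]
      proof (rule sum.cong)
        fix k assume "k \<in> {..M}"
        then have k: "k \<le> M" by simp
        show "d k * Yseq (g (Suc 0)) (g 0) k j = c k * hat M (slice g M (?f k)) j"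
          unfolding hat_slice_Sv[OF g k j] cd[OF k, symmetric] by (simp only: mult.assoc)
      qed simp
      then show "hat M (slice g M v) j = hat M (slice g M (\<lambda>x. \<Sum>k\<le>M. c k * ?f k x)) j"
        by (simp add: hat_def slice_sum sum_distrib_left mult_ac del: Sv.simps)
    qed
    then have "slice g M v i = slice g M (\<lambda>x. \<Sum>k\<le>M. c k * ?f k x) i"
      unfolding hat_eq_iff using i by blast
    moreover have "slice_scale (g 0) (g (Suc (Suc 0))) M i \<noteq> 0"
      using slice_scale_pos[of "g 0" "g (Suc (Suc 0))" i M] g i by simp
    ultimately show ?thesis by (simp add: slice_def del: Sv.simps)
  qed
  ultimately have "?w [x, y, w] = 0" if "x + y + w = M" for x y w
    using that by (rule slice_inject[OF g])
  then have eq: "v x = (\<Sum>k\<le>M. c k * ?f k x)" if "x \<in> deg_lists 3 M" for x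
    using that by (auto simp: sum_list_3 simp del: Sv.simps)
  have "ip 3 M (?f k) v = c k" if k: "k \<le> M" for k
  proof -
    have "ip 3 M (?f k) v = (\<Sum>x\<in>deg_lists 3 M. ?f k x * (\<Sum>k\<le>M. c k * ?f k x))"
      unfolding ip_def using eq by (intro sum.cong) simp_all
    also have "\<dots> = (\<Sum>k'\<le>M. c k' * ip 3 M (?f k) (?f k'))"
      unfolding ip_def sum_distrib_left by (subst sum.swap) (simp add: mult_ac del: Sv.simps)
    also have "\<dots> = (\<Sum>k'\<le>M. c k' * of_bool (k = k'))"
      using ip_Sv3[OF g k] by (intro sum.cong) simp_all
    finally show ?thesis using k by simp
  qed
  then have "(\<Sum>k\<le>M. ip 3 M (?f k) v * ?f k x) = (\<Sum>k\<le>M. c k * ?f k x)" for x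
    by (intro sum.cong) simp_all
  moreover have "v x = (\<Sum>k\<le>M. c k * ?f k x)"
  proof (cases "x \<in> deg_lists 3 M")
    case False
    then have "v x = 0" using s by blast
    moreover have "?f k x = 0" if "k \<le> M" for k
      using Sv3_support[OF that, of g x] False by blast
    ultimately show ?thesis by (simp del: Sv.simps)
  qed (rule eq)
  ultimately show ?thesis by simp
qed

section \<open>The overlap matrix of three sites\<close>

definition mixing :: "(nat \<Rightarrow> real) \<Rightarrow> nat \<Rightarrow> nat \<Rightarrow> nat \<Rightarrow> real" where
  "mixing g M m k = ip 3 M (Jv g [m, M - m]) (Sv g [k, M - k])"

lemma ip_commute: "ip n N u v = ip n N v u"
  by (simp add: ip_def mult.commute)

lemma Sv3_mixing:
  assumes "pos g" "k \<le> M"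
  shows "Sv g [k, M - k] x = (\<Sum>m\<le>M. mixing g M m k * Jv g [m, M - m] x)"
  unfolding mixing_def
  using assms Jv3_expansion[where v = "Sv g [k, M - k]" and x = x, OF assms(1) lower_op_Sv3[OF assms(1)] Sv3_support[OF assms(2)]] by simp

lemma Jv3_mixing:
  assumes "pos g" "m \<le> M"
  shows "Jv g [m, M - m] x = (\<Sum>k\<le>M. mixing g M m k * Sv g [k, M - k] x)"
  unfolding mixing_def
  using assms Sv3_expansion[where v = "Jv g [m, M - m]" and x = x, OF assms(1) lower_op_Jv3[OF assms(1)] Jv3_support[OF assms(2)]]
  by (simp only: ip_commute[of 3 M "Sv g [_, M - _]"])

text \<open>The matrix is orthogonal because both families are orthonormal and span the same
  vectors.\<close>

lemma mixing_rows:
  assumes "pos g" "m \<le> M" "m' \<le> M"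
  shows "(\<Sum>k\<le>M. mixing g M m k * mixing g M m' k) = of_bool (m = m')"
proof -
  have "of_bool (m = m') = ip 3 M (Jv g [m', M - m']) (Jv g [m, M - m])"
    using ip_Jv3[OF assms(1,3,2)] by auto
  also have "\<dots> = (\<Sum>x\<in>deg_lists 3 M. Jv g [m', M - m'] x * (\<Sum>k\<le>M. mixing g M m k * Sv g [k, M - k] x))"
    unfolding ip_def Jv3_mixing[OF assms(1,2)] ..
  also have "\<dots> = (\<Sum>k\<le>M. mixing g M m k * mixing g M m' k)"
    unfolding mixing_def[of g M m'] ip_def sum_distrib_left by (subst sum.swap) (simp add: mult_ac del: Jv.simps Sv.simps)
  finally show ?thesis by simp
qed

text \<open>By \<open>mixing_0_square\<close> this is the square of row 0 of the overlap matrix, in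
  the form in which it arises there: last entries of two bidiagonal eigenvectors, and a polynomial
  of the exchanged problem at \<rho>_1.\<close>

definition mix_weight :: "real \<Rightarrow> real \<Rightarrow> real \<Rightarrow> nat \<Rightarrow> nat \<Rightarrow> real" where
  "mix_weight a b c M k = Yseq b a k M * Yseq b c 0 M * (\<Prod>i<k. 2 * bi_A c b a M i / btau c M (Suc i))"

context
  fixes g :: "nat \<Rightarrow> real" and a b c :: real and M :: nat
  assumes g: "pos g"
  defines "a \<equiv> g 0" and "b \<equiv> g (Suc 0)" and "c \<equiv> g (Suc (Suc 0))"
begin

private abbreviation "u \<equiv> mixing g M"
text \<open>\<open>\<kappa>\<close> and \<open>\<eta>\<close> are the factors between the unit
  vectors and the eigenvectors \<open>Yseq\<close>, whose diagonal entry is 1. Their values are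
  never computed: the sign and the ratios of squares of \<open>\<kappa>\<close> suffice, and
  \<open>\<eta>\<close> cancels.\<close>

private definition "\<kappa> m = slice g M (Jv g [m, M - m]) m"
private definition "\<eta> k = hat M (slice g M (Sv g [k, M - k])) k"

private lemma abc: "0 < a" "0 < b" "0 < c"
  using g by (simp_all add: a_def b_def c_def)

private lemma kappa_nonzero: "m \<le> M \<Longrightarrow> \<kappa> m \<noteq> 0"
  using slice_Jv_diag_sign[OF g, of m M] by (auto simp: \<kappa>_def)

private lemma eta_nonzero: "k \<le> M \<Longrightarrow> \<eta> k \<noteq> 0"
  using hat_diag_nonzero[OF g, of k M] by (simp add: \<eta>_def)

private lemma slice_Sv_expansion:
  assumes "k \<le> M" "i \<le> M"
  shows "slice g M (Sv g [k, M - k]) i = (\<Sum>m\<le>M. u m k * \<kappa> m * Yseq b c m i)"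
proof -
  have "Sv g [k, M - k] = (\<lambda>x. \<Sum>m\<le>M. u m k * Jv g [m, M - m] x)"
    using Sv3_mixing[OF g assms(1)] by blast
  then have "slice g M (Sv g [k, M - k]) i = (\<Sum>m\<le>M. u m k * slice g M (Jv g [m, M - m]) i)"
    by (simp only: slice_sum)
  also have "\<dots> = (\<Sum>m\<le>M. u m k * \<kappa> m * Yseq b c m i)"
    unfolding \<kappa>_def b_def c_def mult.assoc
    by (intro sum.cong refl) (simp only: atMost_iff slice_Jv[OF g _ assms(2), symmetric])
  finally show ?thesis .
qed

private lemma slice_Sv_0:
  assumes "k \<le> M"
  shows "slice g M (Sv g [k, M - k]) 0 = u 0 k * \<kappa> 0"
proof -
  have "(\<Sum>m\<le>M. u m k * \<kappa> m * Yseq b c m 0) = (\<Sum>m\<in>{0}. u m k * \<kappa> m * Yseq b c m 0)"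
    by (intro sum.mono_neutral_right) (auto simp: Yseq_below)
  then show ?thesis using slice_Sv_expansion[OF assms, of 0] by simp
qed

private lemma mixing_bi_B:
  assumes "k \<le> M" "m \<le> M"
  shows "u m k * \<kappa> m = slice g M (Sv g [k, M - k]) 0 * (\<Prod>i<m. 2 / btau a M (Suc i))
    * bi_B a b c M m ((theta (a + b) k - 1/2) / 2)"
proof (rule expansion_bi_B[OF abc _ _ assms(2), where e = "\<lambda>m. u m k * \<kappa> m"])
  fix i assume "i \<le> M"
  then show "slice g M (Sv g [k, M - k]) i = (\<Sum>m\<le>M. u m k * \<kappa> m * Yseq b c m i)"
    by (rule slice_Sv_expansion[OF assms(1)])
  show "Useq a b M (slice g M (Sv g [k, M - k])) i = theta (a + b) k * slice g M (Sv g [k, M - k]) i"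
    unfolding a_def b_def using \<open>i \<le> M\<close> by (rule Useq_slice_Sv[OF g])
qed

text \<open>Both sides are the matrix element of \<open>\<Gamma>\<^bsub>12\<^esub>\<close> between neighbouring vectors, which is symmetric.\<close>

private lemma kappa_square:
  assumes "m < M"
  shows "btau a M (Suc m) * (\<kappa> (Suc m))\<^sup>2 = bc a b c M m * (\<kappa> m)\<^sup>2"
proof -
  let ?t = "theta (a + b)"
  define S where "S p q = (\<Sum>k\<le>M. ?t k * u p k * u q k)" for p q
  let ?up = "\<lambda>l k. if l < M then btau a M (Suc l) * \<kappa> (Suc l) * u (Suc l) k else 0"
  let ?dn = "\<lambda>l k. if l = 0 then 0 else bc a b c M (l - 1) * \<kappa> (l - 1) * u (l - 1) k"
  have rec: "?t k * (u l k * \<kappa> l) = ?up l k + balpha a b c M l * \<kappa> l * u l k + ?dn l k"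
    if k: "k \<le> M" and l: "l \<le> M" for k l
  proof -
    have ev: "Useq a b M (slice g M (Sv g [k, M - k])) i = ?t k * slice g M (Sv g [k, M - k]) i" if "i \<le> M" for i
      unfolding a_def b_def using that by (rule Useq_slice_Sv[OF g])
    have "(if l < M then btau a M (Suc l) * (u (Suc l) k * \<kappa> (Suc l)) else 0)
      = (?t k - balpha a b c M l) * (u l k * \<kappa> l) - (if l = 0 then 0 else bc a b c M (l - 1) * (u (l - 1) k * \<kappa> (l - 1)))"
      by (rule Useq_expansion[OF abc(2,3) slice_Sv_expansion[OF k] ev l])
    then show ?thesis by (cases "l < M"; cases "l = 0") (auto simp: algebra_simps)
  qed
  have S: "\<kappa> l * S l p = (\<Sum>k\<le>M. (?up l k + balpha a b c M l * \<kappa> l * u l k + ?dn l k) * u p k)"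
    if "l \<le> M" for l p
    unfolding S_def sum_distrib_left
  proof (intro sum.cong refl)
    fix k assume "k \<in> {..M}"
    then have k: "k \<le> M" by simp
    show "\<kappa> l * (?t k * u l k * u p k) = (?up l k + balpha a b c M l * \<kappa> l * u l k + ?dn l k) * u p k"
      unfolding rec[OF k that, symmetric] by (simp only: mult_ac)
  qed
  have rows: "(\<Sum>k\<le>M. x * u p k * u q k) = x * of_bool (p = q)" if "p \<le> M" "q \<le> M" for x p q
    using mixing_rows[OF g that] by (simp add: mult.assoc sum_distrib_left[symmetric])
  have up: "\<kappa> m * S m (Suc m) = btau a M (Suc m) * \<kappa> (Suc m)"
  proof -
    have "\<kappa> m * S m (Suc m) = (\<Sum>k\<le>M. btau a M (Suc m) * \<kappa> (Suc m) * u (Suc m) k * u (Suc m) k)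
      + (\<Sum>k\<le>M. balpha a b c M m * \<kappa> m * u m k * u (Suc m) k)
      + (\<Sum>k\<le>M. (if m = 0 then 0 else bc a b c M (m - 1) * \<kappa> (m - 1)) * u (m - 1) k * u (Suc m) k)"
      using S[of m "Suc m"] assms by (simp add: sum.distrib distrib_right)
    moreover have "m - Suc 0 \<noteq> Suc m" by arith
    ultimately show ?thesis using assms by (simp add: rows)
  qed
  have dn: "\<kappa> (Suc m) * S (Suc m) m = bc a b c M m * \<kappa> m"
  proof -
    have "\<kappa> (Suc m) * S (Suc m) m
      = (\<Sum>k\<le>M. (if Suc m < M then btau a M (Suc (Suc m)) * \<kappa> (Suc (Suc m)) else 0) * (if Suc m < M then u (Suc (Suc m)) k else 0) * u m k)
      + (\<Sum>k\<le>M. balpha a b c M (Suc m) * \<kappa> (Suc m) * u (Suc m) k * u m k)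
      + (\<Sum>k\<le>M. bc a b c M m * \<kappa> m * u m k * u m k)"
      using S[of "Suc m" m] assms by (simp add: sum.distrib distrib_right)
    also have "(\<Sum>k\<le>M. (if Suc m < M then btau a M (Suc (Suc m)) * \<kappa> (Suc (Suc m)) else 0) * (if Suc m < M then u (Suc (Suc m)) k else 0) * u m k) = 0"
      by (cases "Suc m < M") (simp_all add: rows)
    finally show ?thesis using assms by (simp add: rows)
  qed
  have "S (Suc m) m = S m (Suc m)" unfolding S_def by (simp add: mult_ac)
  then have "\<kappa> (Suc m) * (btau a M (Suc m) * \<kappa> (Suc m)) = \<kappa> m * (bc a b c M m * \<kappa> m)"
    unfolding up[symmetric] dn[symmetric] by (simp add: mult_ac)
  then show ?thesis by (simp add: power2_eq_square mult_ac)
qed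

text \<open>The overlap is computed twice. Expanding \<open>Jv\<close> with m = 0 in the
  \<open>Sv\<close> gives \<open>u 0 k * \<eta> k\<close> by polynomials of the problem with
  exchanged outer sites, at the eigenvalue \<open>theta (c + b) 0\<close>, that is at x = \<rho>_1.
  Entry 0 of the slice of \<open>Sv\<close> gives \<open>u 0 k * \<kappa> 0\<close>. In the product
  of the two equations \<open>\<eta> k * \<kappa> 0\<close> cancels.\<close>

private lemma mixing_0_square:
  assumes "k \<le> M"
  shows "(u 0 k)\<^sup>2 = mix_weight a b c M k"
proof -
  have pos': "0 < c" "0 < b" "0 < a" using abc by auto
  let ?z = "hat M (slice g M (Jv g [0, M - 0]))"
  have z: "?z j = (\<Sum>k\<le>M. u 0 k * \<eta> k * Yseq b a k j)" if j: "j \<le> M" for j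
  proof -
    have "Jv g [0, M - 0] = (\<lambda>x. \<Sum>k\<le>M. u 0 k * Sv g [k, M - k] x)"
      using Jv3_mixing[OF g le0] by blast
    then have "?z j = (\<Sum>k\<le>M. u 0 k * hat M (slice g M (Sv g [k, M - k])) j)"
      by (simp only: hat_def slice_sum) (simp add: sum_distrib_left mult_ac del: Sv.simps)
    also have "\<dots> = (\<Sum>k\<le>M. u 0 k * \<eta> k * Yseq b a k j)"
      unfolding \<eta>_def a_def b_def mult.assoc
      by (intro sum.cong refl) (simp only: atMost_iff hat_slice_Sv[OF g _ j, symmetric])
    finally show ?thesis .
  qed
  have slJ: "slice g M (Jv g [0, M - 0]) i = \<kappa> 0 * Yseq b c 0 i" if "i \<le> M" for i
    unfolding \<kappa>_def b_def c_def by (rule slice_Jv[OF g le0 that])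
  have ev: "Useq c b M ?z j = theta (c + b) 0 * ?z j" if j: "j \<le> M" for j
  proof -
    have "theta (b + c) (M - j) * slice g M (Jv g [0, M - 0]) (M - j) - sigma c (M - j) * slice g M (Jv g [0, M - 0]) (M - j - 1)
      = theta (b + c) 0 * slice g M (Jv g [0, M - 0]) (M - j)"
    proof -
      have "Gam (shift g) (Suc (Suc 0)) (\<lambda>r. Jv g [0, M - 0] ((M - (M - j)) # r)) [0, M - j]
          = theta (b + c) 0 * Jv g [0, M - 0] [M - (M - j), 0, M - j]"
        using Gam_shift_Jv[OF g, of 1 "[0, M - 0]" "[0, M - j]" "M - (M - j)"]
        by (simp add: theta_def b_def c_def add.assoc del: Jv.simps)
      then show ?thesis
        using slice_Gam23[OF g lower_op_Jv3[OF g], of "M - j" M 0 "M - 0"]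
        by (simp add: slice_def b_def c_def del: Jv.simps)
    qed
    then show ?thesis unfolding Useq_hat[OF j] by (simp add: hat_def add.commute del: Jv.simps)
  qed
  have "u 0 k * \<eta> k = ?z 0 * (\<Prod>i<k. 2 / btau c M (Suc i)) * bi_B c b a M k ((theta (c + b) 0 - 1/2) / 2)"
    by (rule expansion_bi_B[OF pos' z ev assms]) 
  also have "(theta (c + b) 0 - 1/2) / 2 = (c + b - 1) / 2" by (simp add: theta_def)
  also have "bi_B c b a M k ((c + b - 1) / 2) = (\<Prod>i<k. bi_A c b a M i)" by (rule bi_B_at_rho1)
  also have "?z 0 = \<kappa> 0 * Yseq b c 0 M" unfolding hat_def using slJ[of M] by (simp del: Jv.simps)
  finally have A: "u 0 k * \<eta> k = \<kappa> 0 * Yseq b c 0 M * (\<Prod>i<k. 2 * bi_A c b a M i / btau c M (Suc i))"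
    by (simp add: prod_dividef prod.distrib mult_ac)
  have "u 0 k * \<kappa> 0 = ((-1) ^ Suc M) ^ M * hat M (slice g M (Sv g [k, M - k])) M"
    unfolding slice_Sv_0[OF assms, symmetric] hat_def by (simp add: mult.assoc[symmetric] power_mult_distrib[symmetric] power_add[symmetric] del: Sv.simps)
  also have "hat M (slice g M (Sv g [k, M - k])) M = \<eta> k * Yseq b a k M"
    unfolding \<eta>_def a_def b_def by (rule hat_slice_Sv[OF g assms le_refl])
  \<comment> \<open>The exponent M (M + 1) is even.\<close>
  also have "((-1) ^ Suc M) ^ M = (1::real)" by (simp add: power_mult[symmetric] del: power_Suc)
  finally have B: "u 0 k * \<kappa> 0 = \<eta> k * Yseq b a k M" by simp
  have "(u 0 k)\<^sup>2 * (\<eta> k * \<kappa> 0) = (u 0 k * \<eta> k) * (u 0 k * \<kappa> 0)"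
    by (simp add: power2_eq_square mult_ac)
  also have "\<dots> = mix_weight a b c M k * (\<eta> k * \<kappa> 0)"
    unfolding A B mix_weight_def by (simp add: mult_ac)
  finally show ?thesis using eta_nonzero[OF assms] kappa_nonzero[of 0] by simp
qed

lemma mixing_eq:
  assumes k: "k \<le> M" and m: "m \<le> M"
  shows "u m k = sqrt (mix_weight a b c M k / (\<Prod>i<m. bi_A a b c M i * bi_C a b c M (Suc i)))
    * bi_B a b c M m ((theta (a + b) k - 1/2) / 2)"
proof -
  \<comment> \<open>\<open>P\<close> is the prefactor of the polynomial. Its square follows from
    \<open>kappa_square\<close> and \<open>mixing_0_square\<close>; being positive, it is the square
    root of that.\<close>
  define P where "P = slice g M (Sv g [k, M - k]) 0 * (\<Prod>i<m. 2 / btau a M (Suc i)) / \<kappa> m"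
  have tau: "0 < (-1) ^ M * btau a M (Suc i)" if "i < m" for i
    using that m by (intro btau_sign abc) simp
  have "0 < P"
  proof -
    have "0 < slice g M (Sv g [k, M - k]) 0"
      using Sv3_corner[OF g k] by (simp add: slice_def slice_scale_def del: Sv.simps)
    moreover have "0 < (\<Prod>i<m. 2 / ((-1) ^ M * btau a M (Suc i)))"
      using tau by (intro prod_pos) simp
    moreover have "0 < (-1) ^ (M * m) * \<kappa> m"
      unfolding \<kappa>_def by (rule slice_Jv_diag_sign[OF g m])
    \<comment> \<open>A sign (-1)^M moves into each of the m factors \<open>btau\<close>, and their
      product (-1)^(M m) into \<open>\<kappa> m\<close>; then all factors are positive.\<close>
    moreover have "P = slice g M (Sv g [k, M - k]) 0 * (\<Prod>i<m. 2 / ((-1) ^ M * btau a M (Suc i))) / ((-1) ^ (M * m) * \<kappa> m)"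
      unfolding P_def by (cases "even M"; cases "even m") (simp_all add: prod_dividef prod_uminus del: Sv.simps)
    ultimately show ?thesis by (simp del: Sv.simps)
  qed
  have "(\<kappa> m)\<^sup>2 * (\<Prod>i<m. btau a M (Suc i)) = (\<kappa> 0)\<^sup>2 * (\<Prod>i<m. bc a b c M i)"
    using m
  proof (induction m)
    case (Suc m)
    have "(\<kappa> (Suc m))\<^sup>2 * (\<Prod>i<Suc m. btau a M (Suc i))
      = (btau a M (Suc m) * (\<kappa> (Suc m))\<^sup>2) * (\<Prod>i<m. btau a M (Suc i))"
      by (simp add: mult_ac)
    also have "btau a M (Suc m) * (\<kappa> (Suc m))\<^sup>2 = bc a b c M m * (\<kappa> m)\<^sup>2"
      using Suc.prems by (intro kappa_square) simp
    also have "bc a b c M m * (\<kappa> m)\<^sup>2 * (\<Prod>i<m. btau a M (Suc i))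
      = bc a b c M m * ((\<kappa> m)\<^sup>2 * (\<Prod>i<m. btau a M (Suc i)))" by (simp only: mult.assoc)
    also have "(\<kappa> m)\<^sup>2 * (\<Prod>i<m. btau a M (Suc i)) = (\<kappa> 0)\<^sup>2 * (\<Prod>i<m. bc a b c M i)"
      using Suc by simp
    finally show ?case by (simp add: mult_ac)
  qed simp
  moreover have t0: "(\<Prod>i<m. btau a M (Suc i)) \<noteq> 0"
  proof -
    have "btau a M (Suc i) \<noteq> 0" if "i < m" for i using tau[OF that] by auto
    then show ?thesis by simp
  qed
  ultimately have k2: "(\<kappa> m)\<^sup>2 = (\<kappa> 0)\<^sup>2 * (\<Prod>i<m. bc a b c M i) / (\<Prod>i<m. btau a M (Suc i))"
    by (simp add: field_simps)
  have AC: "(\<Prod>i<m. bi_A a b c M i * bi_C a b c M (Suc i)) = (\<Prod>i<m. btau a M (Suc i)) * (\<Prod>i<m. bc a b c M i) / 4 ^ m"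
  proof -
    have "(\<Prod>i<m. bi_A a b c M i * bi_C a b c M (Suc i)) = (\<Prod>i<m. btau a M (Suc i) * bc a b c M i / 4)"
      using m by (intro prod.cong refl) (simp add: bi_A_bi_C[OF abc(2,3), symmetric])
    then show ?thesis by (simp add: prod_dividef prod.distrib)
  qed
  have "P\<^sup>2 = (u 0 k * \<kappa> 0)\<^sup>2 * (2 ^ m / (\<Prod>i<m. btau a M (Suc i)))\<^sup>2 / (\<kappa> m)\<^sup>2"
    unfolding P_def slice_Sv_0[OF k] by (simp add: prod_dividef power_mult_distrib power_divide)
  also have "\<dots> = (u 0 k)\<^sup>2 / (\<Prod>i<m. bi_A a b c M i * bi_C a b c M (Suc i))"
  proof -
    have four: "(4::real) ^ m = (2 ^ m)\<^sup>2"
      by (simp add: power2_eq_square flip: power_mult_distrib)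
    \<comment> \<open>For q = 0 both sides are 0, since division by 0 gives 0.\<close>
    have "(x * y)\<^sup>2 * (p / t)\<^sup>2 / (y\<^sup>2 * q / t) = x\<^sup>2 / (t * q / p\<^sup>2)" if "y \<noteq> 0" "t \<noteq> 0" "p \<noteq> 0" for x y t q p :: real
      using that by (cases "q = 0") (simp_all add: power2_eq_square field_simps)
    from this[OF kappa_nonzero[OF le0] t0] show ?thesis unfolding k2 AC four by simp
  qed
  finally have "P = sqrt (mix_weight a b c M k / (\<Prod>i<m. bi_A a b c M i * bi_C a b c M (Suc i)))"
    unfolding mixing_0_square[OF k, symmetric]
    using \<open>0 < P\<close> by (intro real_sqrt_unique[symmetric]) simp_all
  moreover have "u m k = P * bi_B a b c M m ((theta (a + b) k - 1/2) / 2)"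
    using mixing_bi_B[OF k m] kappa_nonzero[OF m] unfolding P_def by (simp add: field_simps)
  ultimately show ?thesis by simp
qed

end

section \<open>Weights and norms\<close>

definition bi_weight :: "real \<Rightarrow> real \<Rightarrow> real \<Rightarrow> nat \<Rightarrow> nat \<Rightarrow> real" where
  "bi_weight a b c M = weight1 ((a + b - 1) / 2) (par_x a b c M + (2 * c - 1) / 4) (par_x a b c M - (2 * c - 1) / 4) ((a - b) / 2)"

definition bi_norm :: "real \<Rightarrow> real \<Rightarrow> real \<Rightarrow> nat \<Rightarrow> nat \<Rightarrow> real" where
  "bi_norm a b c M = norm1 ((a + b - 1) / 2) (par_x a b c M + (2 * c - 1) / 4) (par_x a b c M - (2 * c - 1) / 4) ((a - b) / 2) M"

lemma par_x_even: "par_x a b c (2 * e) = (2 * real e + a + b + c - 1/2) / 2"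
  and par_x_odd: "par_x a b c (Suc (2 * e)) = - (2 * real e + a + b + c + 1/2) / 2"
  by (simp_all add: par_x_def field_simps)

section \<open>Norms and weights for each parity\<close>

lemma bi_norm_even:
  assumes "p \<le> 1"
  shows "bi_norm a b c (2 * e) (2 * d + p) = fact e * fact d / fact (e - d - p)
    * (pochhammer (b + c + real d) (e - d) / pochhammer (c + real d + real p) (e - d - p))
    * (pochhammer (a + b) e * pochhammer (real e + b + c) (d + p)
       / (pochhammer a (e - d) * (pochhammer (b + c + real d) (d + p))\<^sup>2))
    * pochhammer b (d + p) * pochhammer (real e + a + b + c) d"
proof -
  have dm: "2 * e div 2 = e" "2 * e mod 2 = 0" "(2 * d + p) div 2 = d" "(2 * d + p) mod 2 = p"
    using assms by auto
  let ?X = "(2 * real e + a + b + c - 1/2) / 2"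
  have ar: "(a + b - 1) / 2 + (?X + (2 * c - 1) / 4) - (?X - (2 * c - 1) / 4) - (a - b) / 2 + real d + 1 = b + c + real d"
    "?X + (2 * c - 1) / 4 - (?X - (2 * c - 1) / 4) + real d + real p + 1/2 = c + real d + real p"
    "2 * ((a + b - 1) / 2) + 1 = a + b"
    "real 0 * ((a + b - 1) / 2 - (?X + (2 * c - 1) / 4) - (?X - (2 * c - 1) / 4) + (a - b) / 2)
       + (?X + (2 * c - 1) / 4) - (a - b) / 2 + 1/2 = real e + b + c"
    "(a + b - 1) / 2 + (a - b) / 2 + 1/2 = a"
    "(a + b - 1) / 2 - (a - b) / 2 + 1/2 = b"
    "- real 0 * ((a + b - 1) / 2 + (?X + (2 * c - 1) / 4) + (?X - (2 * c - 1) / 4) + (a - b) / 2)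
       + (a + b - 1) / 2 + (?X + (2 * c - 1) / 4) + 1 = real e + a + b + c"
    by (simp_all add: field_simps)
  show ?thesis
    unfolding bi_norm_def norm1_def Let_def dm par_x_even ar by simp
qed

lemma bi_norm_odd:
  assumes "p \<le> 1"
  shows "bi_norm a b c (Suc (2 * e)) (2 * d + p) = fact e * fact d / fact (e - d)
    * (pochhammer (b + c + real d) (e + 1 - d) / pochhammer (c + real d + real p) (e + 1 - d - p))
    * (pochhammer (a + b) (e + 1) * pochhammer (real e + a + b + c) (d + p)
       / (pochhammer a (e - d + (1 - p)) * (pochhammer (b + c + real d) (d + p))\<^sup>2))
    * pochhammer b (d + p) * pochhammer (real e + 1 + b + c) d"
proof -
  have dm: "Suc (2 * e) div 2 = e" "Suc (2 * e) mod 2 = 1" "(2 * d + p) div 2 = d" "(2 * d + p) mod 2 = p"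
    using assms by auto
  let ?X = "- (2 * real e + a + b + c + 1/2) / 2"
  have ar: "(a + b - 1) / 2 + (?X + (2 * c - 1) / 4) - (?X - (2 * c - 1) / 4) - (a - b) / 2 + real d + 1 = b + c + real d"
    "?X + (2 * c - 1) / 4 - (?X - (2 * c - 1) / 4) + real d + real p + 1/2 = c + real d + real p"
    "2 * ((a + b - 1) / 2) + 1 = a + b"
    "real 1 * ((a + b - 1) / 2 - (?X + (2 * c - 1) / 4) - (?X - (2 * c - 1) / 4) + (a - b) / 2)
       + (?X + (2 * c - 1) / 4) - (a - b) / 2 + 1/2 = real e + a + b + c"
    "(a + b - 1) / 2 + (a - b) / 2 + 1/2 = a"
    "(a + b - 1) / 2 - (a - b) / 2 + 1/2 = b"
    "- real 1 * ((a + b - 1) / 2 + (?X + (2 * c - 1) / 4) + (?X - (2 * c - 1) / 4) + (a - b) / 2)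
       + (a + b - 1) / 2 + (?X + (2 * c - 1) / 4) + 1 = real e + 1 + b + c"
    by (simp_all add: field_simps)
  show ?thesis
    unfolding bi_norm_def norm1_def Let_def dm par_x_odd ar by simp
qed

lemma bi_weight_even:
  assumes "p \<le> 1"
  shows "bi_weight a b c (2 * e) (2 * j + p) = (-1) ^ p *
    (pochhammer (real e + a + b + c) j * pochhammer (- real e) (j + p) * pochhammer b (j + p) * pochhammer (a + b) j)
    / (fact j * pochhammer a (j + p) * pochhammer (real e + a + b) (j + p) * pochhammer (1 - real e - c) j)"
proof -
  have dm: "(2 * j + p) div 2 = j" "(2 * j + p) mod 2 = p" using assms by auto
  let ?X = "(2 * real e + a + b + c - 1/2) / 2"
  have ar: "(a + b - 1) / 2 + (?X + (2 * c - 1) / 4) + 1 = real e + a + b + c"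
    "(a + b - 1) / 2 - (?X - (2 * c - 1) / 4) + 1/2 = - real e"
    "(a + b - 1) / 2 - (a - b) / 2 + 1/2 = b"
    "2 * ((a + b - 1) / 2) + 1 = a + b"
    "(a + b - 1) / 2 + (a - b) / 2 + 1/2 = a"
    "(a + b - 1) / 2 + (?X - (2 * c - 1) / 4) + 1/2 = real e + a + b"
    "(a + b - 1) / 2 - (?X + (2 * c - 1) / 4) + 1 = 1 - real e - c"
    by (simp_all add: field_simps)
  show ?thesis unfolding bi_weight_def weight1_def Let_def dm par_x_even ar ..
qed

lemma bi_weight_odd:
  assumes "p \<le> 1"
  shows "bi_weight a b c (Suc (2 * e)) (2 * j + p) = (-1) ^ p *
    (pochhammer (- real e) j * pochhammer (real e + a + b + c) (j + p) * pochhammer b (j + p) * pochhammer (a + b) j)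
    / (fact j * pochhammer a (j + p) * pochhammer (- real e - c) (j + p) * pochhammer (real e + 1 + a + b) j)"
proof -
  have dm: "(2 * j + p) div 2 = j" "(2 * j + p) mod 2 = p" using assms by auto
  let ?X = "- (2 * real e + a + b + c + 1/2) / 2"
  have ar: "(a + b - 1) / 2 + (?X + (2 * c - 1) / 4) + 1 = - real e"
    "(a + b - 1) / 2 - (?X - (2 * c - 1) / 4) + 1/2 = real e + a + b + c"
    "(a + b - 1) / 2 - (a - b) / 2 + 1/2 = b"
    "2 * ((a + b - 1) / 2) + 1 = a + b"
    "(a + b - 1) / 2 + (a - b) / 2 + 1/2 = a"
    "(a + b - 1) / 2 + (?X - (2 * c - 1) / 4) + 1/2 = - real e - c"
    "(a + b - 1) / 2 - (?X + (2 * c - 1) / 4) + 1 = real e + 1 + a + b"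
    by (simp_all add: field_simps)
  show ?thesis unfolding bi_weight_def weight1_def Let_def dm par_x_odd ar ..
qed

lemmas pochhammer_arith = add.assoc[symmetric] diff_zero add_0_right of_nat_0 of_nat_1 fact_Suc
  Suc_eq_plus1[symmetric] diff_Suc_1 diff_Suc_Suc diff_self_eq_0

text \<open>The lengths of the Pochhammer symbols are aligned by an auxiliary q, and the symbols
  common to both sides are named, which leaves an identity of rational functions. The other three
  parities are treated alike.\<close>

lemma bi_norm_step_even_even:
  assumes "0 < a" "0 < b" "0 < c" "d < e"
  shows "bi_norm a b c (2 * e) (Suc (2 * d)) = bi_norm a b c (2 * e) (2 * d)
    * ((real e - real d) * (c + real d) * (real e + b + c + real d) * (b + real d) / (b + c + 2 * real d)\<^sup>2)"
proof -
  obtain q where e: "e = Suc (d + q)" using assms(4) by (auto simp: less_iff_Suc_add)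
  have q: "e - d = Suc q" "e - d - 1 = q" "real e - real d = real (Suc q)" using e by auto
  have nz: "pochhammer (c + real d + 1) q \<noteq> 0" "c + real d \<noteq> 0" "b + c + 2 * real d \<noteq> 0"
    using assms pochhammer_pos[of "c + real d + 1" q] by (auto simp: add_pos_nonneg)
  have s: "real (Suc d) = real d + 1" "b + c + real d + real d = b + c + 2 * real d"
    "b + c + real d + 1 + real d = b + c + 2 * real d + 1"
    "fact (Suc d) = (real d + 1) * fact d" "fact (Suc q) = real (Suc q) * fact q" by simp_all
  define P1 where "P1 = pochhammer (c + real d + 1) q"
  define P2 where "P2 = pochhammer (real e + b + c) d"
  define P3 where "P3 = pochhammer (b + c + real d) d"
  define P4 where "P4 = pochhammer b d"
  have "bi_norm a b c (2 * e) (2 * d + 1) = fact e * fact d / fact q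
    * (pochhammer (b + c + real d) (Suc q) / P1)
    * (pochhammer (a + b) e * (P2 * (real e + b + c + real d))
       / (pochhammer a (Suc q) * (P3 * (b + c + 2 * real d))\<^sup>2))
    * (P4 * (b + real d)) * pochhammer (real e + a + b + c) d"
    by (subst bi_norm_even, simp, simp only: pochhammer_arith q s P1_def P2_def P3_def P4_def
        pochhammer_Suc[of "b + c + real d" d] pochhammer_Suc[of b d] pochhammer_Suc[of "real e + b + c" d])
  moreover have "bi_norm a b c (2 * e) (2 * d + 0) = fact e * fact d / (real (Suc q) * fact q)
    * (pochhammer (b + c + real d) (Suc q) / ((c + real d) * P1))
    * (pochhammer (a + b) e * P2 / (pochhammer a (Suc q) * P3\<^sup>2))
    * P4 * pochhammer (real e + a + b + c) d"
    by (subst bi_norm_even, simp, simp only: pochhammer_arith q s P1_def P2_def P3_def P4_def pochhammer_rec[of "c + real d" q])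
  ultimately show ?thesis using nz q by (simp add: power_mult_distrib mult_ac)
qed

lemma bi_norm_step_even_odd:
  assumes "0 < a" "0 < b" "0 < c" "d < e"
  shows "bi_norm a b c (2 * e) (2 * Suc d) = bi_norm a b c (2 * e) (Suc (2 * d))
    * ((real d + 1) * (b + c + real d) * (a + real e - real d - 1) * (real e + a + b + c + real d) / (b + c + 2 * real d + 1)\<^sup>2)"
proof -
  obtain q where e: "e = Suc (d + q)" using assms(4) by (auto simp: less_iff_Suc_add)
  have q: "e - d = Suc q" "e - d - 1 = q" "e - Suc d = q" "a + real e - real d - 1 = a + real q" using e by auto
  have nz: "b + c + real d \<noteq> 0" "b + c + 2 * real d + 1 \<noteq> 0" "a + real q \<noteq> 0"
    "pochhammer (b + c + real d + 1) d \<noteq> 0"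
    using assms pochhammer_pos[of "b + c + real d + 1" d] by (auto simp: add_pos_nonneg)
  have s: "real (Suc d) = real d + 1" "b + c + real d + real d = b + c + 2 * real d"
    "b + c + real d + 1 + real d = b + c + 2 * real d + 1"
    "fact (Suc d) = (real d + 1) * fact d" "fact (Suc q) = real (Suc q) * fact q" by simp_all
  define P1 where "P1 = pochhammer (b + c + real d + 1) q"
  define P2 where "P2 = pochhammer (real e + b + c) (Suc d)"
  define P3 where "P3 = pochhammer (b + c + real d + 1) d"
  define P4 where "P4 = pochhammer b (Suc d)"
  define P5 where "P5 = pochhammer (real e + a + b + c) d"
  define P6 where "P6 = pochhammer (c + real d + 1) q"
  define P7 where "P7 = pochhammer a q"
  have B: "bi_norm a b c (2 * e) (2 * d + 1) = fact e * fact d / fact q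
    * ((b + c + real d) * P1 / P6)
    * (pochhammer (a + b) e * P2 / (P7 * (a + real q) * ((b + c + real d) * P3)\<^sup>2)) * P4 * P5"
    by (subst bi_norm_even, simp, simp only: pochhammer_arith q s P1_def P2_def P3_def P4_def P5_def P6_def P7_def
        pochhammer_Suc[of a q] pochhammer_rec[of "b + c + real d"])
  have A: "bi_norm a b c (2 * e) (2 * Suc d + 0) = fact e * ((real d + 1) * fact d) / fact q
    * (P1 / P6)
    * (pochhammer (a + b) e * P2 / (P7 * (P3 * (b + c + 2 * real d + 1))\<^sup>2)) * P4 * (P5 * (real e + a + b + c + real d))"
    by (subst bi_norm_even, simp, simp only: pochhammer_arith q s P1_def P2_def P3_def P4_def P5_def P6_def P7_def
        pochhammer_Suc[of "b + c + real d + 1" d] pochhammer_Suc[of "real e + a + b + c" d])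
  have gen: "F * (k * G) / f * (p1 / p6) * (A * p2 / (p7 * (p3 * D)\<^sup>2)) * p4 * (p5 * Y)
      = (F * G / f * (x * p1 / p6) * (A * p2 / (p7 * z * (x * p3)\<^sup>2)) * p4 * p5) * (k * x * z * Y / D\<^sup>2)"
    if "x \<noteq> 0" "z \<noteq> 0" "D \<noteq> 0" "p3 \<noteq> 0" "f \<noteq> 0" "p6 \<noteq> 0" "p7 \<noteq> 0"
    for F k G f p1 p2 p3 p4 p5 p6 p7 A D Y x z :: real
    using that by (simp add: divide_simps) (simp add: power2_eq_square)
  have "P6 \<noteq> 0" "P7 \<noteq> 0"
    unfolding P6_def P7_def using assms by (intro pochhammer_pos[THEN less_imp_neq, THEN not_sym]; simp add: add_pos_nonneg)+
  moreover have "P3 \<noteq> 0" unfolding P3_def using nz by simp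
  moreover have "fact q \<noteq> (0::real)" "a + real q \<noteq> 0" using nz by simp_all
  ultimately show ?thesis unfolding A[unfolded add_0_right, folded Suc_eq_plus1] B[folded Suc_eq_plus1] q
    using nz by (intro gen)
qed

lemma bi_norm_step_odd_even:
  assumes "0 < a" "0 < b" "0 < c" "d \<le> e"
  shows "bi_norm a b c (Suc (2 * e)) (Suc (2 * d)) = bi_norm a b c (Suc (2 * e)) (2 * d)
    * ((c + real d) * (real e + a + b + c + real d) * (a + real e - real d) * (b + real d) / (b + c + 2 * real d)\<^sup>2)"
proof -
  obtain q where e: "e = d + q" using assms(4) by (auto simp: le_iff_add)
  have q: "e - d = q" "e + 1 - d = Suc q" "e + 1 - d - 1 = q" "Suc e - d = Suc q" "a + real e - real d = a + real q" using e by auto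
  have nz: "pochhammer (c + real d + 1) q \<noteq> 0" "c + real d \<noteq> 0" "b + c + 2 * real d \<noteq> 0" "a + real q \<noteq> 0"
    using assms pochhammer_pos[of "c + real d + 1" q] by (auto simp: add_pos_nonneg)
  have s: "real (Suc d) = real d + 1" "b + c + real d + real d = b + c + 2 * real d"
    "b + c + real d + 1 + real d = b + c + 2 * real d + 1"
    "fact (Suc d) = (real d + 1) * fact d" "fact (Suc q) = real (Suc q) * fact q" by simp_all
  define P1 where "P1 = pochhammer (c + real d + 1) q"
  define P2 where "P2 = pochhammer (real e + a + b + c) d"
  define P3 where "P3 = pochhammer (b + c + real d) d"
  define P4 where "P4 = pochhammer b d"
  define P5 where "P5 = pochhammer a q"
  have "bi_norm a b c (Suc (2 * e)) (2 * d + 1) = fact e * fact d / fact q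
    * (pochhammer (b + c + real d) (Suc q) / P1)
    * (pochhammer (a + b) (e + 1) * (P2 * (real e + a + b + c + real d))
       / (P5 * (P3 * (b + c + 2 * real d))\<^sup>2))
    * (P4 * (b + real d)) * pochhammer (real e + 1 + b + c) d"
    by (subst bi_norm_odd, simp, simp only: pochhammer_arith q s P1_def P2_def P3_def P4_def P5_def
        pochhammer_Suc[of "b + c + real d" d] pochhammer_Suc[of b d] pochhammer_Suc[of "real e + a + b + c" d])
  moreover have "bi_norm a b c (Suc (2 * e)) (2 * d + 0) = fact e * fact d / fact q
    * (pochhammer (b + c + real d) (Suc q) / ((c + real d) * P1))
    * (pochhammer (a + b) (e + 1) * P2 / (P5 * (a + real q) * P3\<^sup>2))
    * P4 * pochhammer (real e + 1 + b + c) d"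
    by (subst bi_norm_odd, simp, simp only: pochhammer_arith q s P1_def P2_def P3_def P4_def P5_def pochhammer_rec[of "c + real d" q]
        pochhammer_Suc[of a q])
  ultimately show ?thesis unfolding q(5) using nz by (simp add: power_mult_distrib mult_ac)
qed

lemma bi_norm_step_odd_odd:
  assumes "0 < a" "0 < b" "0 < c" "d < e"
  shows "bi_norm a b c (Suc (2 * e)) (2 * Suc d) = bi_norm a b c (Suc (2 * e)) (Suc (2 * d))
    * ((real d + 1) * (real e - real d) * (b + c + real d) * (real e + 1 + b + c + real d) / (b + c + 2 * real d + 1)\<^sup>2)"
proof -
  obtain q where e: "e = Suc (d + q)" using assms(4) by (auto simp: less_iff_Suc_add)
  have q: "e - d = Suc q" "Suc e - d = Suc (Suc q)" "e + 1 - d = Suc (Suc q)" "e - Suc d = q" "e + 1 - d - 1 = Suc q" "e + 1 - Suc d = Suc q"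
    "real e - real d = real (Suc q)" using e by auto
  have nz: "b + c + real d \<noteq> 0" "b + c + 2 * real d + 1 \<noteq> 0" "pochhammer (b + c + real d + 1) d \<noteq> 0"
    using assms pochhammer_pos[of "b + c + real d + 1" d] by (auto simp: add_pos_nonneg)
  have s: "real (Suc d) = real d + 1" "b + c + real d + real d = b + c + 2 * real d"
    "b + c + real d + 1 + real d = b + c + 2 * real d + 1"
    "fact (Suc d) = (real d + 1) * fact d" "fact (Suc q) = real (Suc q) * fact q" by simp_all
  define P1 where "P1 = pochhammer (b + c + real d + 1) (Suc q)"
  define P2 where "P2 = pochhammer (real e + a + b + c) (Suc d)"
  define P3 where "P3 = pochhammer (b + c + real d + 1) d"
  define P4 where "P4 = pochhammer b (Suc d)"
  define P5 where "P5 = pochhammer (real e + 1 + b + c) d"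
  define P6 where "P6 = pochhammer (c + real d + 1) (Suc q)"
  define P7 where "P7 = pochhammer a (Suc q)"
  have B: "bi_norm a b c (Suc (2 * e)) (2 * d + 1) = fact e * fact d / (real (Suc q) * fact q)
    * ((b + c + real d) * P1 / P6)
    * (pochhammer (a + b) (e + 1) * P2 / (P7 * ((b + c + real d) * P3)\<^sup>2)) * P4 * P5"
    by (subst bi_norm_odd, simp, simp only: pochhammer_arith q s P1_def P2_def P3_def P4_def P5_def P6_def P7_def
        pochhammer_rec[of "b + c + real d"])
  have A: "bi_norm a b c (Suc (2 * e)) (2 * Suc d + 0) = fact e * ((real d + 1) * fact d) / fact q
    * (P1 / P6)
    * (pochhammer (a + b) (e + 1) * P2 / (P7 * (P3 * (b + c + 2 * real d + 1))\<^sup>2)) * P4 * (P5 * (real e + 1 + b + c + real d))"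
    by (subst bi_norm_odd, simp, simp only: pochhammer_arith q s P1_def P2_def P3_def P4_def P5_def P6_def P7_def
        pochhammer_Suc[of "b + c + real d + 1" d] pochhammer_Suc[of "real e + 1 + b + c" d])
  have gen: "F * (k * G) / f * (p1 / p6) * (A * p2 / (p7 * (p3 * D)\<^sup>2)) * p4 * (p5 * Y)
      = (F * G / (z * f) * (x * p1 / p6) * (A * p2 / (p7 * (x * p3)\<^sup>2)) * p4 * p5) * (k * z * x * Y / D\<^sup>2)"
    if "x \<noteq> 0" "z \<noteq> 0" "D \<noteq> 0" "p3 \<noteq> 0" "f \<noteq> 0" "p6 \<noteq> 0" "p7 \<noteq> 0"
    for F k G f p1 p2 p3 p4 p5 p6 p7 A D Y x z :: real
    using that by (simp add: divide_simps) (simp add: power2_eq_square)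
  have "P6 \<noteq> 0" "P7 \<noteq> 0"
    unfolding P6_def P7_def using assms by (intro pochhammer_pos[THEN less_imp_neq, THEN not_sym]; simp add: add_pos_nonneg)+
  moreover have "P3 \<noteq> 0" unfolding P3_def using nz by simp
  moreover have "fact q \<noteq> (0::real)" "real (Suc q) \<noteq> 0" using nz by simp_all
  ultimately show ?thesis unfolding A[unfolded add_0_right, folded Suc_eq_plus1] B[folded Suc_eq_plus1] q
    using nz by (intro gen)
qed

text \<open>As for every monic orthogonal family, the quotient of successive squared norms is the
  coefficient of the lower neighbour in the three-term recurrence, here A_m C_{m+1}. It is verified
  in each of the four parity classes.\<close>

lemma bi_norm_Suc:
  assumes pos: "0 < a" "0 < b" "0 < c" and m: "m < M"
  shows "bi_norm a b c M (Suc m) = bi_norm a b c M m * (bi_A a b c M m * bi_C a b c M (Suc m))"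
proof -
  obtain e where e: "M = 2 * e \<or> M = Suc (2 * e)" by (metis evenE oddE add_0_right add_Suc_right One_nat_def)
  obtain d where d: "m = 2 * d \<or> m = Suc (2 * d)" by (metis evenE oddE add_0_right add_Suc_right One_nat_def)
  have nz: "b + c + 2 * real d \<noteq> 0" "b + c + 2 * real d + 1 \<noteq> 0" using pos by (auto simp: add_pos_nonneg)
  consider "M = 2 * e" "m = 2 * d" | "M = 2 * e" "m = Suc (2 * d)"
    | "M = Suc (2 * e)" "m = 2 * d" | "M = Suc (2 * e)" "m = Suc (2 * d)" using e d by blast
  then show ?thesis
  proof cases
    case 1
    then have "d < e" using m by simp
    have "bi_A a b c M m = - ((real e - real d) * (b + real d) / (b + c + 2 * real d))"
      unfolding 1 using nz by (simp add: bi_A_cases field_simps)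
    moreover have "bi_C a b c M (Suc m) = - ((real e + b + c + real d) * (c + real d) / (b + c + 2 * real d))"
      unfolding 1 using nz by (simp add: bi_C_cases field_simps)
    ultimately show ?thesis using bi_norm_step_even_even[OF pos \<open>d < e\<close>] 1 by (simp add: power2_eq_square mult_ac)
  next
    case 2
    then have "d < e" using m by simp
    have "bi_A a b c M m = (b + c + real d) * (real e + a + b + c + real d) / (b + c + 2 * real d + 1)"
      unfolding 2 using nz by (simp add: bi_A_cases field_simps)
    moreover have "bi_C a b c M (Suc m) = (real d + 1) * (a + real e - real d - 1) / (b + c + 2 * real d + 1)"
      unfolding 2 using nz by (simp add: bi_C_cases field_simps)
    ultimately show ?thesis using bi_norm_step_even_odd[OF pos \<open>d < e\<close>] 2 by (simp add: power2_eq_square mult_ac)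
  next
    case 3
    then have "d \<le> e" using m by simp
    have "bi_A a b c M m = (real e + a + b + c + real d) * (b + real d) / (b + c + 2 * real d)"
      unfolding 3 using nz by (simp add: bi_A_cases field_simps)
    moreover have "bi_C a b c M (Suc m) = (a + real e - real d) * (c + real d) / (b + c + 2 * real d)"
      unfolding 3 using nz by (simp add: bi_C_cases field_simps)
    ultimately show ?thesis using bi_norm_step_odd_even[OF pos \<open>d \<le> e\<close>] 3 by (simp add: power2_eq_square mult_ac)
  next
    case 4
    then have "d < e" using m by simp
    have "bi_A a b c M m = - ((b + c + real d) * (real e - real d) / (b + c + 2 * real d + 1))"
      unfolding 4 using nz by (simp add: bi_A_cases field_simps)
    moreover have "bi_C a b c M (Suc m) = - ((real d + 1) * (real e + 1 + b + c + real d) / (b + c + 2 * real d + 1))"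
      unfolding 4 using nz by (simp add: bi_C_cases field_simps)
    ultimately show ?thesis using bi_norm_step_odd_odd[OF pos \<open>d < e\<close>] 4 by (simp add: power2_eq_square mult_ac)
  qed
qed

lemma bi_norm_prod:
  assumes "0 < a" "0 < b" "0 < c"
  shows "m \<le> M \<Longrightarrow> bi_norm a b c M m = bi_norm a b c M 0 * (\<Prod>i<m. bi_A a b c M i * bi_C a b c M (Suc i))"
  by (induction m) (simp_all add: bi_norm_Suc[OF assms])

text \<open>A positive even index i repeats the preceding entry, since
  \<open>sigma c i = bD (b + c) 0 i\<close>; each odd step contributes one factor -(c + k) / (b + c
  + k).\<close>

lemma bY_0_cases:
  assumes "0 < b" "0 < c"
  shows "bY b c 0 (2 * e) = (-1) ^ e * pochhammer c e / pochhammer (b + c) e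
    \<and> bY b c 0 (Suc (2 * e)) = (-1) ^ Suc e * pochhammer c (Suc e) / pochhammer (b + c) (Suc e)"
proof -
  have odd: "bY b c 0 (Suc (2 * k)) = - (c + real k) / (b + c + real k) * bY b c 0 (2 * k)" for k
  proof -
    have "sigma c (Suc (2 * k)) = 2 * (c + real k)" by (simp add: sigma_odd)
    moreover have "bD (b + c) 0 (Suc (2 * k)) = 2 * - (b + c + real k)" by (simp add: bD_def)
    moreover have "2 * x / (2 * - y) = - x / y" for x y :: real by (simp only: mult_divide_mult_cancel_left_if) simp
    ultimately show ?thesis
      by (simp only: bY.simps power_0 mult_1_left add_0_left)
  qed
  show ?thesis
  proof (induction e)
    case 0
    then show ?case using odd[of 0] by simp
  next
    case (Suc e)
    have "bY b c 0 (2 * Suc e) = bY b c 0 (Suc (2 * e))"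
      by (simp add: bD_def sigma_even)
    then have A: "bY b c 0 (2 * Suc e) = (-1) ^ Suc e * pochhammer c (Suc e) / pochhammer (b + c) (Suc e)"
      by (rule trans) (rule conjunct2[OF Suc])
    have "bY b c 0 (Suc (2 * Suc e)) = - (c + real (Suc e)) / (b + c + real (Suc e)) * ((-1) ^ Suc e * pochhammer c (Suc e) / pochhammer (b + c) (Suc e))"
      unfolding odd A ..
    also have "\<dots> = (-1) ^ Suc (Suc e) * pochhammer c (Suc (Suc e)) / pochhammer (b + c) (Suc (Suc e))"
    proof -
      have "- x / y * (s * p / q) = - s * (p * x) / (q * y)" for x y s p q :: real
        by (simp add: mult_ac)
      then show ?thesis
        unfolding pochhammer_Suc[of c "Suc e"] pochhammer_Suc[of "b + c" "Suc e"] power_Suc[of "-1" "Suc e"] mult_minus1 .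
    qed
    finally show ?case using A by blast
  qed
qed

text \<open>The two eigenvectors have the same sign at their last entry, so the signs cancel and
  only quotients of Pochhammer symbols are compared.\<close>

lemma mix_weight_0:
  assumes "0 < a" "0 < b" "0 < c"
  shows "mix_weight a b c M 0 = bi_weight a b c M 0 / bi_norm a b c M 0"
proof -
  obtain e where e: "M = 2 * e \<or> M = Suc (2 * e)" by (metis evenE oddE add_0_right add_Suc_right One_nat_def)
  have sg: "(-1) ^ n * x * ((-1) ^ n * y) = x * y" for n and x y :: real
    by (cases "even n") simp_all
  have "(-1) ^ n * x / p * ((-1) ^ n * y / q) = x * y / (p * q)" for n and x y p q :: real
    using sg[of n x y] by simp
  note sg' = this
  from e show ?thesis
  proof
    assume M: "M = 2 * e"
    have "bi_weight a b c M 0 = 1" using bi_weight_even[of 0 a b c e 0] M by simp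
    moreover have "bi_norm a b c M 0 = (pochhammer (b + c) e / pochhammer c e) * (pochhammer (a + b) e / pochhammer a e)"
      using bi_norm_even[of 0 a b c e 0] M by simp
    moreover have "mix_weight a b c M 0 = pochhammer a e * pochhammer c e / (pochhammer (b + a) e * pochhammer (b + c) e)"
      using bY_0_cases[OF assms(2,1), of e] bY_0_cases[OF assms(2,3), of e] M
      by (simp only: mix_weight_def Yseq_def not_less_zero if_False diff_zero lessThan_0 prod.empty mult_1_right sg')
    ultimately show ?thesis by (simp add: add.commute mult_ac)
  next
    assume M: "M = Suc (2 * e)"
    have "bi_weight a b c M 0 = 1" using bi_weight_odd[of 0 a b c e 0] M by simp
    moreover have "bi_norm a b c M 0 = (pochhammer (b + c) (Suc e) / pochhammer c (Suc e)) * (pochhammer (a + b) (Suc e) / pochhammer a (Suc e))"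
      using bi_norm_odd[of 0 a b c e 0] M by simp
    moreover have "mix_weight a b c M 0 = pochhammer a (Suc e) * pochhammer c (Suc e) / (pochhammer (b + a) (Suc e) * pochhammer (b + c) (Suc e))"
      using bY_0_cases[OF assms(2,1), of e] bY_0_cases[OF assms(2,3), of e] M
      by (simp only: mix_weight_def Yseq_def not_less_zero if_False diff_zero lessThan_0 prod.empty mult_1_right sg')
    ultimately show ?thesis by (simp add: add.commute mult_ac)
  qed
qed

text \<open>The last entry of the eigenvector changes with k as in \<open>bY_lower\<close>, and the
  product by one factor.\<close>

lemma mix_weight_Suc:
  assumes pos: "0 < a" "0 < b" "0 < c" and k: "k < M"
  shows "mix_weight a b c M (Suc k) = mix_weight a b c M k *
    (- 2 * bi_A c b a M k / (sigma c (M - k) * sigma a (Suc k) * bR (b + a) (Suc k) (M - Suc k)))"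
proof -
  define r where "r = M - Suc k"
  have r: "M - k = Suc r" "M = Suc (k + r)" using k by (auto simp: r_def)
  have s: "sigma c (Suc r) \<noteq> 0" "sigma a (Suc k) \<noteq> 0" using sigma_pos[OF pos(3), of r] sigma_pos[OF pos(1), of k] by auto
  have R: "bR (b + a) (Suc k) r \<noteq> 0" using pos by (intro bR_nonzero) simp
  have low: "Yseq b a k M = sigma a (Suc k) * (-1) ^ (k + r) * bR (b + a) (Suc k) r * Yseq b a (Suc k) M"
    using bY_lower[OF pos(2,1), of k r] r by (simp add: Yseq_def)
  have t: "btau c M (Suc k) = - ((-1) ^ (k + r) * sigma c (Suc r))"
    using r by (simp add: btau_def)
  have "(-1) ^ (k + r) * ((-1) ^ (k + r) * x) = x" for x :: real by (simp flip: mult.assoc power_add)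
  have gen: "y * z * (p * (2 * A / - (g * sc))) = sa * g * R * y * z * p * (- 2 * A / (sc * sa * R))"
    if "g * g = 1" "sc \<noteq> 0" "sa \<noteq> 0" "R \<noteq> 0" for y z p A g sc sa R :: real
  proof -
    have "g \<noteq> 0" using that(1) by auto
    have "y * z * (p * (2 * A / - (g * sc))) = - (2 * A * y * z * p) / (g * sc)" by simp
    also have "\<dots> = - (2 * A * y * z * p) * (g * g) / (g * sc)" using that(1) by simp
    also have "\<dots> = sa * g * R * y * z * p * (- 2 * A / (sc * sa * R))"
      using that \<open>g \<noteq> 0\<close> by (simp add: field_simps)
    finally show ?thesis .
  qed
  have "(-1) ^ (k + r) * (-1) ^ (k + r) = (1::real)" by (simp flip: power_add)
  from gen[OF this s R] show ?thesis
    unfolding mix_weight_def low r_def[symmetric] r(1) prod.lessThan_Suc t by blast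
qed

text \<open>The quotient is that of \<open>mix_weight_Suc\<close>, so both sequences agree up to a
  constant. In all four parity classes D = k + a + b and 2 E = \<open>sigma c (M - k)\<close>; the
  parameter c enters E and N exactly if M - k is odd.\<close>

lemma bi_weight_Suc:
  assumes pos: "0 < a" "0 < b" "0 < c" and k: "k < M"
  shows "bi_weight a b c M (Suc k) = bi_weight a b c M k *
    (- 2 * bi_A c b a M k / (sigma c (M - k) * sigma a (Suc k) * bR (b + a) (Suc k) (M - Suc k)))"
proof -
  obtain e where e: "M = 2 * e \<or> M = Suc (2 * e)" by (metis evenE oddE add_0_right add_Suc_right One_nat_def)
  obtain j where j: "k = 2 * j \<or> k = Suc (2 * j)" by (metis evenE oddE add_0_right add_Suc_right One_nat_def)
  have h: "real k + a + b \<noteq> 0" using pos by (intro of_nat_add_pos_nonzero)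
  have rk: "real (M - k) = real M - real k" "real (M - Suc k) = real M - real k - 1" using k by (auto simp: of_nat_diff)
  consider "M = 2 * e" "k = 2 * j" | "M = 2 * e" "k = Suc (2 * j)"
    | "M = Suc (2 * e)" "k = 2 * j" | "M = Suc (2 * e)" "k = Suc (2 * j)" using e j by blast
  then show ?thesis
  proof cases
    case 1
    then have "j < e" using k by simp
    define D where "D = a + b + 2 * real j"
    define E where "E = real e - real j"
    define N where "N = real e + a + b + real j"
    have nz: "E \<noteq> 0" "D \<noteq> 0" "a + real j \<noteq> 0" "N \<noteq> 0"
      unfolding D_def E_def N_def using \<open>j < e\<close> pos by (auto simp: add_nonneg_pos)
    have A: "bi_A c b a M k = - (E * (b + real j) / D)"
      unfolding 1 D_def E_def using nz(2)[unfolded D_def] by (simp add: bi_A_cases field_simps)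
    have S: "sigma c (M - k) = 2 * E" "sigma a (Suc k) = 2 * (a + real j)"
      unfolding 1 E_def using \<open>j < e\<close> by (simp_all add: sigma_even sigma_odd of_nat_diff)
    have R: "bR (b + a) (Suc k) (M - Suc k) = 2 * N / (2 * D * (2 * E))"
    proof -
      have "odd (M - Suc k)" using 1 \<open>j < e\<close> by auto
      moreover have "2 * real (Suc k) + real (M - Suc k) + 2 * (b + a) - 1 = 2 * N" "real (Suc k) + (b + a) - 1 = D"
        "real (M - Suc k) + 1 = 2 * E" unfolding rk D_def E_def N_def using 1 by simp_all
      ultimately show ?thesis by (simp only: bR_def if_False)
    qed
    have "bi_weight a b c M (Suc k) = - (bi_weight a b c M k * ((- real e + real j) * (b + real j) / ((a + real j) * N)))"
      using bi_weight_even[of 1 a b c e j] bi_weight_even[of 0 a b c e j] unfolding 1 N_def by (simp add: pochhammer_Suc mult_ac)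
    also have "- real e + real j = - E" by (simp add: E_def)
    finally have W: "bi_weight a b c M (Suc k) = bi_weight a b c M k * (E * (b + real j) / ((a + real j) * N))" by simp
    have "x * y / (z * t) = - 2 * - (x * y / d) / (2 * x * (2 * z) * (2 * t / (2 * d * (2 * x))))"
      if "x \<noteq> 0" "d \<noteq> 0" "z \<noteq> 0" "t \<noteq> 0" for x y z t d :: real
      using that by (simp add: field_simps)
    from this[OF nz] show ?thesis unfolding A S R W by (simp only:)
  next
    case 2
    then have "j < e" using k by simp
    define D where "D = a + b + 2 * real j + 1"
    define E where "E = real e - real j - 1 + c"
    define N where "N = real e + a + b + c + real j"
    have "real j + 1 \<le> real e" using \<open>j < e\<close> by linarith
    then have nz: "E \<noteq> 0" "D \<noteq> 0" "real j + 1 \<noteq> 0"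
      unfolding D_def E_def using pos by (auto simp: add_nonneg_pos)
    have A: "bi_A c b a M k = (a + b + real j) * N / D"
      unfolding 2 D_def N_def using nz(2)[unfolded D_def] by (simp add: bi_A_cases field_simps)
    have S: "sigma c (M - k) = 2 * E" "sigma a (Suc k) = 2 * (real j + 1)"
      unfolding 2 E_def using \<open>j < e\<close> by (simp_all add: sigma_even sigma_odd of_nat_diff)
    have R: "bR (b + a) (Suc k) (M - Suc k) = - (1 / (2 * D))"
    proof -
      have "even (M - Suc k)" using 2 \<open>j < e\<close> by auto
      moreover have "real (Suc k) + (b + a) - 1 = D" unfolding D_def using 2 by simp
      ultimately show ?thesis by (simp only: bR_def if_True)
    qed
    have "bi_weight a b c M (Suc k) = - (bi_weight a b c M k * (N * (a + b + real j) / ((real j + 1) * (1 - real e - c + real j))))"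
      using bi_weight_even[of 0 a b c e "Suc j"] bi_weight_even[of 1 a b c e j] unfolding 2 N_def by (simp add: pochhammer_Suc add_ac mult_ac)
    also have "1 - real e - c + real j = - E" by (simp add: E_def)
    finally have W: "bi_weight a b c M (Suc k) = bi_weight a b c M k * (N * (a + b + real j) / ((real j + 1) * E))" by simp
    have "t * y / (z * x) = - 2 * (y * t / d) / (2 * x * (2 * z) * - (1 / (2 * d)))"
      if "x \<noteq> 0" "d \<noteq> 0" "z \<noteq> 0" for x y z t d :: real
      using that by (simp add: field_simps)
    from this[OF nz] show ?thesis unfolding A S R W by (simp only:)
  next
    case 3
    then have "j \<le> e" using k by simp
    define D where "D = a + b + 2 * real j"
    define E where "E = real e - real j + c"
    define N where "N = real e + a + b + c + real j"
    have nz: "E \<noteq> 0" "D \<noteq> 0" "a + real j \<noteq> 0"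
      unfolding D_def E_def using \<open>j \<le> e\<close> pos by (auto simp: add_nonneg_pos)
    have A: "bi_A c b a M k = N * (b + real j) / D"
      unfolding 3 D_def N_def using nz(2)[unfolded D_def] by (simp add: bi_A_cases field_simps)
    have S: "sigma c (M - k) = 2 * E" "sigma a (Suc k) = 2 * (a + real j)"
      unfolding 3 E_def using \<open>j \<le> e\<close> by (simp_all add: sigma_even sigma_odd of_nat_diff Suc_diff_le)
    have R: "bR (b + a) (Suc k) (M - Suc k) = - (1 / (2 * D))"
    proof -
      have "even (M - Suc k)" using 3 \<open>j \<le> e\<close> by auto
      moreover have "real (Suc k) + (b + a) - 1 = D" unfolding D_def using 3 by simp
      ultimately show ?thesis by (simp only: bR_def if_True)
    qed
    have "bi_weight a b c M (Suc k) = - (bi_weight a b c M k * (N * (b + real j) / ((a + real j) * (- real e - c + real j))))"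
      using bi_weight_odd[of 1 a b c e j] bi_weight_odd[of 0 a b c e j] unfolding 3 N_def by (simp add: pochhammer_Suc add_ac mult_ac)
    also have "- real e - c + real j = - E" by (simp add: E_def)
    finally have W: "bi_weight a b c M (Suc k) = bi_weight a b c M k * (N * (b + real j) / ((a + real j) * E))" by simp
    have "t * y / (z * x) = - 2 * (t * y / d) / (2 * x * (2 * z) * - (1 / (2 * d)))"
      if "x \<noteq> 0" "d \<noteq> 0" "z \<noteq> 0" for x y z t d :: real
      using that by (simp add: field_simps)
    from this[OF nz] show ?thesis unfolding A S R W by (simp only:)
  next
    case 4
    then have "j < e" using k by simp
    define D where "D = a + b + 2 * real j + 1"
    define E where "E = real e - real j"
    define N where "N = real e + 1 + a + b + real j"
    have nz: "E \<noteq> 0" "D \<noteq> 0" "real j + 1 \<noteq> 0" "N \<noteq> 0"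
      unfolding D_def E_def N_def using \<open>j < e\<close> pos by (auto simp: add_nonneg_pos)
    have A: "bi_A c b a M k = - ((a + b + real j) * E / D)"
      unfolding 4 D_def E_def using nz(2)[unfolded D_def] by (simp add: bi_A_cases field_simps)
    have S: "sigma c (M - k) = 2 * E" "sigma a (Suc k) = 2 * (real j + 1)"
      unfolding 4 E_def using \<open>j < e\<close> by (simp_all add: sigma_even sigma_odd of_nat_diff)
    have R: "bR (b + a) (Suc k) (M - Suc k) = 2 * N / (2 * D * (2 * E))"
    proof -
      have "odd (M - Suc k)" using 4 \<open>j < e\<close> by auto
      moreover have "2 * real (Suc k) + real (M - Suc k) + 2 * (b + a) - 1 = 2 * N" "real (Suc k) + (b + a) - 1 = D"
        "real (M - Suc k) + 1 = 2 * E" unfolding rk D_def E_def N_def using 4 by simp_all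
      ultimately show ?thesis by (simp only: bR_def if_False)
    qed
    have "bi_weight a b c M (Suc k) = - (bi_weight a b c M k * ((- real e + real j) * (a + b + real j) / ((real j + 1) * N)))"
      using bi_weight_odd[of 0 a b c e "Suc j"] bi_weight_odd[of 1 a b c e j] unfolding 4 N_def by (simp add: pochhammer_Suc add_ac mult_ac)
    also have "- real e + real j = - E" by (simp add: E_def)
    finally have W: "bi_weight a b c M (Suc k) = bi_weight a b c M k * (E * (a + b + real j) / ((real j + 1) * N))" by simp
    have "x * y / (z * t) = - 2 * - (y * x / d) / (2 * x * (2 * z) * (2 * t / (2 * d * (2 * x))))"
      if "x \<noteq> 0" "d \<noteq> 0" "z \<noteq> 0" "t \<noteq> 0" for x y z t d :: real
      using that by (simp add: field_simps)
    from this[OF nz] show ?thesis unfolding A S R W by (simp only:)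
  qed
qed

lemma mix_weight_eq:
  assumes "0 < a" "0 < b" "0 < c"
  shows "k \<le> M \<Longrightarrow> mix_weight a b c M k = bi_weight a b c M k / bi_norm a b c M 0"
proof (induction k)
  case (Suc k)
  then show ?case by (simp add: mix_weight_Suc[OF assms] bi_weight_Suc[OF assms])
qed (use mix_weight_0[OF assms] in simp)

lemma mixing_weights:
  assumes g: "pos g" and "k \<le> M" "m \<le> M"
  shows "mixing g M m k = sqrt (bi_weight (g 0) (g (Suc 0)) (g (Suc (Suc 0))) M k / bi_norm (g 0) (g (Suc 0)) (g (Suc (Suc 0))) M m)
    * bi_B (g 0) (g (Suc 0)) (g (Suc (Suc 0))) M m ((theta (g 0 + g (Suc 0)) k - 1/2) / 2)"
proof -
  have abc: "0 < g 0" "0 < g (Suc 0)" "0 < g (Suc (Suc 0))" using g by auto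
  show ?thesis
    unfolding mixing_eq[OF g assms(2,3)] mix_weight_eq[OF abc assms(2)] bi_norm_prod[OF abc assms(3)] by simp
qed

section \<open>Recoupling of all sites\<close>

text \<open>The three-site overlap as an explicit function of its parameters, detached from the
  sites; \<open>mixing_weights\<close> identifies it with \<open>mixing\<close>.\<close>

definition recoupling :: "real \<Rightarrow> real \<Rightarrow> real \<Rightarrow> nat \<Rightarrow> nat \<Rightarrow> nat \<Rightarrow> real" where
  "recoupling a b c M m k = sqrt (bi_weight a b c M k / bi_norm a b c M m) * bi_B a b c M m ((theta (a + b) k - 1/2) / 2)"

abbreviation single :: "nat \<Rightarrow> nat list \<Rightarrow> real" where
  "single t \<equiv> \<lambda>x. of_bool (x = [t])"

lemma raise_op_single: "raise_op h (Suc 0) (single t) [u] = sqrt (sigma (h 0) (Suc t)) * single (Suc t) [u]"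
  by (cases u) auto

lemma raise_op_iota_single:
  assumes g: "pos g"
  shows "raise_op g (Suc (Suc (Suc 0))) (iota g p (iota (merge g p) q (single t))) [x, y, z]
    = sqrt (sigma (g 0 + g (Suc 0) + g (Suc (Suc 0)) + real (p + q)) (Suc t))
      * iota g p (iota (merge g p) q (single (Suc t))) [x, y, z]"
proof -
  have "raise_op g (Suc (Suc (Suc 0))) (iota g p (iota (merge g p) q (single t))) [x, y, z]
    = iota g p (iota (merge g p) q (raise_op (merge (merge g p) q) (Suc 0) (single t))) [x, y, z]"
    by (simp only: raise_op_iota[OF g] iota.simps raise_op_iota[OF pos_merge[OF g]])
  also have "\<dots> = sqrt (sigma (merge (merge g p) q 0) (Suc t)) * iota g p (iota (merge g p) q (single (Suc t))) [x, y, z]"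
    by (simp only: iota.simps raise_op_single) (simp only: mult_ac)
  also have "merge (merge g p) q 0 = g 0 + g (Suc 0) + g (Suc (Suc 0)) + real (p + q)" by simp
  finally show ?thesis .
qed

lemma raise_op_iota23_single:
  assumes g: "pos g"
  shows "raise_op g (Suc (Suc (Suc 0))) (iota23 g p (iota (merge23 g p) q (single t))) [x, y, z]
    = sqrt (sigma (g 0 + g (Suc 0) + g (Suc (Suc 0)) + real (p + q)) (Suc t))
      * iota23 g p (iota (merge23 g p) q (single (Suc t))) [x, y, z]"
proof -
  have "raise_op g (Suc (Suc (Suc 0))) (iota23 g p (iota (merge23 g p) q (single t))) [x, y, z]
    = iota23 g p (iota (merge23 g p) q (raise_op (merge (merge23 g p) q) (Suc 0) (single t))) [x, y, z]"
    by (simp only: raise_op_iota23[OF g] iota23.simps iota.simps raise_op_iota[OF pos_merge23[OF g]])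
  also have "\<dots> = sqrt (sigma (merge (merge23 g p) q 0) (Suc t)) * iota23 g p (iota (merge23 g p) q (single (Suc t))) [x, y, z]"
    by (simp only: iota23.simps iota.simps raise_op_single) (simp only: mult_ac)
  also have "merge (merge23 g p) q 0 = g 0 + g (Suc 0) + g (Suc (Suc 0)) + real (p + q)" by (simp add: add_ac)
  finally show ?thesis .
qed

lemma raise_op_sum: "raise_op g k (\<lambda>x. \<Sum>m\<in>A. c m * F m x) x = (\<Sum>m\<in>A. c m * raise_op g k (F m) x)"
proof (induction A rule: infinite_finite_induct)
  case (insert m A)
  then show ?case by (simp add: raise_op_add raise_op_cmult)
qed (simp_all add: raise_op_zero)

text \<open>For t = 0 this is \<open>Sv3_mixing\<close>. All terms lie in modules of the same
  parameter, so A_+ produces the same nonzero factor in each of them, and the coefficients do not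
  depend on t.\<close>

lemma recouple_single:
  assumes g: "pos g"
  shows "iota g p (iota (merge g p) q (single t)) [x, y, z]
    = (\<Sum>m\<le>p + q. mixing g (p + q) m p * iota23 g m (iota (merge23 g m) (p + q - m) (single t)) [x, y, z])"
proof (induction t arbitrary: x y z)
  case 0
  show ?case using Sv3_mixing[OF g, of p "p + q" "[x, y, z]"] by simp
next
  case (Suc t)
  let ?M = "p + q"
  let ?s = "sqrt (sigma (g 0 + g (Suc 0) + g (Suc (Suc 0)) + real ?M) (Suc t))"
  have "0 < g 0 + g (Suc 0) + g (Suc (Suc 0)) + real ?M" using g by (simp add: add_pos_pos add_pos_nonneg)
  then have s: "?s \<noteq> 0" using sigma_pos by (metis less_irrefl real_sqrt_gt_0_iff)
  have "?s * iota g p (iota (merge g p) q (single (Suc t))) [x, y, z]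
    = raise_op g (Suc (Suc (Suc 0))) (iota g p (iota (merge g p) q (single t))) [x, y, z]"
    by (rule raise_op_iota_single[OF g, symmetric])
  also have "\<dots> = raise_op g (Suc (Suc (Suc 0)))
     (\<lambda>r. \<Sum>m\<le>?M. mixing g ?M m p * iota23 g m (iota (merge23 g m) (?M - m) (single t)) r) [x, y, z]"
  proof (rule raise_op_cong)
    fix r :: "nat list" assume "length r = length [x, y, z]"
    then obtain a b c where "r = [a, b, c]" by (auto simp: length_Suc_conv)
    then show "iota g p (iota (merge g p) q (single t)) r
      = (\<Sum>m\<le>?M. mixing g ?M m p * iota23 g m (iota (merge23 g m) (?M - m) (single t)) r)"
      using Suc by (simp only:)
  qed
  also have "\<dots> = (\<Sum>m\<le>?M. mixing g ?M m p * (?s * iota23 g m (iota (merge23 g m) (?M - m) (single (Suc t))) [x, y, z]))"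
    unfolding raise_op_sum
    by (intro sum.cong refl) (simp only: raise_op_iota23_single[OF g] atMost_iff le_add_diff_inverse)
  also have "\<dots> = ?s * (\<Sum>m\<le>?M. mixing g ?M m p * iota23 g m (iota (merge23 g m) (?M - m) (single (Suc t))) [x, y, z])"
    unfolding sum_distrib_left by (simp only: mult.left_commute)
  finally show ?case by (simp only: mult_left_cancel[OF s])
qed

text \<open>After both merges the fourth and later sites are spectators, and the entry of the merged
  site is fixed by x, y, z; thus w factors out. Where an index would be truncated, \<open>cg\<close>
  makes both sides vanish.\<close>

lemma iota_iota_single:
  "iota g p (iota h q w) (x # y # z # r) = iota g p (iota h q (single (x + y + z - (p + q)))) [x, y, z] * w ((x + y + z - (p + q)) # r)"
proof (cases "p \<le> x + y \<and> q \<le> x + y - p + z")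
  case True
  then have "x + y - p + z - q = x + y + z - (p + q)" by simp
  then show ?thesis by simp
next
  case False
  then show ?thesis
    by (cases "p \<le> x + y") (simp_all add: cg_support)
qed

lemma iota23_iota_single:
  assumes "m \<le> M"
  shows "iota23 g m (iota h (M - m) w) (x # y # z # r)
    = iota23 g m (iota h (M - m) (single (x + y + z - M))) [x, y, z] * w ((x + y + z - M) # r)"
proof (cases "m \<le> y + z \<and> M - m \<le> x + (y + z - m)")
  case True
  then have "x + (y + z - m) - (M - m) = x + y + z - M" using assms by simp
  then show ?thesis by simp
next
  case False
  then show ?thesis
    by (cases "m \<le> y + z") (simp_all add: cg_support)
qed

lemma recouple:
  assumes g: "pos g"
  shows "iota g p (iota (merge g p) q w) (x # y # z # r)
    = (\<Sum>m\<le>p + q. mixing g (p + q) m p * iota23 g m (iota (merge23 g m) (p + q - m) w) (x # y # z # r))"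
  unfolding iota_iota_single[of g p "merge g p" q w] recouple_single[OF g] sum_distrib_right
  by (intro sum.cong refl) (simp only: atMost_iff iota23_iota_single[where w = w] mult.assoc)

text \<open>Both orders of merging give the first site the parameter of the first three sites plus p
  + q, so the later merges inside \<open>Sv\<close> are unaffected.\<close>

lemma merge_merge: "m \<le> p + q \<Longrightarrow> merge (merge g p) q = merge (merge23 g m) (p + q - m)"
  by (rule ext) (simp add: merge_def split: nat.split)

text \<open>One recoupling replaces the degrees p and q by x, for the sites 2 and 3, and p + q - x,
  for adding site 1. The first of them matches the head of j and leaves a problem with one site
  less.\<close>

fun overlap_prod :: "(nat \<Rightarrow> real) \<Rightarrow> nat list \<Rightarrow> nat list \<Rightarrow> real" where
  "overlap_prod g (x # y # j) (p # q # s) =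
     (if x \<le> p + q then recoupling (g 0) (g (Suc 0)) (g (Suc (Suc 0))) (p + q) x p * overlap_prod (merge23 g x) (y # j) ((p + q - x) # s)
      else 0)"
| "overlap_prod g _ _ = 1"

lemma ip_sum_right: "ip n N u (\<lambda>x. \<Sum>m\<in>A. c m * F m x) = (\<Sum>m\<in>A. c m * ip n N u (F m))"
  unfolding ip_def sum_distrib_left by (subst sum.swap) (simp add: mult_ac)

lemma ip_cong_right: "(\<And>x. length x = n \<Longrightarrow> v x = v' x) \<Longrightarrow> ip n N u v = ip n N u v'"
  unfolding ip_def by (intro sum.cong) (auto simp: deg_lists_def)

text \<open>\<open>recouple\<close> writes |s> as a sum over m of vectors in the images of
  \<open>iota23 g m\<close>, which are mutually orthogonal and isometrically embedded. As |j> lies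
  in the image for m = x, a single term survives.\<close>

lemma ip_Jv_Sv:
  "pos g \<Longrightarrow> length j = length s \<Longrightarrow> s \<noteq> [] \<Longrightarrow> sum_list j = sum_list s \<Longrightarrow>
    ip (Suc (length s)) (sum_list s) (Jv g j) (Sv g s) = overlap_prod g j s"
proof (induction g j s rule: overlap_prod.induct)
  case (1 g x y j p q s)
  let ?M = "p + q" and ?N = "sum_list (p # q # s)"
  let ?J = "Jv (merge23 g x) (y # j)"
  have "Sv g (p # q # s) r = (\<Sum>m\<le>?M. mixing g ?M m p * iota23 g m (Sv (merge23 g m) ((?M - m) # s)) r)"
    if len: "length r = Suc (length (p # q # s))" for r
  proof -
    obtain a b c t where r: "r = a # b # c # t" using len by (auto simp: length_Suc_conv)
    show ?thesis
      unfolding r Sv.simps recouple[OF 1(2)]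
      by (intro sum.cong refl) (simp only: atMost_iff merge_merge)
  qed
  then have "ip (Suc (length (p # q # s))) ?N (Jv g (x # y # j)) (Sv g (p # q # s))
    = (\<Sum>m\<le>?M. mixing g ?M m p * ip (Suc (length (p # q # s))) ?N (iota23 g x ?J) (iota23 g m (Sv (merge23 g m) ((?M - m) # s))))"
    unfolding ip_sum_right[symmetric] Jv.simps by (rule ip_cong_right)
  also have "\<dots> = (\<Sum>m\<le>?M. if m = x then mixing g ?M x p * ip (Suc (Suc (length s))) (?N - x) ?J (Sv (merge23 g x) ((?M - x) # s)) else 0)"
    by (intro sum.cong refl) (auto simp: ip_iota23[OF 1(2)] simp del: Jv.simps Sv.simps)
  also have "\<dots> = (if x \<le> ?M then mixing g ?M x p * ip (Suc (Suc (length s))) (?N - x) ?J (Sv (merge23 g x) ((?M - x) # s)) else 0)"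
    by (simp del: Jv.simps Sv.simps)
  also have "\<dots> = overlap_prod g (x # y # j) (p # q # s)"
  proof (cases "x \<le> ?M")
    case True
    have "ip (Suc (length ((?M - x) # s))) (sum_list ((?M - x) # s)) ?J (Sv (merge23 g x) ((?M - x) # s))
      = overlap_prod (merge23 g x) (y # j) ((?M - x) # s)"
      using 1 True by (intro 1(1) pos_merge23) auto
    moreover have "?N - x = sum_list ((?M - x) # s)" using True by simp
    ultimately show ?thesis
      using True mixing_weights[OF 1(2), of p ?M x] by (simp add: recoupling_def del: Jv.simps Sv.simps)
  qed simp
  finally show ?case .
next
  case ("2_1" g s)
  then show ?case by simp
next
  case ("2_2" g x s)
  then obtain p where "s = [p]" by (cases s) auto
  then show ?case using "2_2" ip_Sv[of g "[p]"] by simp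
next
  case ("2_3" g j)
  then show ?case by simp
next
  case ("2_4" g j p)
  then obtain x where "j = [x]" by (cases j) auto
  then show ?case using "2_4" ip_Sv[of g "[p]"] by simp
qed

text \<open>After i recouplings the sites 2 to i + 2 form a single site, whose parameter has grown
  by the degree j_1 + ... + j_i absorbed so far; the degrees of s are counted from there. The index
  i belongs to level i + 1 of the multivariate polynomials.\<close>

definition level_factor :: "(nat \<Rightarrow> real) \<Rightarrow> nat list \<Rightarrow> nat list \<Rightarrow> nat \<Rightarrow> real" where
  "level_factor g j s i = recoupling (g 0) (real (psum j i) + (\<Sum>t<Suc i. g (Suc t))) (g (Suc (Suc i)))
     (psum s (Suc (Suc i)) - psum j i) (j ! i) (psum s (Suc i) - psum j i)"

lemma psum_0 [simp]: "psum s 0 = 0"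
  by (simp add: psum_def)

lemma psum_Cons_Suc [simp]: "psum (a # s) (Suc i) = a + psum s i"
  by (simp add: psum_def)

lemma psum_Suc_ge: "psum s i \<le> psum s (Suc i)"
  by (cases "i < length s") (simp_all add: psum_def take_Suc_conv_app_nth)

text \<open>Replacing p and q by p + q - x lowers the later partial sums of s by x, just as dropping
  x lowers those of j, so the differences agree.\<close>

lemma level_factor_Suc:
  assumes "x \<le> p + q"
  shows "level_factor g (x # y # j) (p # q # s) (Suc i) = level_factor (merge23 g x) (y # j) ((p + q - x) # s) i"
proof -
  have "(\<Sum>t<Suc (Suc i). g (Suc t)) + real x = (\<Sum>t<Suc i. merge23 g x (Suc t))"
    by (simp add: sum.lessThan_Suc_shift del: sum.lessThan_Suc)
  then have "real (psum (x # y # j) (Suc i)) + (\<Sum>t<Suc (Suc i). g (Suc t))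
    = real (psum (y # j) i) + (\<Sum>t<Suc i. merge23 g x (Suc t))"
    by (simp del: sum.lessThan_Suc)
  moreover have "psum (p # q # s) (Suc (Suc (Suc i))) - psum (x # y # j) (Suc i)
      = psum ((p + q - x) # s) (Suc (Suc i)) - psum (y # j) i"
    "psum (p # q # s) (Suc (Suc i)) - psum (x # y # j) (Suc i) = psum ((p + q - x) # s) (Suc i) - psum (y # j) i"
    using assms by simp_all
  ultimately show ?thesis
    unfolding level_factor_def by (simp only: merge23_simps merge_simps nth_Cons_Suc)
qed

lemma overlap_prod_eq_prod:
  "length j = Suc L \<Longrightarrow> length s = Suc L \<Longrightarrow> sum_list j = sum_list s \<Longrightarrow>
    overlap_prod g j s = (if \<exists>i<L. psum s (Suc i) < psum j i then 0 else \<Prod>i<L. level_factor g j s i)"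
proof (induction g j s arbitrary: L rule: overlap_prod.induct)
  case (1 g x y j p q s)
  then obtain K where L: "L = Suc K" and K: "length j = K" by auto
  show ?case
  proof (cases "x \<le> p + q")
    case True
    let ?j = "y # j" and ?s = "(p + q - x) # s"
    have IH: "overlap_prod (merge23 g x) ?j ?s
      = (if \<exists>i<K. psum ?s (Suc i) < psum ?j i then 0 else \<Prod>i<K. level_factor (merge23 g x) ?j ?s i)"
      using 1 True K by (intro 1(1)) auto
    have "psum (p # q # s) (Suc (Suc i)) < psum (x # y # j) (Suc i) \<longleftrightarrow> psum ?s (Suc i) < psum ?j i" for i
      using True by auto
    then have bad: "(\<exists>i<L. psum (p # q # s) (Suc i) < psum (x # y # j) i) \<longleftrightarrow> (\<exists>i<K. psum ?s (Suc i) < psum ?j i)"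
      unfolding L Ex_less_Suc2 by simp
    have "(\<Prod>i<L. level_factor g (x # y # j) (p # q # s) i)
      = recoupling (g 0) (g (Suc 0)) (g (Suc (Suc 0))) (p + q) x p * (\<Prod>i<K. level_factor (merge23 g x) ?j ?s i)"
      unfolding L prod.lessThan_Suc_shift level_factor_Suc[OF True] by (simp add: level_factor_def)
    then show ?thesis
      using True by (cases "\<exists>i<K. psum ?s (Suc i) < psum ?j i")
        (simp_all only: bad IH overlap_prod.simps if_True if_False mult_zero_right)
  next
    case False
    \<comment> \<open>With only two entries in each list, x + y = p + q would contradict x > p + q.
      So a level with index i = 1 exists, and it violates the condition.\<close>
    then have "K \<noteq> 0" using 1 K by (cases j) auto
    then have "Suc 0 < L" "psum (p # q # s) (Suc (Suc 0)) < psum (x # y # j) (Suc 0)" using L False by auto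
    then show ?thesis using False by auto
  qed
qed auto

section \<open>Specialization of the parameters\<close>

context
  fixes \<gamma> :: "nat \<Rightarrow> real" and d :: "nat \<Rightarrow> nat" and k :: nat
  assumes k: "1 \<le> k"
begin

private lemma sum_alpha: "1 \<le> m \<Longrightarrow> (\<Sum>t = 1..m. alpha_of \<gamma> t) = 2 * (\<Sum>t = 1..m + 1. \<gamma> t) - 1"
proof (induction m rule: dec_induct)
  case base
  then show ?case by (simp add: alpha_of_def numeral_2_eq_2)
next
  case (step m)
  then show ?case by (simp add: alpha_of_def)
qed

text \<open>The parameter of the site into which the sites 2 to k + 1 have been merged with total
  degree N_{k-1}. Level k is thus the three-site problem with a = \<gamma>_1, b = B and c =
  \<gamma>_{k+2}.\<close>

private abbreviation "B \<equiv> real (Nprev d k) + (\<Sum>t = 2..k + 1. \<gamma> t)"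

private lemma sum_split: "(\<Sum>t = 1..k + 1. \<gamma> t) = \<gamma> 1 + (\<Sum>t = 2..k + 1. \<gamma> t)"
  using k by (subst sum.atLeast_Suc_atMost) (simp_all add: numeral_2_eq_2)

lemma par_rho1_eq: "par_rho1 (alpha_of \<gamma>) d k = (\<gamma> 1 + B - 1) / 2"
  unfolding par_rho1_def sum_alpha[OF k] sum_split by (simp add: field_simps)

lemma BI_X_eq:
  assumes "Nprev d k \<le> y"
  shows "BI_X (alpha_of \<gamma>) d y k = par_x (\<gamma> 1) B (\<gamma> (k + 2)) (y - Nprev d k)"
proof -
  have "(-1) ^ (Nprev d k + y) = ((-1) ^ (y - Nprev d k) :: real)"
    using assms by (simp add: minus_one_power_iff)
  moreover have "(\<Sum>t = 1..k + 1. alpha_of \<gamma> t) = 2 * (\<gamma> 1 + (\<Sum>t = 2..k + 1. \<gamma> t) + \<gamma> (k + 2)) - 1"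
    using k by (subst sum_alpha) (simp_all add: sum_split[simplified])
  moreover have "real (y - Nprev d k) = real y - real (Nprev d k)" using assms by simp
  ultimately show ?thesis unfolding BI_X_def par_x_def by (simp only:) (simp add: field_simps)
qed

lemma par_rho2_eq:
  "Nprev d k \<le> y \<Longrightarrow> par_rho2 (alpha_of \<gamma>) d y k
    = par_x (\<gamma> 1) B (\<gamma> (k + 2)) (y - Nprev d k) + (2 * \<gamma> (k + 2) - 1) / 4"
  using k by (simp add: par_rho2_def BI_X_eq alpha_of_def)

lemma par_r1_eq:
  "Nprev d k \<le> y \<Longrightarrow> par_r1 (alpha_of \<gamma>) d y k
    = par_x (\<gamma> 1) B (\<gamma> (k + 2)) (y - Nprev d k) - (2 * \<gamma> (k + 2) - 1) / 4"
  using k by (simp add: par_r1_def BI_X_eq alpha_of_def)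

lemma par_r2_eq: "par_r2 (alpha_of \<gamma>) (beta_of \<gamma>) d k = (\<gamma> 1 - B) / 2"
proof -
  have "(\<Sum>t = 1..k. alpha_of \<gamma> t) = alpha_of \<gamma> 1 + (\<Sum>t = 2..k. alpha_of \<gamma> t)"
    using k by (subst sum.atLeast_Suc_atMost) (simp_all add: numeral_2_eq_2)
  then have "(\<Sum>t = 2..k. alpha_of \<gamma> t) = 2 * (\<gamma> 1 + (\<Sum>t = 2..k + 1. \<gamma> t)) - 1 - alpha_of \<gamma> 1"
    unfolding sum_alpha[OF k] sum_split by simp
  then show ?thesis
    unfolding par_r2_def beta_of_def by (simp only:) (simp add: alpha_of_def field_simps)
qed

lemma BI_argument_eq:
  assumes "Nprev d k \<le> x"
  shows "(-1) ^ (Nprev d k + x) / 2 * (real x + (\<Sum>t = 1..k. alpha_of \<gamma> t) / 2) - 1/4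
    = (theta (\<gamma> 1 + B) (x - Nprev d k) - 1/2) / 2"
proof -
  have "(-1) ^ (Nprev d k + x) = ((-1) ^ (x - Nprev d k) :: real)"
    using assms by (simp add: minus_one_power_iff)
  moreover have "real (x - Nprev d k) = real x - real (Nprev d k)" using assms by simp
  ultimately show ?thesis
    unfolding theta_def sum_alpha[OF k] sum_split by (simp only:) (simp add: field_simps)
qed

end

text \<open>The real square root, continued as an odd function, is multiplicative on all reals, so
  the factors can be separated whatever their signs.\<close>

lemma sqrt_prod: "sqrt (\<Prod>i\<in>A. f i) = (\<Prod>i\<in>A. sqrt (f i))"
  by (induction A rule: infinite_finite_induct) (simp_all add: real_sqrt_mult)

text \<open>The norms in the denominator of \<Omega> stop at level n - 3 and H supplies level n - 2,
  so that each level has one weight, one norm and one polynomial, which together form a recoupling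
  coefficient.\<close>

lemma C_coeff_multi_BI:
  assumes n: "3 \<le> n" and len: "length j = n - 1" "length s = n - 1"
  shows "C_coeff \<gamma> n s j * multi_BI (n - 2) (\<lambda>k. j ! (k - 1)) (psum s) (alpha_of \<gamma>) (beta_of \<gamma>) (psum s (n - 1))
    = (if \<exists>i<n - 2. psum s (Suc i) < psum j i then 0 else \<Prod>i<n - 2. level_factor (site_pars \<gamma> n) j s i)"
proof -
  let ?d = "\<lambda>k. j ! (k - 1)" and ?\<alpha> = "alpha_of \<gamma>" and ?\<beta> = "beta_of \<gamma>" and ?L = "n - 2"
  \<comment> \<open>The convention for x_{s+1} changes nothing here: the partial sum of s at n - 1
    is the prescribed N.\<close>
  have upd: "(psum s)(?L + 1 := psum s (n - 1)) = psum s"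
    using n by (intro fun_upd_idem) (simp add: Suc_diff_Suc numeral_2_eq_2)
  have Nprev: "Nprev ?d (Suc i) = psum j i" if "i < ?L" for i
  proof -
    have "Nprev ?d (Suc i) = (\<Sum>t<i. j ! t)"
      unfolding Nprev_def by (intro sum.reindex_bij_witness[of _ Suc "\<lambda>t. t - 1"]) auto
    then show ?thesis
      using that len by (simp add: psum_def sum_list_sum_nth min_def lessThan_atLeast0)
  qed
  have bad: "(\<exists>i\<in>{1..?L}. psum s i < Nprev ?d i) \<longleftrightarrow> (\<exists>i<?L. psum s (Suc i) < psum j i)"
  proof
    assume "\<exists>i\<in>{1..?L}. psum s i < Nprev ?d i"
    then obtain i where i: "i \<in> {1..?L}" "psum s i < Nprev ?d i" by blast
    then obtain m where "i = Suc m" by (cases i) auto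
    then show "\<exists>i<?L. psum s (Suc i) < psum j i" using i Nprev[of m] by (intro exI[of _ m]) auto
  next
    assume "\<exists>i<?L. psum s (Suc i) < psum j i"
    then obtain i where "i < ?L" "psum s (Suc i) < psum j i" by blast
    then show "\<exists>i\<in>{1..?L}. psum s i < Nprev ?d i" using Nprev[of i] by (intro bexI[of _ "Suc i"]) auto
  qed
  show ?thesis
  proof (cases "\<exists>i<?L. psum s (Suc i) < psum j i")
    case True
    then show ?thesis unfolding C_coeff_def Omega_def bad by simp
  next
    case False
    define W where "W i = level_weight (psum s) ?d ?\<alpha> ?\<beta> i" for i
    define H where "H i = level_norm (psum s (i + 1)) ?d ?\<alpha> ?\<beta> i" for i
    define P where "P i = BI_poly (par_rho1 ?\<alpha> ?d i) (par_rho2 ?\<alpha> ?d (psum s (i + 1)) i)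
        (par_r1 ?\<alpha> ?d (psum s (i + 1)) i) (par_r2 ?\<alpha> ?\<beta> ?d i) (?d i)
        ((-1) ^ (Nprev ?d i + psum s i) / 2 * (real (psum s i) + (\<Sum>t = 1..i. ?\<alpha> t) / 2) - 1/4)" for i
    have L: "?L = Suc (?L - 1)" "n - 1 = Suc ?L" using n by auto
    have "Hnorm ?L ?d ?\<alpha> ?\<beta> (psum s (n - 1)) = H ?L"
      unfolding Hnorm_def H_def L(2) by simp
    moreover have "Omega ?L (psum s) ?d ?\<alpha> ?\<beta> (psum s (n - 1)) = (\<Prod>i = 1..?L. W i) / (\<Prod>i = 1..?L - 1. H i)"
      unfolding Omega_def bad upd W_def H_def using False by (simp only: if_False)
    moreover have "(\<Prod>i = 1..?L. H i) = (\<Prod>i = 1..?L - 1. H i) * H ?L"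
    proof -
      obtain K where "?L = Suc K" using L(1) by blast
      then show ?thesis by simp
    qed
    ultimately have "C_coeff \<gamma> n s j = (\<Prod>i = 1..?L. sqrt (W i / H i))"
      unfolding C_coeff_def by (simp add: prod_dividef flip: sqrt_prod)
    moreover have "multi_BI ?L ?d (psum s) ?\<alpha> ?\<beta> (psum s (n - 1)) = (\<Prod>i = 1..?L. P i)"
      unfolding multi_BI_def upd Let_def P_def by (rule refl)
    ultimately have "C_coeff \<gamma> n s j * multi_BI ?L ?d (psum s) ?\<alpha> ?\<beta> (psum s (n - 1))
      = (\<Prod>i = 1..?L. sqrt (W i / H i) * P i)"
      by (simp only: prod.distrib)
    also have "\<dots> = (\<Prod>i<?L. sqrt (W (Suc i) / H (Suc i)) * P (Suc i))"
      unfolding One_nat_def by (rule prod.atLeast1_atMost_eq)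
    also have "\<dots> = (\<Prod>i<?L. level_factor (site_pars \<gamma> n) j s i)"
    proof (rule prod.cong[OF refl])
      fix i assume "i \<in> {..<?L}"
      then have i: "i < ?L" by simp
      have le: "Nprev ?d (Suc i) \<le> psum s (Suc i)" using False i Nprev[OF i] by auto
      have le': "Nprev ?d (Suc i) \<le> psum s (Suc i + 1)" using le psum_Suc_ge[of s "Suc i"] by simp
      have k: "1 \<le> Suc i" by simp
      let ?b = "real (Nprev ?d (Suc i)) + (\<Sum>t = 2..Suc i + 1. \<gamma> t)"
      have "(\<Sum>t<Suc i. site_pars \<gamma> n (Suc t)) = (\<Sum>t<Suc i. \<gamma> (t + 2))"
        using i by (intro sum.cong) (auto simp: site_pars_def)
      also have "\<dots> = (\<Sum>t = 2..Suc i + 1. \<gamma> t)"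
        by (rule sum.reindex_bij_witness[of _ "\<lambda>t. t - 2" "\<lambda>t. t + 2"]) auto
      finally have sum_eq: "(\<Sum>t<Suc i. site_pars \<gamma> n (Suc t)) = (\<Sum>t = 2..Suc i + 1. \<gamma> t)" .
      have "site_pars \<gamma> n 0 = \<gamma> 1" "site_pars \<gamma> n (Suc (Suc i)) = \<gamma> (Suc i + 2)"
        using i n by (simp_all add: site_pars_def less_diff_conv)
      then have "level_factor (site_pars \<gamma> n) j s i
        = recoupling (\<gamma> 1) ?b (\<gamma> (Suc i + 2)) (psum s (Suc i + 1) - Nprev ?d (Suc i)) (?d (Suc i)) (psum s (Suc i) - Nprev ?d (Suc i))"
        unfolding level_factor_def Nprev[OF i] sum_eq by (simp only: Suc_eq_plus1[symmetric] diff_Suc_1)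
      moreover have "W (Suc i) = bi_weight (\<gamma> 1) ?b (\<gamma> (Suc i + 2)) (psum s (Suc i + 1) - Nprev ?d (Suc i)) (psum s (Suc i) - Nprev ?d (Suc i))"
        unfolding W_def level_weight_def bi_weight_def par_rho1_eq[OF k] par_rho2_eq[OF k le'] par_r1_eq[OF k le'] par_r2_eq[OF k] ..
      moreover have "H (Suc i) = bi_norm (\<gamma> 1) ?b (\<gamma> (Suc i + 2)) (psum s (Suc i + 1) - Nprev ?d (Suc i)) (?d (Suc i))"
        unfolding H_def level_norm_def bi_norm_def par_rho1_eq[OF k] par_rho2_eq[OF k le'] par_r1_eq[OF k le'] par_r2_eq[OF k] ..
      moreover have "P (Suc i) = bi_B (\<gamma> 1) ?b (\<gamma> (Suc i + 2)) (psum s (Suc i + 1) - Nprev ?d (Suc i)) (?d (Suc i))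
          ((theta (\<gamma> 1 + ?b) (psum s (Suc i) - Nprev ?d (Suc i)) - 1/2) / 2)"
        unfolding P_def bi_B_def par_rho1_eq[OF k] par_rho2_eq[OF k le'] par_r1_eq[OF k le'] par_r2_eq[OF k] BI_argument_eq[OF k le] ..
      ultimately show "sqrt (W (Suc i) / H (Suc i)) * P (Suc i) = level_factor (site_pars \<gamma> n) j s i"
        by (simp only: recoupling_def)
    qed
    finally show ?thesis using False by (simp only: if_False)
  qed
qed

section \<open>Overlaps of arbitrary unit eigenvectors\<close>

theorem theorem3:
  fixes n :: nat and \<gamma> :: "nat \<Rightarrow> real"
  assumes "n \<ge> 3" and "\<And>i. i \<in> {1..n} \<Longrightarrow> \<gamma> i > 1/2"
  shows "(\<forall>s. length s = n - 1 \<longrightarrow> (\<exists>v. is_s_vector \<gamma> n s v)) \<and>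
         (\<forall>j. length j = n - 1 \<longrightarrow> (\<exists>v. is_j_vector \<gamma> n j v)) \<and>
         (\<forall>S J :: nat list \<Rightarrow> tvec.
            (\<forall>s. length s = n - 1 \<longrightarrow> is_s_vector \<gamma> n s (S s)) \<longrightarrow>
            (\<forall>j. length j = n - 1 \<longrightarrow> is_j_vector \<gamma> n j (J j)) \<longrightarrow>
            (\<exists>\<theta> \<phi> :: nat list \<Rightarrow> complex.
               (\<forall>s. norm (\<theta> s) = 1) \<and> (\<forall>j. norm (\<phi> j) = 1) \<and>
               (\<forall>j s. length j = n - 1 \<longrightarrow> length s = n - 1 \<longrightarrow>
                  overlap (\<lambda>x. \<phi> j * J j x) (\<lambda>x. \<theta> s * S s x) =
                  of_real (of_bool (psum s (n-1) = psum j (n-1)) *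
                    C_coeff \<gamma> n s j *
                    multi_BI (n-2) (\<lambda>k. j ! (k-1)) (psum s) (alpha_of \<gamma>) (beta_of \<gamma>)
                      (psum s (n-1))))))"
proof (intro conjI allI impI)
  fix s :: "nat list" assume "length s = n - 1"
  then have "n = Suc (length s)" using assms(1) by simp
  then show "\<exists>v. is_s_vector \<gamma> n s v" using is_s_vector_Sv[of n \<gamma> s] assms(2) by blast
next
  fix j :: "nat list" assume "length j = n - 1"
  then have "n = Suc (length j)" "j \<noteq> []" using assms(1) by auto
  then show "\<exists>v. is_j_vector \<gamma> n j v" using is_j_vector_Jv[of n \<gamma> j] assms(2) by blast
next
  fix S J :: "nat list \<Rightarrow> tvec"
  assume S: "\<forall>s. length s = n - 1 \<longrightarrow> is_s_vector \<gamma> n s (S s)"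
    and J: "\<forall>j. length j = n - 1 \<longrightarrow> is_j_vector \<gamma> n j (J j)"
  let ?g = "site_pars \<gamma> n"
  have pg: "pos ?g" using assms(2) by (rule pos_site_pars)
  \<comment> \<open>Lists of another length get the phase 1, since the phases have to be of modulus
    1 at all lists.\<close>
  have "\<exists>c. norm c = 1 \<and> (length s = n - 1 \<longrightarrow> S s = (\<lambda>x. c * of_real (Sv ?g s x)))" for s
  proof (cases "length s = n - 1")
    case True
    then have "n = Suc (length s)" using assms(1) by simp
    then show ?thesis using is_s_vector_unique[of n \<gamma> s "S s"] assms(2) S True by blast
  next
    case False
    then show ?thesis by (intro exI[of _ 1]) simp
  qed
  then obtain cS where cS: "\<And>s. norm (cS s) = 1"
    "\<And>s. length s = n - 1 \<Longrightarrow> S s = (\<lambda>x. cS s * of_real (Sv ?g s x))" by metis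
  have "\<exists>c. norm c = 1 \<and> (length j = n - 1 \<longrightarrow> J j = (\<lambda>x. c * of_real (Jv ?g j x)))" for j
  proof (cases "length j = n - 1")
    case True
    then have "n = Suc (length j)" "j \<noteq> []" using assms(1) by auto
    then show ?thesis using is_j_vector_unique[of n \<gamma> j "J j"] assms(2) J True by blast
  next
    case False
    then show ?thesis by (intro exI[of _ 1]) simp
  qed
  then obtain cJ where cJ: "\<And>j. norm (cJ j) = 1"
    "\<And>j. length j = n - 1 \<Longrightarrow> J j = (\<lambda>x. cJ j * of_real (Jv ?g j x))" by metis
  have unit: "cnj z * (z * w) = w" if "norm z = 1" for z w :: complex
  proof -
    have "cnj z * z = 1" using complex_norm_square[of z] that by (simp add: mult.commute)
    then show ?thesis by (simp only: mult.assoc[symmetric] mult_1_left)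
  qed
  have main: "overlap (\<lambda>x. cnj (cJ j) * J j x) (\<lambda>x. cnj (cS s) * S s x) =
      of_real (of_bool (psum s (n-1) = psum j (n-1)) * C_coeff \<gamma> n s j *
        multi_BI (n-2) (\<lambda>k. j ! (k-1)) (psum s) (alpha_of \<gamma>) (beta_of \<gamma>) (psum s (n-1)))"
    if len: "length j = n - 1" "length s = n - 1" for j s
  proof -
    have n: "n = Suc (length s)" "n = Suc (length j)" "length j = Suc (n - 2)" "length s = Suc (n - 2)" "s \<noteq> []"
      using len assms(1) by auto
    have ov: "overlap (\<lambda>x. cnj (cJ j) * J j x) (\<lambda>x. cnj (cS s) * S s x)
      = of_real (ip n (sum_list j) (Jv ?g j) (Sv ?g s))"
      unfolding cS(2)[OF len(2)] cJ(2)[OF len(1)] unit[OF cS(1)] unit[OF cJ(1)]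
      by (rule overlap_of_real) (use Jv_support[of ?g j] n(2) in simp)
    have ps: "psum s (n - 1) = sum_list s" "psum j (n - 1) = sum_list j"
      using len by (simp_all only: psum_full)
    show ?thesis
    proof (cases "sum_list s = sum_list j")
      case True
      have "ip (Suc (length s)) (sum_list s) (Jv ?g j) (Sv ?g s) = overlap_prod ?g j s"
        using len True n(5) by (intro ip_Jv_Sv pg) auto
      then have "ip n (sum_list j) (Jv ?g j) (Sv ?g s) = overlap_prod ?g j s"
        unfolding n(1)[symmetric] True .
      also have "\<dots> = C_coeff \<gamma> n s j *
        multi_BI (n-2) (\<lambda>k. j ! (k-1)) (psum s) (alpha_of \<gamma>) (beta_of \<gamma>) (psum s (n-1))"
        unfolding C_coeff_multi_BI[OF assms(1) len] using n(3,4) True by (intro overlap_prod_eq_prod) auto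
      finally show ?thesis unfolding ov using True ps by simp
    next
      case False
      \<comment> \<open>Vectors of different total degree have disjoint supports, which accounts for
        the Kronecker delta.\<close>
      have "Sv ?g s x = 0" if "x \<in> deg_lists n (sum_list j)" for x
        using Sv_support[of ?g s x] that False by (auto simp: deg_lists_def)
      then have "ip n (sum_list j) (Jv ?g j) (Sv ?g s) = 0" by (simp add: ip_def)
      then show ?thesis unfolding ov using False ps by simp
    qed
  qed
  show "\<exists>\<theta> \<phi> :: nat list \<Rightarrow> complex.
      (\<forall>s. norm (\<theta> s) = 1) \<and> (\<forall>j. norm (\<phi> j) = 1) \<and>
      (\<forall>j s. length j = n - 1 \<longrightarrow> length s = n - 1 \<longrightarrow>
        overlap (\<lambda>x. \<phi> j * J j x) (\<lambda>x. \<theta> s * S s x) =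
        of_real (of_bool (psum s (n-1) = psum j (n-1)) * C_coeff \<gamma> n s j *
          multi_BI (n-2) (\<lambda>k. j ! (k-1)) (psum s) (alpha_of \<gamma>) (beta_of \<gamma>) (psum s (n-1))))"
  \<comment> \<open>The conjugate phases turn the given vectors into the real vectors
    \<open>Sv\<close> and \<open>Jv\<close>, whose signs are already the right ones.\<close>
  proof (rule exI[of _ "\<lambda>s. cnj (cS s)"], rule exI[of _ "\<lambda>j. cnj (cJ j)"], intro conjI allI impI)
    show "norm (cnj (cS s)) = 1" for s by (simp add: cS(1))
    show "norm (cnj (cJ j)) = 1" for j by (simp add: cJ(1))
  qed (rule main)
qed

end
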